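(* Let $L$ be a finite-dimensional solvable transitive local Lie algebra of vector fields on $\mathbb{R}^n$. Then there exist local coordinates $y^1,\dots,y^n$ in a neighbourhood of $0\in\mathbb{R}^n$ such that, for every $X\in L$ written as $X=\sum_{i=1}^n c^i\,\partial_{y^i}$, all coefficients $c^i$ lie in the associative algebra (over $\mathbb{C}$) of functions generated by the functions $y^i$ and the exponentials $\exp(\lambda y^i)$, $i=1,\dots,n$, $\lambda\in\mathbb{C}$.
   Context: A local transitive Lie algebra $L$ of vector fields on $\mathbb{R}^n$ is a (real) Lie algebra, with the Lie bracket of vector fields, of smooth vector fields defined in a connected neighbourhood $U$ of $0\in\mathbb{R}^n$ which span the whole tangent space $T_0\mathbb{R}^n$ at $0$; equivalently, after shrinking $U$, they span $T_x\mathbb{R}^n$ for all $x\in U$. *)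

theory Defs
  imports "HOL-Analysis.Analysis" "HOL-Library.Function_Algebras"
begin

text \<open>Pointwise real vector space structure on functions; the additive structure is the one of
  \<open>HOL-Library.Function_Algebras\<close>. It makes \<open>subspace\<close> and \<open>span\<close> available for
  sets of vector fields.\<close>

instantiation "fun" :: (type, real_vector) real_vector
begin

definition scaleR_fun :: "real \<Rightarrow> ('a \<Rightarrow> 'b) \<Rightarrow> 'a \<Rightarrow> 'b" where
  "scaleR_fun r f = (\<lambda>x. r *\<^sub>R f x)"

instance
  by standard (auto simp: scaleR_fun_def fun_eq_iff scaleR_add_right scaleR_add_left)

end

text \<open>\<open>C\<^sup>k\<close> and \<open>C\<^sup>\<infinity>\<close> maps; only meant for open \<open>S\<close>, where the Frechet derivative
  at a point of \<open>S\<close> does not depend on the values outside \<open>S\<close>.\<close>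

fun Ck_on :: "nat \<Rightarrow> 'a::real_normed_vector set \<Rightarrow> ('a \<Rightarrow> 'b::real_normed_vector) \<Rightarrow> bool" where
  "Ck_on 0 S f \<longleftrightarrow> continuous_on S f"
| "Ck_on (Suc k) S f \<longleftrightarrow>
     (\<forall>x\<in>S. f differentiable (at x)) \<and> (\<forall>v. Ck_on k S (\<lambda>x. frechet_derivative f (at x) v))"

definition smooth_on :: "'a::real_normed_vector set \<Rightarrow> ('a \<Rightarrow> 'b::real_normed_vector) \<Rightarrow> bool" where
  "smooth_on S f \<longleftrightarrow> (\<forall>k. Ck_on k S f)"

text \<open>A vector field on \<open>U\<close> is represented by a total function that is \<open>0\<close> outside \<open>U\<close>, so
  that equality of functions is equality of vector fields on \<open>U\<close>.\<close>

definition vector_fields :: "(real^'n) set \<Rightarrow> (real^'n \<Rightarrow> real^'n) set" where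
  "vector_fields U = {X. smooth_on U X \<and> (\<forall>x. x \<notin> U \<longrightarrow> X x = 0)}"

text \<open>In coordinates, \<open>[X,Y]\<^sup>i = \<Sum>j. X\<^sup>j \<partial>\<^sub>jY\<^sup>i - Y\<^sup>j \<partial>\<^sub>jX\<^sup>i\<close>.\<close>

definition lie_bracket ::
    "(real^'n) set \<Rightarrow> (real^'n \<Rightarrow> real^'n) \<Rightarrow> (real^'n \<Rightarrow> real^'n) \<Rightarrow> real^'n \<Rightarrow> real^'n" where
  "lie_bracket U X Y = (\<lambda>x. if x \<in> U
     then frechet_derivative Y (at x) (X x) - frechet_derivative X (at x) (Y x) else 0)"

definition local_lie_algebra :: "(real^'n) set \<Rightarrow> (real^'n \<Rightarrow> real^'n) set \<Rightarrow> bool" where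
  "local_lie_algebra U L \<longleftrightarrow>
     open U \<and> connected U \<and> 0 \<in> U \<and> L \<subseteq> vector_fields U \<and> subspace L \<and>
     (\<forall>X\<in>L. \<forall>Y\<in>L. lie_bracket U X Y \<in> L)"

definition transitive_at_0 :: "(real^'n \<Rightarrow> real^'n) set \<Rightarrow> bool" where
  "transitive_at_0 L \<longleftrightarrow> span {X 0 | X. X \<in> L} = UNIV"

definition finite_dimensional :: "'a::real_vector set \<Rightarrow> bool" where
  "finite_dimensional L \<longleftrightarrow> (\<exists>B. finite B \<and> B \<subseteq> L \<and> L \<subseteq> span B)"

definition derived_algebra ::
    "(real^'n) set \<Rightarrow> (real^'n \<Rightarrow> real^'n) set \<Rightarrow> (real^'n \<Rightarrow> real^'n) set" where
  "derived_algebra U L = span {lie_bracket U X Y | X Y. X \<in> L \<and> Y \<in> L}"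

definition solvable_lie_algebra :: "(real^'n) set \<Rightarrow> (real^'n \<Rightarrow> real^'n) set \<Rightarrow> bool" where
  "solvable_lie_algebra U L \<longleftrightarrow> (\<exists>k. (derived_algebra U ^^ k) L = {0})"

text \<open>The coordinate functions on \<open>V\<close> are the components \<open>\<lambda>x. y x $ i\<close>.\<close>

definition local_coordinates :: "(real^'n) set \<Rightarrow> (real^'n \<Rightarrow> real^'n) \<Rightarrow> bool" where
  "local_coordinates V y \<longleftrightarrow>
     open V \<and> smooth_on V y \<and> inj_on y V \<and> open (y ` V) \<and> smooth_on (y ` V) (inv_into V y)"

text \<open>The coordinate vector field \<open>\<partial>/\<partial>y\<^sup>i\<close>, i.e. the image of the \<open>i\<close>-th standard vector field
  under the inverse chart.\<close>

definition coord_field ::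
    "(real^'n) set \<Rightarrow> (real^'n \<Rightarrow> real^'n) \<Rightarrow> 'n \<Rightarrow> real^'n \<Rightarrow> real^'n" where
  "coord_field V y i = (\<lambda>x. frechet_derivative (inv_into V y) (at (y x)) (axis i 1))"

inductive_set generated_algebra :: "('a \<Rightarrow> complex) set \<Rightarrow> ('a \<Rightarrow> complex) set"
  for G :: "('a \<Rightarrow> complex) set" where
  zero: "(\<lambda>x. 0) \<in> generated_algebra G"
| generator: "f \<in> G \<Longrightarrow> f \<in> generated_algebra G"
| add: "f \<in> generated_algebra G \<Longrightarrow> g \<in> generated_algebra G \<Longrightarrow>
    (\<lambda>x. f x + g x) \<in> generated_algebra G"
| scale: "f \<in> generated_algebra G \<Longrightarrow> (\<lambda>x. a * f x) \<in> generated_algebra G"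
| mult: "f \<in> generated_algebra G \<Longrightarrow> g \<in> generated_algebra G \<Longrightarrow>
    (\<lambda>x. f x * g x) \<in> generated_algebra G"

text \<open>The constants are included: \<open>exp (0 * y\<^sup>i) = 1\<close>.\<close>

definition poly_exp_algebra :: "(real^'n \<Rightarrow> real^'n) \<Rightarrow> (real^'n \<Rightarrow> complex) set" where
  "poly_exp_algebra y = generated_algebra
     ({\<lambda>x. complex_of_real (y x $ i) | i. True} \<union>
      {\<lambda>x. exp (l * complex_of_real (y x $ i)) | l i. True})"

end

theory Submission
  imports Defs "HOL-Computational_Algebra.Fundamental_Theorem_Algebra"
begin

text \<open>Write \<open>g\<^sub>k\<close> for the derived series of \<open>L\<close> and \<open>H\<^sub>k\<close> for the space of values of \<open>g\<^sub>k\<close> at \<open>0\<close>.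
  Choose \<open>Y\<^sub>1, \<dots>, Y\<^sub>n\<close> block by block, the \<open>k\<close>-th block in \<open>g\<^sub>k\<close> with values at \<open>0\<close> a basis of a complement
  of \<open>H\<^bsub>k+1\<^esub>\<close> in \<open>H\<^sub>k\<close>. The chart is the inverse of the canonical coordinates of the second kind
  \<open>u(y) = exp(y\<^sub>1 Y\<^sub>1) \<dots> exp(y\<^sub>n Y\<^sub>n) 0\<close>, whose coordinate fields are
  \<open>Z\<^sub>i(y) = Ad(exp(y\<^sub>1 Y\<^sub>1) \<dots> exp(y\<^bsub>i-1\<^esub> Y\<^bsub>i-1\<^esub>)) Y\<^sub>i\<close> at \<open>u(y)\<close>; here
  \<open>ad\<close> belongs to the opposite \<open>br V W = [W, V]\<close> of the bracket of vector fields. No flows are needed: the curves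
  \<open>exp(t ad Y)\<close> in \<open>L\<close> are exponential polynomials, the \<open>Z\<^sub>i\<close> are defined from them algebraically and
  satisfy \<open>\<partial>\<^sub>j Z\<^sub>i - \<partial>\<^sub>i Z\<^sub>j = ad(Z\<^sub>j) Z\<^sub>i\<close> for \<open>j < i\<close>, and this is the integrability condition of
  \<open>\<partial>\<^sub>i u = Z\<^sub>i(y)(u)\<close>. The isotropy algebra at \<open>u(y)\<close> is the image of the one at \<open>0\<close> under
  \<open>Ad(exp(y\<^sub>1 Y\<^sub>1) \<dots> exp(y\<^sub>n Y\<^sub>n))\<close>. Since each block commutes modulo the next ideal, the
  decomposition of \<open>X\<close> along the \<open>Z\<^sub>i(y)\<close> and this isotropy algebra is computed block by block
  from exponential polynomials without any division.\<close>

section \<open>Smooth maps\<close>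

text \<open>Expressing a field in the coordinate fields at a point amounts to inverting the matrix
  of their components, and exponential polynomials are not stable under the quotients this creates.
  Hence the decomposition takes place in \<open>L\<close>, before evaluation at a point. Since
  \<open>L\<close> may have more than n dimensions, a complement of the span of the
  \<open>Z\<^sub>i(y)\<close> is needed, and the transported isotropy algebra is the right one
  because its members vanish at \<open>u(y)\<close>. Solvability makes the elimination block
  triangular with identity blocks on the diagonal. The derived series replaces a complete flag of
  ideals, which a real solvable algebra need not have: the eigenvalues of \<open>ad Y\<close> may be
  complex, which is also why complex exponents occur for real fields. The bracket is reversed
  because pushing a field W forward along the flow of Y has derivative -[Y, W]; for
  \<open>br\<close> this is \<open>ad Y\<close> applied to W, and the transport is
  \<open>exp(t ad Y)\<close> without signs.\<close>

lemma Ck_on_cong: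
  assumes "open S" "\<And>x. x \<in> S \<Longrightarrow> f x = g x" "Ck_on k S f"
  shows "Ck_on k S g"
  using assms(2,3)
proof (induction k arbitrary: f g)
  case 0
  then show ?case by (simp cong: continuous_on_cong_simp)
next
  case (Suc k)
  have der: "g differentiable at x \<and> frechet_derivative f (at x) = frechet_derivative g (at x)"
    if x: "x \<in> S" for x
  proof -
    have "(f has_derivative frechet_derivative f (at x)) (at x)"
      using Suc.prems(2) x by (simp add: frechet_derivative_works)
    then have "(g has_derivative frechet_derivative f (at x)) (at x)"
      using has_derivative_transform_within_open[OF _ \<open>open S\<close> x] Suc.prems(1) by blast
    then show ?thesis using differentiableI frechet_derivative_at by blast
  qed
  show ?case
    using Suc.prems(2) der
    by (auto intro!: Suc.IH[of "\<lambda>x. frechet_derivative f (at x) v"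
          "\<lambda>x. frechet_derivative g (at x) v" for v])
qed

lemma Ck_on_SucI:
  assumes "open S" "\<And>x. x \<in> S \<Longrightarrow> (f has_derivative D x) (at x)"
    "\<And>v. Ck_on k S (\<lambda>x. D x v)"
  shows "Ck_on (Suc k) S f"
proof -
  have "frechet_derivative f (at x) = D x" if "x \<in> S" for x
    using assms(2)[OF that] frechet_derivative_at by metis
  then have "Ck_on k S (\<lambda>x. frechet_derivative f (at x) v)" for v
    by (intro Ck_on_cong[OF \<open>open S\<close> _ assms(3)[of v]]) simp
  with assms(2) show ?thesis by (auto simp: differentiable_def)
qed

lemma Ck_on_SucD:
  assumes "Ck_on (Suc k) S f"
  shows "x \<in> S \<Longrightarrow> (f has_derivative frechet_derivative f (at x)) (at x)"
    and "Ck_on k S (\<lambda>x. frechet_derivative f (at x) v)"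
  using assms frechet_derivative_works by auto

lemma Ck_on_continuous: "Ck_on k S f \<Longrightarrow> continuous_on S f"
proof (cases k)
  case (Suc j)
  assume "Ck_on k S f"
  with Suc show ?thesis
    by (auto intro!: continuous_at_imp_continuous_on differentiable_imp_continuous_within)
qed auto

lemma Ck_on_pred: "Ck_on (Suc k) S f \<Longrightarrow> Ck_on k S f"
  by (induction k arbitrary: f) (use Ck_on_continuous[of "Suc 0" S] in \<open>auto\<close>)

lemma Ck_on_subset: "Ck_on k S f \<Longrightarrow> T \<subseteq> S \<Longrightarrow> Ck_on k T f"
  by (induction k arbitrary: f) (auto intro: continuous_on_subset)

lemma Ck_on_const: "Ck_on k S (\<lambda>x. c)"
  by (induction k arbitrary: c) auto

lemma Ck_on_linear:
  assumes "open S" "bounded_linear l" "Ck_on k S f"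
  shows "Ck_on k S (\<lambda>x. l (f x))"
  using assms(3)
proof (induction k arbitrary: f)
  case 0
  then show ?case
    using assms(2) by (auto intro: linear_continuous_on_compose bounded_linear.continuous_on)
next
  case (Suc k)
  show ?case
    by (rule Ck_on_SucI[OF \<open>open S\<close>
          bounded_linear.has_derivative[OF assms(2) Ck_on_SucD(1)[OF Suc.prems]]])
       (auto intro: Suc.IH Ck_on_SucD(2)[OF Suc.prems])
qed

lemma Ck_on_add:
  assumes "open S" "Ck_on k S f" "Ck_on k S g"
  shows "Ck_on k S (\<lambda>x. f x + g x)"
  using assms(2,3)
proof (induction k arbitrary: f g)
  case (Suc k)
  show ?case
    by (rule Ck_on_SucI[OF \<open>open S\<close> has_derivative_add[OF
          Ck_on_SucD(1)[OF Suc.prems(1)] Ck_on_SucD(1)[OF Suc.prems(2)]]])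
       (auto intro: Suc.IH Ck_on_SucD(2)[OF Suc.prems(1)] Ck_on_SucD(2)[OF Suc.prems(2)])
qed (auto intro: continuous_on_add)

lemma Ck_on_sum:
  assumes "open S" "\<And>i. i \<in> I \<Longrightarrow> Ck_on k S (f i)"
  shows "Ck_on k S (\<lambda>x. \<Sum>i\<in>I. f i x)"
  using assms(2)
  by (induction I rule: infinite_finite_induct) (auto intro: Ck_on_const Ck_on_add[OF assms(1)])

lemma Ck_on_bilinear:
  assumes "open S" "bounded_bilinear b" "Ck_on k S f" "Ck_on k S g"
  shows "Ck_on k S (\<lambda>x. b (f x) (g x))"
  using assms(3,4)
proof (induction k arbitrary: f g)
  case 0
  then show ?case using assms(2) by (simp add: bounded_bilinear.continuous_on)
next
  case (Suc k)
  show ?case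
    by (rule Ck_on_SucI[OF \<open>open S\<close> bounded_bilinear.FDERIV[OF assms(2)
          Ck_on_SucD(1)[OF Suc.prems(1)] Ck_on_SucD(1)[OF Suc.prems(2)]]])
       (auto intro!: Suc.IH Ck_on_add[OF \<open>open S\<close>] Suc.prems[THEN Ck_on_pred]
          Ck_on_SucD(2)[OF Suc.prems(1)] Ck_on_SucD(2)[OF Suc.prems(2)])
qed

lemmas Ck_on_scaleR = Ck_on_bilinear[OF _ bounded_bilinear_scaleR]
  and Ck_on_mult = Ck_on_bilinear[OF _ bounded_bilinear_mult]

lemma Ck_on_prod:
  fixes f :: "'i \<Rightarrow> 'a::real_normed_vector \<Rightarrow> 'b::{real_normed_algebra,comm_ring_1}"
  assumes "open S" "\<And>i. i \<in> I \<Longrightarrow> Ck_on k S (f i)"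
  shows "Ck_on k S (\<lambda>x. \<Prod>i\<in>I. f i x)"
  using assms(2)
  by (induction I rule: infinite_finite_induct) (auto intro: Ck_on_const Ck_on_mult[OF assms(1)])

text \<open>The derivative of the reciprocal is a product of the derivative of \<open>f\<close> and
  two copies of the reciprocal itself, so the induction hypothesis at order \<open>k\<close> gives
  order \<open>k + 1\<close>.\<close>

lemma Ck_on_inverse:
  fixes f :: "'a::real_normed_vector \<Rightarrow> real"
  assumes "open S" "Ck_on k S f" "\<And>x. x \<in> S \<Longrightarrow> f x \<noteq> 0"
  shows "Ck_on k S (\<lambda>x. inverse (f x))"
  using assms(2)
proof (induction k)
  case 0
  then show ?case using assms(3) by (auto intro: continuous_on_inverse)
next
  case (Suc k)
  have "Ck_on k S (\<lambda>x. inverse (f x))"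
    using Suc.IH[OF Ck_on_pred[OF Suc.prems]] .
  then show ?case
    by (intro Ck_on_SucI[OF \<open>open S\<close> Deriv.has_derivative_inverse[OF assms(3) Ck_on_SucD(1)[OF Suc.prems]]]
          Ck_on_linear[OF \<open>open S\<close> bounded_linear_minus[OF bounded_linear_ident]]
          Ck_on_mult[OF \<open>open S\<close>] Ck_on_SucD(2)[OF Suc.prems])
qed

lemma Ck_on_compose:
  fixes g :: "'a::real_normed_vector \<Rightarrow> 'b::euclidean_space"
  assumes "open S" "open T" "Ck_on k T f" "Ck_on k S g" "g ` S \<subseteq> T"
  shows "Ck_on k S (\<lambda>x. f (g x))"
  using assms(3,4)
proof (induction k arbitrary: f)
  case 0
  then show ?case using assms(5) by (auto intro: continuous_on_compose2)
next
  case (Suc k)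
  let ?F = "\<lambda>y. frechet_derivative f (at y)" and ?G = "\<lambda>x. frechet_derivative g (at x)"
  \<comment> \<open>\<open>Ck_on\<close> controls the derivative of \<open>f\<close> only in fixed
    directions, while the chain rule produces the moving direction \<open>?G x v\<close>. Expanding
    it in \<open>Basis\<close> gives a finite sum of products of functions known to be of order
    \<open>k\<close>.\<close>
  have der: "((\<lambda>x. f (g x)) has_derivative (\<lambda>v. \<Sum>b\<in>Basis. (?G x v \<bullet> b) *\<^sub>R ?F (g x) b)) (at x)"
    if "x \<in> S" for x
  proof -
    have f: "(f has_derivative ?F (g x)) (at (g x))"
      using Ck_on_SucD(1)[OF Suc.prems(1), of "g x"] that assms(5) by auto
    have "?F (g x) w = (\<Sum>b\<in>Basis. (w \<bullet> b) *\<^sub>R ?F (g x) b)" for w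
      by (subst (1) euclidean_representation[of w, symmetric])
         (simp add: linear_sum[OF has_derivative_linear[OF f]]
           linear_cmul[OF has_derivative_linear[OF f]])
    moreover have "((\<lambda>x. f (g x)) has_derivative (\<lambda>v. ?F (g x) (?G x v))) (at x)"
      using has_derivative_compose[OF Ck_on_SucD(1)[OF Suc.prems(2) that] f] .
    ultimately show ?thesis by (rule has_derivative_eq_rhs[rotated, OF ext])
  qed
  have "Ck_on k S (\<lambda>x. ?G x v \<bullet> b)" for v b
    by (rule Ck_on_linear[OF \<open>open S\<close> bounded_linear_inner_left Ck_on_SucD(2)[OF Suc.prems(2)]])
  moreover have "Ck_on k S (\<lambda>x. ?F (g x) b)" for b
    by (rule Suc.IH[OF Ck_on_SucD(2)[OF Suc.prems(1)] Ck_on_pred[OF Suc.prems(2)]])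
  ultimately show ?case
    by (intro Ck_on_SucI[OF \<open>open S\<close> der] Ck_on_sum[OF \<open>open S\<close>] Ck_on_scaleR[OF \<open>open S\<close>])
qed

lemma Ck_on_vec:
  fixes f :: "'a::real_normed_vector \<Rightarrow> real^'n"
  assumes "open S" "\<And>i. Ck_on k S (\<lambda>x. f x $ i)"
  shows "Ck_on k S f"
proof -
  have "Ck_on k S (\<lambda>x. \<Sum>i\<in>UNIV. (f x $ i) *\<^sub>R (axis i 1 :: real^'n))"
    by (intro Ck_on_sum[OF assms(1)] Ck_on_scaleR[OF assms(1)] assms(2) Ck_on_const)
  moreover have "(\<Sum>i\<in>UNIV. (f x $ i) *\<^sub>R (axis i 1 :: real^'n)) = f x" for x
    by (simp add: vec_eq_iff axis_def if_distrib cong: if_cong)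
  ultimately show ?thesis by (simp only:)
qed

lemma Ck_on_det:
  fixes A :: "'a::real_normed_vector \<Rightarrow> real^'n^'n"
  assumes "open S" "\<And>i j. Ck_on k S (\<lambda>x. A x $ i $ j)"
  shows "Ck_on k S (\<lambda>x. det (A x))"
  unfolding det_def
  by (rule Ck_on_sum[OF assms(1) Ck_on_mult[OF assms(1) Ck_on_const Ck_on_prod[OF assms(1) assms(2)]]])

text \<open>By Cramer's rule the derivative of the inverse is a smooth function of the derivative, so
  regularity of the inverse improves from \<open>C\<^sup>k\<close> to \<open>C\<^bsup>k+1\<^esup>\<close>.\<close>

lemma Ck_on_inverse_map:
  fixes f g :: "real^'n \<Rightarrow> real^'n"
  assumes "open S" "open T" "g ` T \<subseteq> S" "smooth_on S f"
    and g: "\<And>x. x \<in> T \<Longrightarrow> (g has_derivative g' x) (at x)"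
    and right_inv: "\<And>x v. x \<in> T \<Longrightarrow> frechet_derivative f (at (g x)) (g' x v) = v"
  shows "Ck_on k T g"
proof (induction k)
  case 0
  show ?case
    using has_derivative_continuous_on[OF has_derivative_at_withinI[OF g]] by simp
next
  case (Suc k)
  let ?F = "\<lambda>x. frechet_derivative f (at (g x))"
  define M where "M x = matrix (?F x)" for x
  have Fd: "Ck_on k S (\<lambda>y. frechet_derivative f (at y) v)"
    and fdiff: "y \<in> S \<Longrightarrow> (f has_derivative frechet_derivative f (at y)) (at y)" for v y
    using \<open>smooth_on S f\<close> Ck_on_SucD[of k S f] by (auto simp: smooth_on_def simp del: Ck_on.simps)
  have lin: "linear (?F x)" if "x \<in> T" for x
    using has_derivative_linear[OF fdiff] assms(3) that by blast
  have M: "M x *v g' x v = v" if "x \<in> T" for x v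
    using right_inv[OF that, of v] fun_cong[OF matrix_vector_mul(2)[OF lin[OF that]]] by (simp add: M_def)
  have MM: "M x ** matrix (g' x) = mat 1" if "x \<in> T" for x
    using M[OF that] fun_cong[OF matrix_vector_mul(2)[OF has_derivative_linear[OF g[OF that]]]]
    by (simp add: matrix_eq flip: matrix_vector_mul_assoc)
  have det: "det (M x) \<noteq> 0" if "x \<in> T" for x
    using MM[OF that] det_mul[of "M x" "matrix (g' x)"] by auto
  have Mij: "Ck_on k T (\<lambda>x. M x $ i $ j)" for i j
    unfolding M_def matrix_def vec_lambda_beta
    by (rule Ck_on_linear[OF \<open>open T\<close> bounded_linear_vec_nth
         Ck_on_compose[OF \<open>open T\<close> \<open>open S\<close> Fd Suc.IH \<open>g ` T \<subseteq> S\<close>]])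
  have eq: "g' x v = (\<chi> i. det (\<chi> a b. if b = i then v $ a else M x $ a $ b) / det (M x))"
    if "x \<in> T" for x v
    using cramer[OF det[OF that], of "g' x v" v] M[OF that, of v] by simp
  have "Ck_on k T (\<lambda>x. \<chi> i. det (\<chi> a b. if b = i then v $ a else M x $ a $ b) / det (M x))" for v
  proof (rule Ck_on_vec[OF \<open>open T\<close>])
    fix i
    have "Ck_on k T (\<lambda>x. if b = i then v $ a else M x $ a $ b)" for a b
      by (cases "b = i") (simp_all add: Ck_on_const Mij)
    then have "Ck_on k T (\<lambda>x. det (\<chi> a b. if b = i then v $ a else M x $ a $ b) * inverse (det (M x)))"
      by - (rule Ck_on_mult[OF \<open>open T\<close> Ck_on_det[OF \<open>open T\<close>]
            Ck_on_inverse[OF \<open>open T\<close> Ck_on_det[OF \<open>open T\<close> Mij] det]], simp)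
    then show "Ck_on k T (\<lambda>x. (\<chi> i. det (\<chi> a b. if b = i then v $ a else M x $ a $ b) / det (M x)) $ i)"
      by (simp add: divide_inverse)
  qed
  then have "Ck_on k T (\<lambda>x. g' x v)" for v
    by (rule Ck_on_cong[OF \<open>open T\<close>, rotated]) (simp add: eq)
  then show ?case using Ck_on_SucI[OF \<open>open T\<close> g] by blast
qed

section \<open>Symmetry of second derivatives\<close>

text \<open>\<open>D y u\<close> is differentiable at the single point \<open>x\<close> only, so the
  mean value inequality is used in the direction \<open>u\<close> alone, for the difference of
  \<open>f\<close> along two parallel segments. The first order expansion of \<open>D y u\<close>
  around \<open>x\<close> controls both.\<close>

lemma second_difference_bound:
  fixes f :: "'a::real_normed_vector \<Rightarrow> 'b::real_normed_vector"
  assumes "open S" "x \<in> S" "\<And>y. y \<in> S \<Longrightarrow> (f has_derivative D y) (at y)"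
    "((\<lambda>y. D y u) has_derivative Du) (at x)" "e > 0"
  shows "\<exists>d>0. \<forall>t. 0 < t \<and> t < d \<longrightarrow>
    norm (f (x + t *\<^sub>R u + t *\<^sub>R v) - f (x + t *\<^sub>R u) - f (x + t *\<^sub>R v) + f x - t\<^sup>2 *\<^sub>R Du v) \<le> e * t\<^sup>2"
proof -
  \<comment> \<open>\<open>t * c\<close> bounds every displacement by multiples of \<open>u\<close>
    and \<open>v\<close> with factors between 0 and \<open>t\<close>; the summand 1 keeps
    \<open>c\<close> positive when both directions vanish.\<close>
  define c where "c = norm u + norm v + 1"
  have c: "c > 0" by (simp add: c_def add_nonneg_pos)
  obtain d1 where d1: "d1 > 0" "\<And>y. norm (y - x) < d1 \<Longrightarrow>
      norm (D y u - D x u - Du (y - x)) \<le> e / (2 * c) * norm (y - x)"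
    using assms(5) c has_derivative_at_alt[THEN iffD1, OF assms(4)]
    by (metis divide_pos_pos mult_pos_pos zero_less_numeral)
  obtain d2 where d2: "d2 > 0" "ball x d2 \<subseteq> S"
    using assms(1,2) by (meson open_contains_ball)
  have linDu: "linear Du" using assms(4) has_derivative_linear by blast
  show ?thesis
  proof (intro exI[of _ "min d1 d2 / c"] conjI allI impI)
    show "min d1 d2 / c > 0" using d1 d2 c by simp
  next
    fix t assume t: "0 < t \<and> t < min d1 d2 / c"
    then have tc: "t * c < d1" "t * c < d2" using c by (simp_all add: field_simps)
    have small: "norm (s *\<^sub>R u + r *\<^sub>R v) \<le> t * c" if "0 \<le> s" "s \<le> t" "0 \<le> r" "r \<le> t" for s r
    proof -
      have "norm (s *\<^sub>R u + r *\<^sub>R v) \<le> s * norm u + r * norm v"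
        using norm_triangle_ineq[of "s *\<^sub>R u" "r *\<^sub>R v"] that by simp
      also have "\<dots> \<le> t * norm u + t * norm v"
        using that by (intro add_mono mult_right_mono) auto
      also have "\<dots> \<le> t * c" using t by (simp add: c_def algebra_simps)
      finally show ?thesis .
    qed
    \<comment> \<open>\<open>k t - k 0\<close> is the second difference minus
      \<open>t\<^sup>2 *\<^sub>R Du v\<close>; a bound \<open>e * t\<close> for \<open>k'\<close> on
      an interval of length \<open>t\<close> therefore suffices.\<close>
    define k where "k s = f (x + s *\<^sub>R u + t *\<^sub>R v) - f (x + s *\<^sub>R u) - (s * t) *\<^sub>R Du v" for s
    define k' where "k' s = D (x + s *\<^sub>R u + t *\<^sub>R v) u - D (x + s *\<^sub>R u) u - t *\<^sub>R Du v" for s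
    have inS: "x + s *\<^sub>R u + r *\<^sub>R v \<in> S" if "0 \<le> s" "s \<le> t" "0 \<le> r" "r \<le> t" for s r
      using small[OF that] tc(2) d2(2) by (auto simp: subset_iff dist_norm add.assoc norm_minus_commute)
    have der: "(k has_derivative (\<lambda>r. r *\<^sub>R k' s)) (at s within {0..t})" if s: "s \<in> {0..t}" for s
    proof -
      have 1: "(f has_derivative D (x + s *\<^sub>R u + t *\<^sub>R v)) (at (x + s *\<^sub>R u + t *\<^sub>R v))"
        "(f has_derivative D (x + s *\<^sub>R u)) (at (x + s *\<^sub>R u))"
        using assms(3)[OF inS[of s t]] assms(3)[OF inS[of s 0]] s by auto
      have 2: "((\<lambda>s. x + s *\<^sub>R u + t *\<^sub>R v) has_derivative (\<lambda>r. r *\<^sub>R u)) (at s)"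
        "((\<lambda>s. x + s *\<^sub>R u) has_derivative (\<lambda>r. r *\<^sub>R u)) (at s)"
        by (auto intro!: derivative_eq_intros)
      have "(k has_derivative (\<lambda>r. D (x + s *\<^sub>R u + t *\<^sub>R v) (r *\<^sub>R u) - D (x + s *\<^sub>R u) (r *\<^sub>R u) - (r * t) *\<^sub>R Du v)) (at s)"
        unfolding k_def
        by (rule derivative_eq_intros has_derivative_compose[OF 2(1) 1(1)]
             has_derivative_compose[OF 2(2) 1(2)] refl | simp)+
      moreover have "D (x + s *\<^sub>R u + t *\<^sub>R v) (r *\<^sub>R u) - D (x + s *\<^sub>R u) (r *\<^sub>R u) - (r * t) *\<^sub>R Du v = r *\<^sub>R k' s" for r
        using 1[THEN has_derivative_linear] by (simp add: k'_def linear_cmul algebra_simps)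
      ultimately show ?thesis by (simp add: has_derivative_at_withinI)
    qed
    have bd: "norm (k' s) \<le> e * t" if s: "s \<in> {0..t}" for s
    proof -
      have "k' s = (D (x + s *\<^sub>R u + t *\<^sub>R v) u - D x u - Du (s *\<^sub>R u + t *\<^sub>R v))
          - (D (x + s *\<^sub>R u) u - D x u - Du (s *\<^sub>R u))"
        using linDu by (simp add: k'_def linear_add linear_cmul)
      also have "norm \<dots> \<le> norm (D (x + s *\<^sub>R u + t *\<^sub>R v) u - D x u - Du (s *\<^sub>R u + t *\<^sub>R v))
          + norm (D (x + s *\<^sub>R u) u - D x u - Du (s *\<^sub>R u))"
        by (rule norm_triangle_ineq4)
      also have "\<dots> \<le> e / (2 * c) * norm (s *\<^sub>R u + t *\<^sub>R v) + e / (2 * c) * norm (s *\<^sub>R u + 0 *\<^sub>R v)"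
        using d1(2)[of "x + s *\<^sub>R u + t *\<^sub>R v"] d1(2)[of "x + s *\<^sub>R u"] small[of s t] small[of s 0] s tc(1) t
        by (intro add_mono) (auto simp: add.assoc)
      also have "\<dots> \<le> e / (2 * c) * (t * c) + e / (2 * c) * (t * c)"
        using small[of s t] small[of s 0] s t c assms(5) by (intro add_mono mult_left_mono) auto
      also have "\<dots> = e * t" using c by (simp add: field_simps)
      finally show ?thesis .
    qed
    have "onorm (\<lambda>r. r *\<^sub>R k' s) \<le> e * t" if "s \<in> {0..t}" for s
      by (rule onorm_bound) (use bd[OF that] t assms(5) in \<open>auto simp: mult.commute intro: mult_left_mono\<close>)
    then have "norm (k t - k 0) \<le> e * t * norm (t - 0)"
      using t by (intro differentiable_bound[OF _ der]) auto
    then show "norm (f (x + t *\<^sub>R u + t *\<^sub>R v) - f (x + t *\<^sub>R u) - f (x + t *\<^sub>R v) + f x - t\<^sup>2 *\<^sub>R Du v) \<le> e * t\<^sup>2"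
      using t by (simp add: k_def power2_eq_square algebra_simps)
  qed
qed

text \<open>The second difference is symmetric in \<open>u\<close> and \<open>v\<close>, and divided
  by \<open>t\<^sup>2\<close> it tends to \<open>Du v\<close> as well as to
  \<open>Dv u\<close>.\<close>

lemma second_derivative_symmetric:
  fixes f :: "'a::real_normed_vector \<Rightarrow> 'b::real_normed_vector"
  assumes "open S" "x \<in> S" "\<And>y. y \<in> S \<Longrightarrow> (f has_derivative D y) (at y)"
    "((\<lambda>y. D y u) has_derivative Du) (at x)" "((\<lambda>y. D y v) has_derivative Dv) (at x)"
  shows "Du v = Dv u"
proof (rule ccontr)
  assume ne: "Du v \<noteq> Dv u"
  \<comment> \<open>With a third of the gap, two errors of size \<open>e\<close> cannot add up to
    it.\<close>
  define e where "e = norm (Du v - Dv u) / 3"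
  have e: "e > 0" using ne by (simp add: e_def)
  define \<Delta> where "\<Delta> t = f (x + t *\<^sub>R u + t *\<^sub>R v) - f (x + t *\<^sub>R u) - f (x + t *\<^sub>R v) + f x" for t :: real
  obtain d where d: "d > 0" "\<And>t. 0 < t \<Longrightarrow> t < d \<Longrightarrow> norm (\<Delta> t - t\<^sup>2 *\<^sub>R Du v) \<le> e * t\<^sup>2"
    using second_difference_bound[OF assms(1-4) e, of v] unfolding \<Delta>_def by blast
  obtain d' where d': "d' > 0" "\<And>t. 0 < t \<Longrightarrow> t < d' \<Longrightarrow> norm (\<Delta> t - t\<^sup>2 *\<^sub>R Dv u) \<le> e * t\<^sup>2"
    using second_difference_bound[OF assms(1-3) assms(5) e, of u] unfolding \<Delta>_def
    by (auto simp: algebra_simps)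
  obtain t where t: "0 < t" "t < d" "t < d'"
    using d(1) d'(1) field_lbound_gt_zero by blast
  have "t\<^sup>2 * (3 * e) = norm ((\<Delta> t - t\<^sup>2 *\<^sub>R Dv u) - (\<Delta> t - t\<^sup>2 *\<^sub>R Du v))"
    using t(1) by (simp add: e_def flip: scaleR_diff_right)
  also have "\<dots> \<le> e * t\<^sup>2 + e * t\<^sup>2"
    using norm_triangle_ineq4 d(2)[OF t(1,2)] d'(2)[OF t(1,3)] by (metis add_mono order_trans add.commute)
  finally have "t\<^sup>2 * e \<le> 0" by (simp add: algebra_simps)
  with e t(1) show False by (simp add: mult_le_0_iff)
qed

section \<open>Integrable total differential equations\<close>

text \<open>Picard iteration normalised to unit time: the bound \<open>R\<close> keeps the iterates
  in the ball, and the Lipschitz constant 1/2 makes the integral operator a contraction in the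
  supremum norm.\<close>

lemma ode_exists:
  fixes G :: "real \<times> 'b::euclidean_space \<Rightarrow> 'b"
  assumes cont: "continuous_on ({0..1} \<times> cball x0 R) G" and "R \<ge> 0"
    and bound: "\<And>t x. t \<in> {0..1} \<Longrightarrow> x \<in> cball x0 R \<Longrightarrow> norm (G (t, x)) \<le> R"
    and lip: "\<And>t x x'. t \<in> {0..1} \<Longrightarrow> x \<in> cball x0 R \<Longrightarrow> x' \<in> cball x0 R \<Longrightarrow>
      norm (G (t, x) - G (t, x')) \<le> norm (x - x') / 2"
  obtains p where "p 0 = x0" "\<And>t. t \<in> {0..1} \<Longrightarrow> p t \<in> cball x0 R"
    "\<And>t. t \<in> {0..1} \<Longrightarrow> (p has_vector_derivative G (t, p t)) (at t within {0..1})"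
proof -
  \<comment> \<open>Clamping the time to the unit interval makes every curve a bounded continuous
    function on the whole line, a complete space in which Banach's theorem applies.\<close>
  define cl where "cl t = max 0 (min 1 t)" for t :: real
  have cl: "cl t \<in> {0..1}" for t by (auto simp: cl_def)
  have cont_cl: "continuous_on UNIV cl" unfolding cl_def by (intro continuous_intros)
  define S :: "(real \<Rightarrow>\<^sub>C 'b) set" where "S = PiC UNIV (\<lambda>_. cball x0 R)"
  have S: "p \<in> S \<longleftrightarrow> (\<forall>t. apply_bcontfun p t \<in> cball x0 R)" for p
    by (auto simp: S_def mem_PiC_iff)
  define T where "T p t = x0 + integral {0..cl t} (\<lambda>s. G (s, apply_bcontfun p s))" for p t
  have contG: "continuous_on {0..1} (\<lambda>s. G (s, apply_bcontfun p s))" if "p \<in> S" for p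
    by (rule continuous_on_compose2[OF cont]) (use that in \<open>auto simp: S intro!: continuous_intros\<close>)
  have int: "(\<lambda>s. G (s, apply_bcontfun p s)) integrable_on {0..cl t}" if "p \<in> S" for p t
    using cl[of t] by (intro integrable_continuous_real continuous_on_subset[OF contG[OF that]]) auto
  have Tcont: "continuous_on UNIV (T p)" if "p \<in> S" for p
    unfolding T_def
    by (intro continuous_on_add continuous_on_const
        continuous_on_compose2[OF indefinite_integral_continuous_1[OF integrable_continuous_real[OF contG[OF that]]] cont_cl])
       (use cl in auto)
  have Tball: "T p t \<in> cball x0 R" if "p \<in> S" for p t
  proof -
    have "norm (integral {0..cl t} (\<lambda>s. G (s, apply_bcontfun p s))) \<le> R * (cl t - 0)"
    proof (rule integral_bound)
      show "continuous_on {0..cl t} (\<lambda>s. G (s, apply_bcontfun p s))"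
        by (rule continuous_on_subset[OF contG[OF that]]) (use cl[of t] in auto)
      show "norm (G (s, apply_bcontfun p s)) \<le> R" if "s \<in> {0..cl t}" for s
        using bound[of s "p s"] that \<open>p \<in> S\<close> cl[of t] by (auto simp: S)
    qed (use cl in auto)
    also have "\<dots> \<le> R" using cl[of t] \<open>R \<ge> 0\<close> mult_left_le[of "cl t" R] by simp
    finally show ?thesis by (simp add: T_def dist_norm norm_minus_commute)
  qed
  have Tb: "T p \<in> bcontfun" if "p \<in> S" for p
  proof (rule bcontfun_normI[OF Tcont[OF that]])
    show "norm (T p t) \<le> norm x0 + R" for t
      using Tball[OF that, of t] norm_triangle_sub[of "T p t" x0] by (simp add: dist_norm norm_minus_commute)
  qed
  define TT where "TT p = Bcontfun (T p)" for p
  have TT: "apply_bcontfun (TT p) = T p" if "p \<in> S" for p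
    using Tb[OF that] by (simp add: TT_def Bcontfun_inverse)
  have "\<exists>!p\<in>S. TT p = p"
  proof (rule Banach_fix[where c = "1/2"])
    show "complete S" unfolding S_def complete_eq_closed by (rule closed_PiC) simp
    have "const_bcontfun x0 \<in> S" using \<open>R \<ge> 0\<close> by (simp add: S)
    then show "S \<noteq> {}" by blast
    show "TT ` S \<subseteq> S"
    proof (rule image_subsetI)
      show "TT p \<in> S" if "p \<in> S" for p unfolding S TT[OF that] using Tball[OF that] by blast
    qed
    show "dist (TT p) (TT q) \<le> 1/2 * dist p q" if "p \<in> S" "q \<in> S" for p q
    proof (rule dist_bound)
      fix t
      have "dist (apply_bcontfun (TT p) t) (apply_bcontfun (TT q) t)
          = norm (integral {0..cl t} (\<lambda>s. G (s, apply_bcontfun p s) - G (s, apply_bcontfun q s)))"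
        unfolding TT[OF that(1)] TT[OF that(2)]
        by (simp add: T_def dist_norm integral_diff[OF int[OF that(1)] int[OF that(2)]])
      also have "\<dots> \<le> (1/2 * dist p q) * (cl t - 0)"
      proof (rule integral_bound)
        show "continuous_on {0..cl t} (\<lambda>s. G (s, apply_bcontfun p s) - G (s, apply_bcontfun q s))"
          by (intro continuous_on_diff continuous_on_subset[OF contG[OF that(1)]]
              continuous_on_subset[OF contG[OF that(2)]]) (use cl[of t] in auto)
        fix s assume "s \<in> {0..cl t}"
        then have "norm (G (s, apply_bcontfun p s) - G (s, apply_bcontfun q s)) \<le> dist (p s) (q s) / 2"
          using that cl[of t] unfolding dist_norm by (intro lip) (auto simp: S)
        then show "norm (G (s, apply_bcontfun p s) - G (s, apply_bcontfun q s)) \<le> 1/2 * dist p q"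
          using dist_bounded[of p s q] by simp
      qed (use cl in auto)
      also have "\<dots> \<le> 1/2 * dist p q" using cl[of t] mult_left_le[of "cl t" "1/2 * dist p q"] by simp
      finally show "dist (apply_bcontfun (TT p) t) (apply_bcontfun (TT q) t) \<le> 1/2 * dist p q" .
    qed
  qed auto
  then obtain p where p: "p \<in> S" "TT p = p" by blast
  then have pT: "apply_bcontfun p = T p" using TT by metis
  show thesis
  proof (rule that)
    show "p 0 = x0" using fun_cong[OF pT, of 0] by (simp add: T_def cl_def)
    show "p t \<in> cball x0 R" for t using p S by blast
    show "(apply_bcontfun p has_vector_derivative G (t, p t)) (at t within {0..1})" if t: "t \<in> {0..1}" for t
    proof (rule has_vector_derivative_transform[OF t])
      show "((\<lambda>t. x0 + integral {0..t} (\<lambda>s. G (s, apply_bcontfun p s))) has_vector_derivative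
          G (t, p t)) (at t within {0..1})"
        using integral_has_vector_derivative[OF contG[OF p(1)] t]
        by (auto intro!: derivative_eq_intros)
      show "p s = x0 + integral {0..s} (\<lambda>s. G (s, apply_bcontfun p s))" if "s \<in> {0..1}" for s
        using that fun_cong[OF pT, of s] by (simp add: T_def cl_def)
    qed
  qed
qed

text \<open>Replaces Gronwall's inequality on the unit interval: the maximum m of the distance
  satisfies m <= m/2 + e, hence m <= 2e.\<close>

lemma ode_compare:
  fixes p q :: "real \<Rightarrow> 'b::real_normed_vector"
  assumes p: "\<And>t. t \<in> {0..1} \<Longrightarrow> (p has_vector_derivative p' t) (at t within {0..1})"
    and q: "\<And>t. t \<in> {0..1} \<Longrightarrow> (q has_vector_derivative q' t) (at t within {0..1})"
    and le: "\<And>t. t \<in> {0..1} \<Longrightarrow> norm (p' t - q' t) \<le> norm (p t - q t) / 2 + e"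
    and "p 0 = q 0" "t \<in> {0..1}"
  shows "norm (p t - q t) \<le> 2 * e"
proof -
  have "continuous_on {0..1} (\<lambda>t. norm (p t - q t))"
    using has_vector_derivative_continuous[OF p] has_vector_derivative_continuous[OF q]
    by (intro continuous_intros) (simp_all add: continuous_on_eq_continuous_within)
  then obtain m where m: "m \<in> {0..1}" "\<And>t. t \<in> {0..1} \<Longrightarrow> norm (p t - q t) \<le> norm (p m - q m)"
    using continuous_attains_sup[of "{0..1::real}" "\<lambda>t. norm (p t - q t)"] by auto
  have e: "norm (p m - q m) / 2 + e \<ge> 0"
    using le[OF m(1)] norm_ge_zero order_trans by blast
  have "norm ((p m - q m) - (p 0 - q 0)) \<le> (norm (p m - q m) / 2 + e) * norm (m - 0)"
  proof (rule differentiable_bound[of "{0..1}"])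
    fix s :: real assume s: "s \<in> {0..1}"
    show "((\<lambda>t. p t - q t) has_derivative (\<lambda>h. h *\<^sub>R (p' s - q' s))) (at s within {0..1})"
      using has_vector_derivative_diff[OF p[OF s] q[OF s]] by (simp add: has_vector_derivative_def)
    show "onorm (\<lambda>h. h *\<^sub>R (p' s - q' s)) \<le> norm (p m - q m) / 2 + e"
    proof (rule onorm_le)
      fix h :: real
      have "norm (p' s - q' s) \<le> norm (p m - q m) / 2 + e" using le[OF s] m(2)[OF s] by simp
      then show "norm (h *\<^sub>R (p' s - q' s)) \<le> (norm (p m - q m) / 2 + e) * norm h"
        by (simp add: mult.commute mult_left_mono)
    qed
  qed (use m(1) in auto)
  also have "\<dots> \<le> norm (p m - q m) / 2 + e"
    using m(1) e mult_left_le[of m "norm (p m - q m) / 2 + e"] by simp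
  finally have "norm (p m - q m) \<le> 2 * e" using assms(4) by simp
  with m(2)[OF assms(5)] show ?thesis by simp
qed

text \<open>Uniform continuity of \<open>F'\<close> makes the mean value estimate along the segment
  from \<open>z\<close> to \<open>w\<close> independent of \<open>z\<close>; convexity keeps the
  segment in \<open>K\<close>.\<close>

lemma uniformly_differentiable_on_compact:
  fixes F :: "'a::euclidean_space \<Rightarrow> 'b::real_normed_vector" and F' :: "'a \<Rightarrow> 'a \<Rightarrow>\<^sub>L 'b"
  assumes "compact K" "convex K" "\<And>z. z \<in> K \<Longrightarrow> (F has_derivative F' z) (at z)"
    "continuous_on K F'" "e > 0"
  obtains d where "d > 0" "\<And>z w. z \<in> K \<Longrightarrow> w \<in> K \<Longrightarrow> norm (w - z) < d \<Longrightarrow>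
    norm (F w - F z - F' z (w - z)) \<le> e * norm (w - z)"
proof -
  obtain d where d: "d > 0" "\<And>z w. z \<in> K \<Longrightarrow> w \<in> K \<Longrightarrow> dist w z < d \<Longrightarrow> dist (F' w) (F' z) < e"
    using compact_uniformly_continuous[OF assms(4,1)] \<open>e > 0\<close> unfolding uniformly_continuous_on_def by metis
  show thesis
  proof (rule that[OF d(1)])
    fix z w assume zw: "z \<in> K" "w \<in> K" "norm (w - z) < d"
    have seg: "closed_segment z w \<subseteq> K" using zw assms(2) closed_segment_subset by blast
    have "norm (F w - F z - F' z (w - z)) \<le> norm (w - z) * e"
    proof (rule differentiable_bound_linearization[where S = "closed_segment z w" and f' = "\<lambda>z. blinfun_apply (F' z)"])
      show "z + t *\<^sub>R (w - z) \<in> closed_segment z w" if "t \<in> {0..1}" for t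
        using that by (auto simp: closed_segment_def algebra_simps intro!: exI[of _ t])
      show "(F has_derivative F' x) (at x within closed_segment z w)" if "x \<in> closed_segment z w" for x
        using assms(3) that seg has_derivative_at_withinI by blast
      show "onorm (blinfun_apply (F' x) - blinfun_apply (F' z)) \<le> e" if x: "x \<in> closed_segment z w" for x
      proof -
        have "norm (x - z) \<le> norm (w - z)"
          using segment_bound(1)[OF x] by simp
        then have "norm (F' x - F' z) \<le> e"
          using d(2)[of z x] x seg zw by (auto simp: dist_norm intro: less_imp_le)
        moreover have "onorm (blinfun_apply (F' x) - blinfun_apply (F' z)) = norm (F' x - F' z)"
          by (simp add: norm_blinfun.rep_eq minus_blinfun.rep_eq fun_diff_def)
        ultimately show ?thesis by simp
      qed
    qed auto
    then show "norm (F w - F z - F' z (w - z)) \<le> e * norm (w - z)" by (simp add: mult.commute)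
  qed
qed

text \<open>Solves the total differential equation \<open>du = F(y, u) dy\<close> along rays. Differentiability in \<open>y\<close>: if
  \<open>p\<close> is the solution on the ray through \<open>y\<close>, then by integrability \<open>q(t) = p(t) + t F(ty, p(t)) h\<close>
  satisfies the equation on the ray through \<open>y + h\<close> up to an error \<open>o(h)\<close>.\<close>

theorem frobenius_solution:
  fixes F :: "'a::euclidean_space \<times> 'b::euclidean_space \<Rightarrow> 'a \<Rightarrow>\<^sub>L 'b"
    and F' :: "'a \<times> 'b \<Rightarrow> ('a \<times> 'b) \<Rightarrow>\<^sub>L ('a \<Rightarrow>\<^sub>L 'b)"
  assumes W: "open W" "(0, x0) \<in> W"
    and der: "\<And>z. z \<in> W \<Longrightarrow> (F has_derivative F' z) (at z)"
    and cont: "continuous_on W F'"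
    and integrable: "\<And>z a b. z \<in> W \<Longrightarrow> F' z (a, F z a) b = F' z (b, F z b) a"
  obtains r u where "r > 0" "u 0 = x0" "\<And>y. y \<in> ball 0 r \<Longrightarrow> (y, u y) \<in> W"
    "\<And>y. y \<in> ball 0 r \<Longrightarrow> (u has_derivative F (y, u y)) (at y)"
proof -
  obtain A B where AB: "open A" "open B" "0 \<in> A" "x0 \<in> B" "A \<times> B \<subseteq> W"
    using open_prod_elim[OF W] by (metis mem_Sigma_iff)
  obtain R1 R2 where R12: "R1 > 0" "cball 0 R1 \<subseteq> A" "R2 > 0" "cball x0 R2 \<subseteq> B"
    using AB by (meson open_contains_cball)
  define R where "R = min R1 R2"
  define K where "K = cball (0::'a) R \<times> cball x0 R"
  have R: "R > 0" using R12 by (simp add: R_def)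
  have KW: "K \<subseteq> W" using R12 AB(5) by (fastforce simp: K_def R_def)
  have K: "compact K" "convex K" by (simp_all add: K_def compact_Times convex_Times)
  have contF: "continuous_on K F"
    using der KW by (intro continuous_at_imp_continuous_on ballI has_derivative_continuous) blast
  have contF': "continuous_on K F'" using cont KW continuous_on_subset by blast
  obtain b where b: "b > 0" "\<And>z. z \<in> K \<Longrightarrow> norm (F z) \<le> b"
    using compact_imp_bounded[OF compact_continuous_image[OF contF K(1)]] unfolding bounded_pos by auto
  obtain c where c: "c > 0" "\<And>z. z \<in> K \<Longrightarrow> norm (F' z) \<le> c"
    using compact_imp_bounded[OF compact_continuous_image[OF contF' K(1)]] unfolding bounded_pos by auto
  have lip: "norm (F z - F w) \<le> c * norm (z - w)" if "z \<in> K" "w \<in> K" for z w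
  proof (rule differentiable_bound[OF K(2) _ _ that])
    fix z assume z: "z \<in> K"
    show "(F has_derivative F' z) (at z within K)"
      using der z KW by (blast intro: has_derivative_at_withinI)
    show "onorm (F' z) \<le> c" using c(2)[OF z] by (simp add: norm_blinfun.rep_eq)
  qed
  \<comment> \<open>On rays of length at most \<open>r\<close> the right-hand side is bounded by
    \<open>r * b <= R / 2\<close> and has Lipschitz constant \<open>r * c <= 1 / 2\<close>, as
    \<open>ode_exists\<close> and \<open>ode_compare\<close> demand.\<close>
  define r where "r = min R (min (R / (2 * b)) (1 / (2 * c)))"
  have r: "r > 0" "r \<le> R" "r * b \<le> R / 2" "r * c \<le> 1 / 2"
    using R b c by (auto simp: r_def min_def field_simps)
  define G where "G y z = F (fst z *\<^sub>R y, snd z) y" for y :: 'a and z :: "real \<times> 'b"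
  have inK: "(t *\<^sub>R y, x) \<in> K" if "norm y \<le> r" "t \<in> {0..1}" "x \<in> cball x0 R" for y t x
  proof -
    have "t * norm y \<le> 1 * r" using that r(1) by (intro mult_mono) auto
    then show ?thesis using that r(2) by (auto simp: K_def)
  qed
  have lipG: "norm (G y (t, x) - G y (t, x')) \<le> norm (x - x') / 2"
    if "norm y \<le> r" "t \<in> {0..1}" "x \<in> cball x0 R" "x' \<in> cball x0 R" for y t x x'
  proof -
    have "norm (G y (t, x) - G y (t, x')) \<le> norm (F (t *\<^sub>R y, x) - F (t *\<^sub>R y, x')) * norm y"
      unfolding G_def by (simp flip: blinfun.diff_left add: norm_blinfun)
    also have "\<dots> \<le> (c * norm (x - x')) * r"
      using lip[OF inK inK, of y t x y t x'] that c(1) by (intro mult_mono) (auto simp: norm_Pair)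
    also have "\<dots> = (r * c) * norm (x - x')" by simp
    also have "\<dots> \<le> 1 / 2 * norm (x - x')" by (rule mult_right_mono[OF r(4)]) simp
    finally show ?thesis by simp
  qed
  \<comment> \<open>Solutions are kept in the half ball, which leaves room \<open>R / 2\<close> for
    the perturbation that turns \<open>P y\<close> into the comparison curve \<open>q\<close>
    below.\<close>
  have ex: "\<exists>p. p 0 = x0 \<and> (\<forall>t\<in>{0..1}. p t \<in> cball x0 (R/2) \<and>
      (p has_vector_derivative G y (t, p t)) (at t within {0..1}))" if y: "norm y \<le> r" for y
  proof -
    have half: "x \<in> cball x0 R" if "x \<in> cball x0 (R/2)" for x using that R by auto
    obtain p where "p 0 = x0" "\<And>t. t \<in> {0..1} \<Longrightarrow> p t \<in> cball x0 (R/2)"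
      "\<And>t. t \<in> {0..1} \<Longrightarrow> (p has_vector_derivative G y (t, p t)) (at t within {0..1})"
    proof (rule ode_exists[of x0 "R/2" "G y"])
      show "continuous_on ({0..1} \<times> cball x0 (R/2)) (G y)"
        unfolding G_def
        by (intro bounded_bilinear.continuous_on[OF bounded_bilinear_blinfun_apply] continuous_on_const
            continuous_on_compose2[OF contF] continuous_intros)
           (use inK[OF y] half in auto)
      show "norm (G y (t, x)) \<le> R / 2" if "t \<in> {0..1}" "x \<in> cball x0 (R/2)" for t x
      proof -
        have "norm (G y (t, x)) \<le> norm (F (t *\<^sub>R y, x)) * norm y" by (simp add: G_def norm_blinfun)
        also have "\<dots> \<le> b * r"
          using b(2)[OF inK[OF y that(1) half[OF that(2)]]] y b(1) by (intro mult_mono) auto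
        finally show ?thesis using r(3) by (simp add: mult.commute)
      qed
    qed (use lipG[OF y] half R in auto)
    then show ?thesis by blast
  qed
  obtain P where P: "\<And>y. norm y \<le> r \<Longrightarrow> P y 0 = x0"
    "\<And>y t. norm y \<le> r \<Longrightarrow> t \<in> {0..1} \<Longrightarrow> P y t \<in> cball x0 (R/2)"
    "\<And>y t. norm y \<le> r \<Longrightarrow> t \<in> {0..1} \<Longrightarrow> (P y has_vector_derivative G y (t, P y t)) (at t within {0..1})"
  proof -
    have "\<forall>y. \<exists>p. norm y \<le> r \<longrightarrow> p 0 = x0 \<and> (\<forall>t\<in>{0..1}. p t \<in> cball x0 (R/2) \<and>
      (p has_vector_derivative G y (t, p t)) (at t within {0..1}))" using ex by blast
    from choice[OF this] that show ?thesis by blast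
  qed
  have PR: "P y t \<in> cball x0 R" if "norm y \<le> r" "t \<in> {0..1}" for y t
    using P(2)[OF that] R by auto
  define u where "u y = P y 1" for y
  show thesis
  proof (rule that[of r u])
    \<comment> \<open>On the degenerate ray the right-hand side is 0; comparison with a constant
      curve at error 0 determines the chosen solution.\<close>
    have "norm (P 0 1 - (\<lambda>t::real. x0) 1) \<le> 2 * 0"
    proof (rule ode_compare[of "P 0" "\<lambda>t. G 0 (t, P 0 t)" "\<lambda>_. x0" "\<lambda>_. 0"])
      show "(P 0 has_vector_derivative G 0 (t, P 0 t)) (at t within {0..1})" if "t \<in> {0..1}" for t
        using P(3)[OF _ that, of 0] r(1) by simp
    qed (use P(1)[of 0] r(1) in \<open>auto simp: G_def blinfun.zero_right\<close>)
    then show "u 0 = x0" by (simp add: u_def)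
    show "(y, u y) \<in> W" if "y \<in> ball 0 r" for y
      using inK[of y 1 "u y"] PR[of y 1] that KW by (auto simp: u_def)
    show "(u has_derivative F (y, u y)) (at y)" if y: "y \<in> ball 0 r" for y
      unfolding has_derivative_at
    proof (rule conjI)
      show "bounded_linear (blinfun_apply (F (y, u y)))" by (rule blinfun.bounded_linear_right)
      have yr: "norm y < r" using y by simp
      define z where "z t = (t *\<^sub>R y, P y t)" for t
      have zK: "z t \<in> K" if "t \<in> {0..1}" for t
        unfolding z_def using inK PR that yr by auto
      have zder: "(z has_vector_derivative (y, F (z t) y)) (at t within {0..1})" if t: "t \<in> {0..1}" for t
      proof -
        have "((\<lambda>t. t *\<^sub>R y) has_vector_derivative y) (at t within {0..1})"
          by (auto intro!: derivative_eq_intros simp: has_vector_derivative_def)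
        then show ?thesis
          using P(3)[OF _ t, of y] yr unfolding z_def G_def has_vector_derivative_def
          by (auto dest: has_derivative_Pair)
      qed
      have est: "\<exists>d>0. \<forall>h. norm h < d \<longrightarrow> norm (u (y + h) - u y - F (y, u y) h) \<le> e * norm h"
        if e: "e > 0" for e
      proof -
        \<comment> \<open>\<open>ode_compare\<close> doubles the defect, so it must not exceed
          \<open>e / 2\<close> times the norm of \<open>h\<close>: one \<open>e / 4\<close> goes to
          the remainder of \<open>F\<close>, the other to the term of second order in
          \<open>h\<close>. The factors \<open>r\<close> and \<open>1 + b\<close> come from the
          bounds for \<open>y + h\<close> and for the increment \<open>k\<close>.\<close>
        define \<eta> where "\<eta> = e / (4 * r * (1 + b))"
        have \<eta>: "\<eta> > 0" using e r b by (simp add: \<eta>_def)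
        obtain \<delta> where \<delta>: "\<delta> > 0" "\<And>z w. z \<in> K \<Longrightarrow> w \<in> K \<Longrightarrow> norm (w - z) < \<delta> \<Longrightarrow>
            norm (F w - F z - F' z (w - z)) \<le> \<eta> * norm (w - z)"
          using uniformly_differentiable_on_compact[OF K _ contF' \<eta>] der KW by blast
        \<comment> \<open>The four bounds keep \<open>y + h\<close> within radius \<open>r\<close>,
          the increment \<open>k\<close> within \<open>\<delta>\<close>, the curve \<open>q\<close>
          in the ball of radius \<open>R\<close>, and the second order term below
          \<open>e / 4\<close>.\<close>
        define d where "d = min (min (r - norm y) (\<delta> / (1 + b))) (min (R / (2 * b)) (e / (4 * c * (1 + b))))"
        have "d > 0" using yr \<delta>(1) b(1) c(1) R e by (simp add: d_def)
        moreover have "norm (u (y + h) - u y - F (y, u y) h) \<le> e * norm h" if h: "norm h < d" for h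
        proof -
          have h1: "norm (y + h) \<le> r" using h norm_triangle_ineq[of y h] by (simp add: d_def)
          have h2: "(1 + b) * norm h < \<delta>" using h b(1) by (simp add: d_def field_simps)
          have h3: "b * norm h \<le> R / 2" using h b(1) by (simp add: d_def field_simps)
          have "norm h < e / (4 * c * (1 + b))" using h by (simp add: d_def)
          then have "norm h * (4 * c * (1 + b)) < e"
            using b(1) c(1) by (subst (asm) pos_less_divide_eq) auto
          then have h4: "c * (1 + b) * norm h \<le> e / 4" by (simp add: algebra_simps)
          define q where "q t = P y t + t *\<^sub>R F (z t) h" for t
          define q' where "q' t = F (z t) y + (F (z t) h + t *\<^sub>R F' (z t) (y, F (z t) y) h)" for t
          have qder: "(q has_vector_derivative q' t) (at t within {0..1})" if t: "t \<in> {0..1}" for t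
          proof -
            have "((\<lambda>t. F (z t)) has_vector_derivative F' (z t) (y, F (z t) y)) (at t within {0..1})"
            proof -
              have "(F has_derivative F' (z t)) (at (z t) within z ` {0..1})"
                using der zK[OF t] KW by (blast intro: has_derivative_at_withinI)
              from has_derivative_in_compose[OF zder[OF t, unfolded has_vector_derivative_def] this]
              show ?thesis by (simp add: has_vector_derivative_def blinfun.scaleR_right flip: scaleR_Pair)
            qed
            from bounded_linear.has_vector_derivative[OF blinfun.bounded_linear_left this]
            have "((\<lambda>t. F (z t) h) has_vector_derivative F' (z t) (y, F (z t) y) h) (at t within {0..1})" .
            from has_vector_derivative_scaleR[OF DERIV_ident this]
            have "((\<lambda>t. t *\<^sub>R F (z t) h) has_vector_derivative
                (F (z t) h + t *\<^sub>R F' (z t) (y, F (z t) y) h)) (at t within {0..1})"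
              by (simp add: add.commute)
            from has_vector_derivative_add[OF P(3)[OF less_imp_le[OF yr] t] this]
            show ?thesis by (simp add: q_def[abs_def] q'_def G_def z_def)
          qed
          have qR: "q t \<in> cball x0 R" if t: "t \<in> {0..1}" for t
          proof -
            have "norm (t *\<^sub>R F (z t) h) \<le> norm (F (z t) h)"
              using t by (simp add: mult_left_le_one_le)
            also have "\<dots> \<le> norm (F (z t)) * norm h" by (rule norm_blinfun)
            also have "\<dots> \<le> b * norm h" using b(2)[OF zK[OF t]] by (simp add: mult_right_mono)
            also have "\<dots> \<le> R / 2" by (rule h3)
            finally have "norm (t *\<^sub>R F (z t) h) \<le> R / 2" .
            moreover have "norm (x0 - P y t) \<le> R / 2" using P(2)[OF less_imp_le[OF yr] t] by (simp add: dist_norm)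
            ultimately show ?thesis
              using norm_triangle_ineq4[of "x0 - P y t" "t *\<^sub>R F (z t) h"]
              by (simp add: q_def dist_norm algebra_simps)
          qed
          have "norm (P (y + h) 1 - q 1) \<le> 2 * (e / 2 * norm h)"
          proof (rule ode_compare[OF P(3)[OF h1] qder])
            show "P (y + h) 0 = q 0" using P(1)[OF h1] P(1)[of y] yr by (simp add: q_def)
            fix t :: real assume t: "t \<in> {0..1}"
            define k where "k = t *\<^sub>R (h, F (z t) h)"
            have zk: "z t + k = (t *\<^sub>R (y + h), q t)" by (simp add: z_def k_def q_def scaleR_add_right)
            have zkK: "z t + k \<in> K" unfolding zk using inK[OF h1 t qR[OF t]] .
            have "norm k \<le> norm (h, F (z t) h)" using t by (simp add: k_def mult_left_le_one_le del: scaleR_Pair)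
            also have "\<dots> \<le> norm h + norm (F (z t) h)" by (rule norm_Pair_le)
            also have "\<dots> \<le> norm h + b * norm h"
              using norm_blinfun[of "F (z t)" h] b(2)[OF zK[OF t]] by (meson add_left_mono mult_right_mono norm_ge_zero order_trans)
            finally have k: "norm k \<le> (1 + b) * norm h" by (simp add: algebra_simps)
            define rem where "rem = F (z t + k) - F (z t) - F' (z t) k"
            have rem: "norm rem \<le> \<eta> * ((1 + b) * norm h)"
            proof -
              have "norm rem \<le> \<eta> * norm k"
                using \<delta>(2)[OF zK[OF t] zkK] k h2 by (simp add: rem_def)
              also have "\<dots> \<le> \<eta> * ((1 + b) * norm h)" using k \<eta> by simp
              finally show ?thesis .
            qed
            \<comment> \<open>Integrability enters here: exchanging \<open>h\<close> and
              \<open>y\<close> turns the variation of \<open>F\<close> applied to \<open>y\<close>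
              into the very term of \<open>q'\<close> that comes from differentiating
              \<open>F (z t) h\<close> along the ray, so all terms of first order cancel.\<close>
            have "F' (z t) k y = t *\<^sub>R F' (z t) (y, F (z t) y) h"
              using integrable[OF subsetD[OF KW zK[OF t]], of h y]
              by (simp add: k_def blinfun.scaleR_right blinfun.scaleR_left del: scaleR_Pair)
            moreover have "G (y + h) (t, q t) = F (z t + k) (y + h)" by (simp add: G_def zk)
            ultimately have "G (y + h) (t, q t) - q' t = rem (y + h) + F' (z t) k h"
              by (simp add: q'_def rem_def blinfun.diff_left blinfun.add_right)
            also have "norm \<dots> \<le> norm rem * norm (y + h) + norm (F' (z t)) * norm k * norm h"
              using norm_triangle_ineq[of "rem (y + h)" "F' (z t) k h"] norm_blinfun[of rem "y + h"]
                norm_blinfun[of "F' (z t) k" h] mult_right_mono[OF norm_blinfun[of "F' (z t)" k], of "norm h"]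
              by simp
            also have "\<dots> \<le> (\<eta> * ((1 + b) * norm h)) * r + c * ((1 + b) * norm h) * norm h"
              using rem h1 c(2)[OF zK[OF t]] k c(1) b(1) \<eta> by (intro add_mono mult_mono) auto
            also have "\<dots> = (\<eta> * (1 + b) * r + c * (1 + b) * norm h) * norm h" by (simp add: algebra_simps)
            also have "\<dots> \<le> (e / 4 + e / 4) * norm h"
            proof (intro mult_right_mono add_mono)
              show "\<eta> * (1 + b) * r \<le> e / 4" using b(1) r(1) by (simp add: \<eta>_def)
            qed (use h4 in auto)
            finally have "norm (G (y + h) (t, q t) - q' t) \<le> e / 2 * norm h" by simp
            then show "norm (G (y + h) (t, P (y + h) t) - q' t) \<le> norm (P (y + h) t - q t) / 2 + e / 2 * norm h"
              using lipG[OF h1 t PR[OF h1 t] qR[OF t]]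
                norm_triangle_ineq[of "G (y + h) (t, P (y + h) t) - G (y + h) (t, q t)" "G (y + h) (t, q t) - q' t"]
              by simp
          qed simp_all
          then show ?thesis by (simp add: u_def q_def z_def diff_diff_eq)
        qed
        ultimately show ?thesis by blast
      qed
      show "(\<lambda>h. norm (u (y + h) - u y - F (y, u y) h) / norm h) \<midarrow>0\<rightarrow> 0"
        unfolding LIM_eq
      proof (intro allI impI)
        fix e :: real assume "e > 0"
        then obtain d where d: "d > 0" "\<And>h. norm h < d \<Longrightarrow> norm (u (y + h) - u y - F (y, u y) h) \<le> e / 2 * norm h"
          using est[of "e / 2"] by auto
        have "norm (u (y + h) - u y - F (y, u y) h) / norm h < e" if "h \<noteq> 0" "norm h < d" for h
        proof -
          have "norm (u (y + h) - u y - F (y, u y) h) / norm h \<le> e / 2"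
            using d(2)[OF that(2)] that(1) by (simp add: field_simps)
          also have "\<dots> < e" using \<open>e > 0\<close> by simp
          finally show ?thesis .
        qed
        then show "\<exists>d>0. \<forall>h. h \<noteq> 0 \<and> norm (h - 0) < d \<longrightarrow>
            norm (norm (u (y + h) - u y - F (y, u y) h) / norm h - 0) < e"
          using d(1) by auto
      qed
    qed
  qed (use r in auto)
qed

section \<open>Exponentials of linear maps with exponential polynomial coefficients\<close>

text \<open>A normal form without a product rule, so that linear equations can be solved term by
  term. Exponents are complex because they will be roots of a real polynomial.\<close>

inductive exp_polynomial :: "(real \<Rightarrow> complex) \<Rightarrow> bool" where
  monomial: "exp_polynomial (\<lambda>t. c * of_real t ^ k * exp (l * of_real t))"
| add: "exp_polynomial f \<Longrightarrow> exp_polynomial g \<Longrightarrow> exp_polynomial (\<lambda>t. f t + g t)"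

lemma exp_polynomial_scale: "exp_polynomial f \<Longrightarrow> exp_polynomial (\<lambda>t. a * f t)"
proof (induction rule: exp_polynomial.induct)
  case (monomial c k l)
  then show ?case using exp_polynomial.monomial[of "a * c" k l] by (simp add: mult.assoc)
qed (simp add: distrib_left exp_polynomial.add)

lemma exp_polynomial_zero: "exp_polynomial (\<lambda>t. 0)"
  using exp_polynomial.monomial[of 0 0 0] by simp

lemma exp_polynomial_cnj: "exp_polynomial f \<Longrightarrow> exp_polynomial (\<lambda>t. cnj (f t))"
proof (induction rule: exp_polynomial.induct)
  case (monomial c k l)
  then show ?case using exp_polynomial.monomial[of "cnj c" k "cnj l"] by (simp add: exp_cnj)
qed (simp add: exp_polynomial.add)

text \<open>Conjugation only conjugates coefficients and exponents, and the real part is the mean of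
  a function and its conjugate.\<close>

lemma exp_polynomial_Re:
  assumes "exp_polynomial f"
  shows "exp_polynomial (\<lambda>t. of_real (Re (f t)))"
proof -
  have "exp_polynomial (\<lambda>t. 1 / 2 * (f t + cnj (f t)))"
    by (intro exp_polynomial_scale exp_polynomial.add exp_polynomial_cnj assms)
  then show ?thesis by (simp add: complex_add_cnj)
qed

lemma exp_polynomial_reflect: "exp_polynomial f \<Longrightarrow> exp_polynomial (\<lambda>t. f (- t))"
proof (induction rule: exp_polynomial.induct)
  case (monomial c k l)
  have "c * of_real (- t) ^ k * exp (l * of_real (- t)) = c * (- 1) ^ k * of_real t ^ k * exp (- l * of_real t)"
    for t :: real
    by (simp add: power_minus[of "of_real t"] mult.assoc)
  then show ?case using exp_polynomial.monomial[of "c * (- 1) ^ k" k "- l"] by (simp only:)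
qed (simp add: exp_polynomial.add)

lemma monomial_has_vector_derivative:
  "((\<lambda>t. a * of_real t ^ k * exp (l * of_real t)) has_vector_derivative
     l * (a * of_real t ^ k * exp (l * of_real t)) + a * of_nat k * (of_real t ^ (k - 1) * exp (l * of_real t))) (at t)"
  for a l :: complex
proof -
  have "((\<lambda>z. a * z ^ k * exp (l * z)) has_field_derivative
      l * (a * z ^ k * exp (l * z)) + a * of_nat k * (z ^ (k - 1) * exp (l * z))) (at z)" for z
    by (rule derivative_eq_intros refl)+ (simp add: algebra_simps)
  from has_vector_derivative_real_field[OF this] show ?thesis .
qed

text \<open>In the resonant case \<open>m = l\<close> the degree rises by one; otherwise a solution
  is found by induction on the degree.\<close>

lemma exp_polynomial_ode_monomial:
  "\<exists>r. exp_polynomial r \<and>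
     (\<forall>t. (r has_vector_derivative (l * r t + of_real t ^ k * exp (m * of_real t))) (at t))"
proof (cases "m = l")
  case True
  define a :: complex where "a = 1 / of_nat (Suc k)"
  define r where "r t = a * of_real t ^ Suc k * exp (l * of_real t)" for t :: real
  have "exp_polynomial r" unfolding r_def by (rule exp_polynomial.monomial)
  moreover have "a * of_nat (Suc k) = 1" by (simp add: a_def del: of_nat_Suc)
  then have "(r has_vector_derivative (l * r t + of_real t ^ k * exp (m * of_real t))) (at t)" for t
    using monomial_has_vector_derivative[of a "Suc k" l t] unfolding r_def True by simp
  ultimately show ?thesis by blast
next
  case False
  then have ml: "m - l \<noteq> 0" by simp
  show ?thesis
  proof (induction k)
    case 0
    define r where "r t = 1 / (m - l) * of_real t ^ 0 * exp (m * of_real t)" for t :: real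
    have "exp_polynomial r" unfolding r_def by (rule exp_polynomial.monomial)
    moreover have "m * r t = l * r t + of_real t ^ 0 * exp (m * of_real t)" for t
      using ml by (simp add: r_def divide_simps) (simp add: algebra_simps)
    then have "(r has_vector_derivative (l * r t + of_real t ^ 0 * exp (m * of_real t))) (at t)" for t
      using monomial_has_vector_derivative[of "1 / (m - l)" 0 m t] by (simp add: r_def[abs_def])
    ultimately show ?case by blast
  next
    case (Suc k)
    then obtain r where r: "exp_polynomial r"
      "\<And>t. (r has_vector_derivative (l * r t + of_real t ^ k * exp (m * of_real t))) (at t)" by blast
    \<comment> \<open>\<open>s\<close> solves the equation up to the surplus \<open>a\<close> times
      the monomial of degree \<open>k\<close>, which \<open>- a\<close> times the solution
      \<open>r\<close> for degree \<open>k\<close> removes.\<close>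
    define s where "s t = 1 / (m - l) * of_real t ^ Suc k * exp (m * of_real t)" for t :: real
    define a where "a = 1 / (m - l) * of_nat (Suc k)"
    have "exp_polynomial (\<lambda>t. s t + (- a) * r t)"
      unfolding s_def by (intro exp_polynomial.intros exp_polynomial_scale r)
    moreover have "((\<lambda>t. s t + (- a) * r t) has_vector_derivative
        (l * (s t + (- a) * r t) + of_real t ^ Suc k * exp (m * of_real t))) (at t)" for t
    proof -
      have s: "(s has_vector_derivative m * s t + a * (of_real t ^ k * exp (m * of_real t))) (at t)"
        using monomial_has_vector_derivative[of "1 / (m - l)" "Suc k" m t]
        unfolding s_def a_def diff_Suc_1 .
      have "s t * (m - l) = of_real t ^ Suc k * exp (m * of_real t)"
        using ml by (simp add: s_def)
      then have "m * s t + a * (of_real t ^ k * exp (m * of_real t)) + (- a) * (l * r t + of_real t ^ k * exp (m * of_real t))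
        = l * (s t + (- a) * r t) + of_real t ^ Suc k * exp (m * of_real t)"
        by (simp add: algebra_simps)
      with has_vector_derivative_add[OF s has_vector_derivative_mult_right[OF r(2), of "- a" t]]
      show ?thesis by (simp only:)
    qed
    ultimately show ?case by blast
  qed
qed

text \<open>Superposition of the solutions for the monomials; a multiple of
  \<open>exp (l * t)\<close> then adjusts the initial value.\<close>

lemma exp_polynomial_ode:
  assumes "exp_polynomial g"
  shows "\<exists>r. exp_polynomial r \<and> r 0 = a \<and> (\<forall>t. (r has_vector_derivative (l * r t + g t)) (at t))"
proof -
  have "\<exists>r. exp_polynomial r \<and> (\<forall>t. (r has_vector_derivative (l * r t + g t)) (at t))"
    using assms
  proof (induction rule: exp_polynomial.induct)
    case (monomial c k m)
    obtain r where r: "exp_polynomial r"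
      "\<And>t. (r has_vector_derivative (l * r t + of_real t ^ k * exp (m * of_real t))) (at t)"
      using exp_polynomial_ode_monomial by blast
    have "((\<lambda>t. c * r t) has_vector_derivative (l * (c * r t) + c * of_real t ^ k * exp (m * of_real t))) (at t)" for t
      using has_vector_derivative_mult_right[OF r(2), of c t] by (simp add: algebra_simps)
    with exp_polynomial_scale[OF r(1)] show ?case by blast
  next
    case (add f g)
    then obtain r s where r: "exp_polynomial r" "\<And>t. (r has_vector_derivative (l * r t + f t)) (at t)"
      and s: "exp_polynomial s" "\<And>t. (s has_vector_derivative (l * s t + g t)) (at t)" by blast
    have "((\<lambda>t. r t + s t) has_vector_derivative (l * (r t + s t) + (f t + g t))) (at t)" for t
      using has_vector_derivative_add[OF r(2) s(2), of t] by (simp add: algebra_simps)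
    with exp_polynomial.add[OF r(1) s(1)] show ?case by blast
  qed
  then obtain r where r: "exp_polynomial r" "\<And>t. (r has_vector_derivative (l * r t + g t)) (at t)" by blast
  define s where "s t = (a - r 0) * of_real t ^ 0 * exp (l * of_real t)" for t :: real
  have s: "exp_polynomial s" unfolding s_def by (rule exp_polynomial.monomial)
  have "(s has_vector_derivative l * s t) (at t)" for t
    using monomial_has_vector_derivative[of "a - r 0" 0 l t] by (simp add: s_def[abs_def])
  then have "((\<lambda>t. r t + s t) has_vector_derivative (l * (r t + s t) + g t)) (at t)" for t
    using has_vector_derivative_add[OF r(2), of s "l * s t" t] by (simp add: algebra_simps)
  with exp_polynomial.add[OF r(1) s] show ?thesis by (auto simp: s_def intro!: exI[of _ "\<lambda>t. r t + s t"])
qed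

text \<open>Putzer's algorithm: \<open>Q t\<close> is the residue of \<open>exp (t x)\<close> modulo \<open>P\<close>, so evaluating it at
  a linear map annihilated by \<open>P\<close> gives the exponential of that map.\<close>

lemma putzer:
  fixes A :: "complex multiset"
  defines "P \<equiv> (\<Prod>x\<in>#A. [:-x, 1:])"
  shows "\<exists>Q \<rho>. exp_polynomial \<rho> \<and> (\<forall>j. exp_polynomial (\<lambda>t. coeff (Q t) j)) \<and>
    (\<forall>t j. j \<ge> size A \<longrightarrow> coeff (Q t) j = 0) \<and> Q 0 = (if A = {#} then 0 else 1) \<and>
    (\<forall>t j. ((\<lambda>t. coeff (Q t) j) has_vector_derivative coeff (pCons 0 (Q t) - smult (\<rho> t) P) j) (at t))"
  unfolding P_def
proof (induction A)
  case empty
  show ?case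
    by (intro exI[of _ "\<lambda>_. 0"]) (auto simp: exp_polynomial_zero)
next
  case (add x A)
  let ?P = "\<Prod>x\<in>#A. [:-x, 1:]"
  have deg: "degree ?P = size A"
  proof (induction A)
    case (add x A)
    have "(\<Prod>x\<in>#A. [:-x, 1:]) \<noteq> 0" by (auto simp: prod_mset_zero_iff)
    then show ?case
      using degree_mult_eq[of "[:-x, 1:]" "\<Prod>x\<in>#A. [:-x, 1:]"] add by (simp del: mult_pCons_left)
  qed simp
  obtain Q \<rho> where Q: "exp_polynomial \<rho>" "\<And>j. exp_polynomial (\<lambda>t. coeff (Q t) j)"
    "\<And>t j. j \<ge> size A \<Longrightarrow> coeff (Q t) j = 0" "Q 0 = (if A = {#} then 0 else 1)"
    "\<And>t j. ((\<lambda>t. coeff (Q t) j) has_vector_derivative coeff (pCons 0 (Q t) - smult (\<rho> t) ?P) j) (at t)"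
    using add.IH by blast
  \<comment> \<open>The first root raises the value of \<open>Q\<close> at 0 from the zero
    polynomial to 1; all later roots start with \<open>r 0 = 0\<close> and preserve it.\<close>
  obtain r where r: "exp_polynomial r" "r 0 = (if A = {#} then 1 else 0)"
    "\<And>t. (r has_vector_derivative (x * r t + \<rho> t)) (at t)"
    using exp_polynomial_ode[OF Q(1)] by blast
  \<comment> \<open>X times \<open>r P\<close> is \<open>x r P\<close> plus
    \<open>r (X - x) P\<close>. The first part and the equation for \<open>r\<close> cancel the old
    defect \<open>\<rho> P\<close>, and \<open>r\<close> becomes the coefficient of the enlarged
    product.\<close>
  define Q' where "Q' t = Q t + smult (r t) ?P" for t
  have "exp_polynomial (\<lambda>t. coeff (Q' t) j)" for j
    using exp_polynomial.add[OF Q(2) exp_polynomial_scale[OF r(1), of "coeff ?P j"]]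
    by (simp add: Q'_def mult.commute)
  moreover have "coeff (Q' t) j = 0" if "j \<ge> size (add_mset x A)" for t j
    using that Q(3) deg by (simp add: Q'_def coeff_eq_0)
  moreover have "Q' 0 = 1" using Q(4) r(2) by (simp add: Q'_def)
  moreover have "((\<lambda>t. coeff (Q' t) j) has_vector_derivative
      coeff (pCons 0 (Q' t) - smult (r t) (\<Prod>x\<in>#add_mset x A. [:-x, 1:])) j) (at t)" for t j
  proof -
    have "pCons 0 (Q' t) - smult (r t) (\<Prod>x\<in>#add_mset x A. [:-x, 1:]) =
        (pCons 0 (Q t) - smult (\<rho> t) ?P) + smult (x * r t + \<rho> t) ?P"
      by (simp add: Q'_def algebra_simps smult_add_left smult_add_right flip: smult_smult
          add: poly_eq_iff coeff_pCons split: nat.splits)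
    moreover have "((\<lambda>t. coeff (Q' t) j) has_vector_derivative
        coeff ((pCons 0 (Q t) - smult (\<rho> t) ?P) + smult (x * r t + \<rho> t) ?P) j) (at t)"
      unfolding Q'_def coeff_add coeff_smult
      using has_vector_derivative_add[OF Q(5)[of j t] has_vector_derivative_mult_left[OF r(3)[of t], of "coeff ?P j"]]
      by simp
    ultimately show ?thesis by (simp only:)
  qed
  ultimately show ?case using r(1) by (intro exI[of _ Q'] exI[of _ r]) auto
qed

text \<open>The roots require complex numbers, but since \<open>p\<close> is real, taking real parts
  of the complex solution respects the differential equations.\<close>

lemma real_putzer:
  fixes p :: "real poly"
  assumes "lead_coeff p = 1" "degree p > 0"
  obtains q \<rho> where "\<And>j. exp_polynomial (\<lambda>t. of_real (q j t))"
    "\<And>t j. j \<ge> degree p \<Longrightarrow> q j t = 0" "\<And>j. q j 0 = (if j = 0 then 1 else 0)"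
    "\<And>t j. (q j has_real_derivative ((if j = 0 then 0 else q (j - 1) t) - \<rho> t * coeff p j)) (at t)"
proof -
  let ?p = "map_poly complex_of_real p"
  have p: "degree ?p = degree p" "lead_coeff ?p = 1" "?p \<noteq> 0" "\<And>j. coeff ?p j = of_real (coeff p j)"
    using assms by (auto simp: degree_map_poly coeff_map_poly map_poly_eq_0_iff)
  obtain A where A: "size A = degree p" "?p = (\<Prod>x\<in>#A. [:-x, 1:])"
    using alg_closed_imp_factorization[OF p(3)] p(1,2) by auto
  obtain Q \<rho> where Q: "exp_polynomial \<rho>" "\<And>j. exp_polynomial (\<lambda>t. coeff (Q t) j)"
    "\<And>t j. j \<ge> degree p \<Longrightarrow> coeff (Q t) j = 0" "Q 0 = 1"
    "\<And>t j. ((\<lambda>t. coeff (Q t) j) has_vector_derivative coeff (pCons 0 (Q t) - smult (\<rho> t) ?p) j) (at t)"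
    using putzer[of A] A assms(2) by (auto split: if_splits)
  show thesis
  proof (rule that[of "\<lambda>j t. Re (coeff (Q t) j)" "\<lambda>t. Re (\<rho> t)"])
    show "exp_polynomial (\<lambda>t. of_real (Re (coeff (Q t) j)))" for j
      by (rule exp_polynomial_Re[OF Q(2)])
    show "Re (coeff (Q t) j) = 0" if "j \<ge> degree p" for t j using Q(3)[OF that] by simp
    show "Re (coeff (Q 0) j) = (if j = 0 then 1 else 0)" for j using Q(4) by (simp add: coeff_pCons one_pCons split: nat.splits)
    show "((\<lambda>t. Re (coeff (Q t) j)) has_real_derivative
        ((if j = 0 then 0 else Re (coeff (Q t) (j - 1))) - Re (\<rho> t) * coeff p j)) (at t)" for t j
      using bounded_linear.has_vector_derivative[OF bounded_linear_Re Q(5)[of j t]]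
      by (cases j) (simp_all add: has_real_derivative_iff_has_vector_derivative p(4))
  qed
qed

section \<open>Polynomials annihilating a linear map\<close>

lemma sum_fun_apply: "(\<Sum>i\<in>I. f i) x = (\<Sum>i\<in>I. f i x)"
  by (induction I rule: infinite_finite_induct) auto

text \<open>There is a dependence among the first \<open>card T + 1\<close> members. Since
  \<open>dependent\<close> speaks about sets, a repeated value is treated separately; there the
  difference of two monomials serves as \<open>p\<close>.\<close>

lemma sequence_in_span_dependent:
  fixes f :: "nat \<Rightarrow> 'v::real_vector"
  assumes "finite T" "\<And>j. f j \<in> span T"
  shows "\<exists>p. p \<noteq> (0::real poly) \<and> (\<Sum>j\<le>degree p. coeff p j *\<^sub>R f j) = 0"
proof -
  define N where "N = card T"
  have "\<exists>c. (\<exists>j\<le>N. c j \<noteq> (0::real)) \<and> (\<Sum>j\<le>N. c j *\<^sub>R f j) = 0"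
  proof (cases "inj_on f {..N}")
    case True
    then have "card (f ` {..N}) > card T" by (simp add: card_image N_def)
    then have "dependent (f ` {..N})"
      using independent_span_bound[OF assms(1), of "f ` {..N}"] assms(2) by fastforce
    then obtain u where u: "\<exists>v\<in>f ` {..N}. u v \<noteq> 0" "(\<Sum>v\<in>f ` {..N}. u v *\<^sub>R v) = 0"
      by (auto simp: dependent_finite)
    then show ?thesis
      by (intro exI[of _ "\<lambda>j. u (f j)"]) (auto simp: sum.reindex[OF True])
  next
    case False
    then obtain i j where ij: "i \<le> N" "j \<le> N" "i \<noteq> j" "f i = f j" by (auto simp: inj_on_def)
    have "(\<Sum>k\<le>N. ((if k = i then 1 else 0) - (if k = j then 1 else 0)) *\<^sub>R f k) = f i - f j"
      using ij by (simp add: scaleR_diff_left sum_subtractf if_distrib[of "\<lambda>c. c *\<^sub>R _"] cong: if_cong)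
    then show ?thesis
      using ij by (intro exI[of _ "\<lambda>k. (if k = i then 1 else 0) - (if k = j then 1 else 0)"]) auto
  qed
  then obtain c where c: "\<exists>j\<le>N. c j \<noteq> (0::real)" "(\<Sum>j\<le>N. c j *\<^sub>R f j) = 0" by blast
  define p where "p = (\<Sum>j\<le>N. monom (c j) j)"
  have cp: "coeff p j = (if j \<le> N then c j else 0)" for j
    by (simp add: p_def coeff_sum if_distrib cong: if_cong)
  have "p \<noteq> 0" using c(1) cp by (metis coeff_0)
  moreover have "degree p \<le> N" by (rule degree_le) (simp add: cp)
  then have "(\<Sum>j\<le>degree p. coeff p j *\<^sub>R f j) = (\<Sum>j\<le>N. coeff p j *\<^sub>R f j)"
    by (intro sum.mono_neutral_left) (auto simp: coeff_eq_0)
  then have "(\<Sum>j\<le>degree p. coeff p j *\<^sub>R f j) = 0" using c(2) cp by simp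
  ultimately show ?thesis by blast
qed

text \<open>The factor \<open>x\<close> of the annihilating polynomial makes the residue of \<open>exp (t x)\<close> have constant
  term \<open>1\<close>.\<close>

lemma linear_annihilating_polynomial:
  fixes A :: "'v::real_vector \<Rightarrow> 'v"
  assumes "linear A" "finite B" "A ` span B \<subseteq> span B"
  obtains p :: "real poly" where "lead_coeff p = 1" "degree p > 0" "coeff p 0 = 0"
    "\<And>w. w \<in> span B \<Longrightarrow> (\<Sum>j\<le>degree p. coeff p j *\<^sub>R (A ^^ j) w) = 0"
proof -
  have lin: "linear (A ^^ j)" for j
  proof (induction j)
    case (Suc j)
    from linear_compose[OF this assms(1)] show ?case by (simp only: funpow.simps)
  qed (simp add: linear_iff)
  have AB: "(A ^^ j) b \<in> span B" if "b \<in> span B" for j b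
    using that by (induction j) (use assms(3) in auto)
  \<comment> \<open>The restriction \<open>f j\<close> of \<open>A ^^ j\<close> to \<open>B\<close>
    is a vector in the finite-dimensional space spanned by the matrix units \<open>e b c\<close>; a
    relation between the powers of \<open>A\<close> becomes a linear dependence there.\<close>
  define e where "e b c = (\<lambda>x. if x = b then c else (0::'v))" for b c :: 'v
  define f where "f j = (\<lambda>x. if x \<in> B then (A ^^ j) x else 0)" for j
  define T where "T = (\<lambda>(b, c). e b c) ` (B \<times> B)"
  have eT: "e b c \<in> span T" if "b \<in> B" "c \<in> span B" for b c
  proof -
    have "linear (e b)" by (auto simp: e_def linear_iff fun_eq_iff scaleR_fun_def)
    then have "e b c \<in> span (e b ` B)" using that(2) by (simp add: linear_span_image)
    also have "\<dots> \<subseteq> span T" by (rule span_mono) (use that in \<open>auto simp: T_def\<close>)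
    finally show ?thesis .
  qed
  have "f j \<in> span T" for j
  proof -
    have "f j = (\<Sum>b\<in>B. e b ((A ^^ j) b))"
      using assms(2) by (auto simp: f_def e_def fun_eq_iff sum_fun_apply)
    also have "\<dots> \<in> span T"
      by (rule span_sum, rule eT, assumption, rule AB[OF span_base])
    finally show ?thesis .
  qed
  then obtain p where p: "p \<noteq> (0::real poly)" "(\<Sum>j\<le>degree p. coeff p j *\<^sub>R f j) = 0"
    using sequence_in_span_dependent[of T f] assms(2) by (auto simp: T_def)
  have pB: "(\<Sum>j\<le>degree p. coeff p j *\<^sub>R (A ^^ j) b) = 0" if "b \<in> B" for b
    using fun_cong[OF p(2), of b] that by (simp add: sum_fun_apply scaleR_fun_def f_def)
  have pL: "(\<Sum>j\<le>degree p. coeff p j *\<^sub>R (A ^^ j) w) = 0" if "w \<in> span B" for w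
  proof -
    have "linear (\<lambda>w. \<Sum>j\<le>degree p. coeff p j *\<^sub>R (A ^^ j) w)"
      by (intro linear_compose_sum ballI linear_compose_scale_right lin)
    from linear_eq_0_on_span[OF this pB that] show ?thesis .
  qed
  define r where "r = smult (inverse (lead_coeff p)) (pCons 0 p)"
  have r: "degree r = Suc (degree p)" "\<And>j. coeff r (Suc j) = inverse (lead_coeff p) * coeff p j"
    using p(1) by (simp_all add: r_def degree_pCons_eq)
  show thesis
  proof (rule that[of r])
    show "lead_coeff r = 1" "degree r > 0" "coeff r 0 = 0" using p(1) r by (simp_all add: r_def)
    show "(\<Sum>j\<le>degree r. coeff r j *\<^sub>R (A ^^ j) w) = 0" if "w \<in> span B" for w
    proof -
      have "(\<Sum>j\<le>degree r. coeff r j *\<^sub>R (A ^^ j) w) =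
          (\<Sum>j\<le>degree p. coeff r (Suc j) *\<^sub>R (A ^^ Suc j) w)"
        unfolding r(1) sum.atMost_Suc_shift by (simp add: r_def)
      also have "\<dots> = inverse (lead_coeff p) *\<^sub>R A (\<Sum>j\<le>degree p. coeff p j *\<^sub>R (A ^^ j) w)"
        using assms(1) by (simp add: r(2) linear_sum linear_cmul scaleR_sum_right)
      finally show ?thesis using pL[OF that] linear_0[OF assms(1)] by simp
    qed
  qed
qed

section \<open>Exponentials of inner derivations\<close>

text \<open>The identity chart is used so that all computations take place in coordinate space
  before a chart exists; \<open>poly_exp_algebra_comp\<close> substitutes the actual chart at the
  end.\<close>

definition real_poly_exp :: "(real^'n \<Rightarrow> real) \<Rightarrow> bool" where
  "real_poly_exp f \<longleftrightarrow> (\<lambda>y. complex_of_real (f y)) \<in> poly_exp_algebra (\<lambda>y. y)"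

lemma poly_exp_algebra_const: "(\<lambda>x. c) \<in> poly_exp_algebra y"
proof -
  have "(\<lambda>x. exp (0 * complex_of_real (y x $ i))) \<in> poly_exp_algebra y" for i
    unfolding poly_exp_algebra_def by (rule generated_algebra.generator) blast
  from generated_algebra.scale[OF this[unfolded poly_exp_algebra_def], of c]
  show ?thesis by (simp add: poly_exp_algebra_def)
qed

lemma poly_exp_algebra_mult:
  "f \<in> poly_exp_algebra y \<Longrightarrow> g \<in> poly_exp_algebra y \<Longrightarrow> (\<lambda>x. f x * g x) \<in> poly_exp_algebra y"
  unfolding poly_exp_algebra_def by (rule generated_algebra.mult)

lemma poly_exp_algebra_add:
  "f \<in> poly_exp_algebra y \<Longrightarrow> g \<in> poly_exp_algebra y \<Longrightarrow> (\<lambda>x. f x + g x) \<in> poly_exp_algebra y"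
  unfolding poly_exp_algebra_def by (rule generated_algebra.add)

lemma poly_exp_algebra_coord: "(\<lambda>x. complex_of_real (y x $ i)) \<in> poly_exp_algebra y"
  unfolding poly_exp_algebra_def by (rule generated_algebra.generator) blast

lemma poly_exp_algebra_exp: "(\<lambda>x. exp (l * complex_of_real (y x $ i))) \<in> poly_exp_algebra y"
  unfolding poly_exp_algebra_def by (rule generated_algebra.generator) blast

lemma poly_exp_algebra_induct [consumes 1, case_names const coord exp add mult]:
  assumes "f \<in> poly_exp_algebra y" "\<And>c. P (\<lambda>x. c)" "\<And>i. P (\<lambda>x. complex_of_real (y x $ i))"
    "\<And>l i. P (\<lambda>x. exp (l * complex_of_real (y x $ i)))"
    "\<And>f g. P f \<Longrightarrow> P g \<Longrightarrow> f \<in> poly_exp_algebra y \<Longrightarrow> g \<in> poly_exp_algebra y \<Longrightarrow> P (\<lambda>x. f x + g x)"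
    "\<And>f g. P f \<Longrightarrow> P g \<Longrightarrow> f \<in> poly_exp_algebra y \<Longrightarrow> g \<in> poly_exp_algebra y \<Longrightarrow> P (\<lambda>x. f x * g x)"
  shows "P f"
  using assms(1) unfolding poly_exp_algebra_def
proof (induction rule: generated_algebra.induct)
  case (generator f)
  then show ?case using assms(3,4) by blast
next
  case (scale f a)
  show ?case
    by (rule assms(6)[OF assms(2) scale.IH poly_exp_algebra_const]) (use scale.hyps in \<open>simp add: poly_exp_algebra_def\<close>)
next
  case (add f g)
  then show ?case by (intro assms(5)) (simp_all add: poly_exp_algebra_def)
next
  case (mult f g)
  then show ?case by (intro assms(6)) (simp_all add: poly_exp_algebra_def)
qed (rule assms(2))

lemma poly_exp_algebra_comp: "f \<in> poly_exp_algebra (\<lambda>y. y) \<Longrightarrow> (\<lambda>x. f (y x)) \<in> poly_exp_algebra y"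
  by (induction f rule: poly_exp_algebra_induct)
     (auto intro: poly_exp_algebra_const poly_exp_algebra_mult poly_exp_algebra_add
        poly_exp_algebra_coord poly_exp_algebra_exp)

text \<open>Since directional derivatives stay in the algebra, smoothness of all orders follows by a
  simple induction in \<open>real_poly_exp_Ck\<close>.\<close>

lemma poly_exp_algebra_derivative:
  fixes f :: "real^'n \<Rightarrow> complex"
  assumes "f \<in> poly_exp_algebra (\<lambda>y. y)"
  shows "\<exists>D. (\<forall>y. (f has_derivative D y) (at y)) \<and> (\<forall>v. (\<lambda>y. D y v) \<in> poly_exp_algebra (\<lambda>y. y))"
  using assms
proof (induction f rule: poly_exp_algebra_induct)
  case (const c)
  then show ?case by (intro exI[of _ "\<lambda>y v. 0"]) (auto intro: poly_exp_algebra_const)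
next
  case (coord i)
  have "((\<lambda>y::real^'n. complex_of_real (y $ i)) has_derivative (\<lambda>v. complex_of_real (v $ i))) (at y)" for y
    by (intro bounded_linear_imp_has_derivative bounded_linear_compose[OF bounded_linear_of_real bounded_linear_vec_nth])
  then show ?case by (intro exI[of _ "\<lambda>y v. complex_of_real (v $ i)"]) (auto intro: poly_exp_algebra_const)
next
  case (exp l i)
  have "((\<lambda>y::real^'n. exp (l * complex_of_real (y $ i))) has_derivative
      (\<lambda>v. (l * complex_of_real (v $ i)) * exp (l * complex_of_real (y $ i)))) (at y)" for y
  proof -
    have "((\<lambda>y::real^'n. l * complex_of_real (y $ i)) has_derivative (\<lambda>v. l * complex_of_real (v $ i))) (at y)"
      by (intro bounded_linear_imp_has_derivative bounded_linear_const_mult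
          bounded_linear_compose[OF bounded_linear_of_real bounded_linear_vec_nth])
    from has_derivative_compose[OF this DERIV_exp[unfolded has_field_derivative_def]]
    show ?thesis by (simp add: mult.commute)
  qed
  then show ?case
    by (intro exI[of _ "\<lambda>y v. (l * complex_of_real (v $ i)) * exp (l * complex_of_real (y $ i))"])
       (auto intro!: poly_exp_algebra_mult[OF poly_exp_algebra_const] poly_exp_algebra_exp)
next
  case (add f g)
  then obtain D E where D: "\<And>y. (f has_derivative D y) (at y)" "\<And>v. (\<lambda>y. D y v) \<in> poly_exp_algebra (\<lambda>y. y)"
    and E: "\<And>y. (g has_derivative E y) (at y)" "\<And>v. (\<lambda>y. E y v) \<in> poly_exp_algebra (\<lambda>y. y)" by blast
  show ?case
    by (rule exI[of _ "\<lambda>y v. D y v + E y v"])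
       (use has_derivative_add[OF D(1) E(1)] poly_exp_algebra_add[OF D(2) E(2)] in blast)
next
  case (mult f g)
  then obtain D E where D: "\<And>y. (f has_derivative D y) (at y)" "\<And>v. (\<lambda>y. D y v) \<in> poly_exp_algebra (\<lambda>y. y)"
    and E: "\<And>y. (g has_derivative E y) (at y)" "\<And>v. (\<lambda>y. E y v) \<in> poly_exp_algebra (\<lambda>y. y)" by blast
  show ?case
    by (rule exI[of _ "\<lambda>y v. f y * E y v + D y v * g y"])
       (use has_derivative_mult[OF D(1) E(1)] poly_exp_algebra_add[OF poly_exp_algebra_mult[OF mult(3) E(2)]
          poly_exp_algebra_mult[OF D(2) mult(4)]] in blast)
qed

lemma real_poly_exp_const: "real_poly_exp (\<lambda>y. c)"
  unfolding real_poly_exp_def by (rule poly_exp_algebra_const)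

lemma real_poly_exp_add: "real_poly_exp f \<Longrightarrow> real_poly_exp g \<Longrightarrow> real_poly_exp (\<lambda>y. f y + g y)"
  unfolding real_poly_exp_def of_real_add by (rule poly_exp_algebra_add)

lemma real_poly_exp_mult: "real_poly_exp f \<Longrightarrow> real_poly_exp g \<Longrightarrow> real_poly_exp (\<lambda>y. f y * g y)"
  unfolding real_poly_exp_def of_real_mult by (rule poly_exp_algebra_mult)

lemma real_poly_exp_sum: "(\<And>i. i \<in> I \<Longrightarrow> real_poly_exp (f i)) \<Longrightarrow> real_poly_exp (\<lambda>y. \<Sum>i\<in>I. f i y)"
  by (induction I rule: infinite_finite_induct) (auto intro: real_poly_exp_const real_poly_exp_add)

lemma real_poly_exp_coord:
  assumes "exp_polynomial (\<lambda>t. of_real (q t))"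
  shows "real_poly_exp (\<lambda>y. q (y $ i))"
proof -
  have "(\<lambda>y. g (y $ i)) \<in> poly_exp_algebra (\<lambda>y. y)" if "exp_polynomial g" for g
    using that
  proof (induction rule: exp_polynomial.induct)
    case (monomial c k l)
    have "(\<lambda>y. complex_of_real (y $ i) ^ k) \<in> poly_exp_algebra (\<lambda>y. y)"
      by (induction k) (auto intro: poly_exp_algebra_const poly_exp_algebra_mult[OF poly_exp_algebra_coord])
    then show ?case
      by (intro poly_exp_algebra_mult poly_exp_algebra_const poly_exp_algebra_exp)
  qed (rule poly_exp_algebra_add)
  from this[OF assms] show ?thesis by (simp add: real_poly_exp_def)
qed

lemma real_poly_exp_derivative:
  assumes "real_poly_exp f"
  shows "\<exists>D. (\<forall>y. (f has_derivative D y) (at y)) \<and> (\<forall>v. real_poly_exp (\<lambda>y. D y v))"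
proof -
  obtain D where D: "\<And>y. ((\<lambda>y. complex_of_real (f y)) has_derivative D y) (at y)"
    "\<And>v. (\<lambda>y. D y v) \<in> poly_exp_algebra (\<lambda>y. y)"
    using poly_exp_algebra_derivative[OF assms[unfolded real_poly_exp_def]] by blast
  have f: "(f has_derivative (\<lambda>v. Re (D y v))) (at y)" for y
    using bounded_linear.has_derivative[OF bounded_linear_Re D(1)] by simp
  \<comment> \<open>By uniqueness of derivatives \<open>D y v\<close> is real, so its real part lies
    in the algebra as well.\<close>
  have "D y v = complex_of_real (Re (D y v))" for y v
    using has_derivative_unique[OF D(1) bounded_linear.has_derivative[OF bounded_linear_of_real f]] by metis
  with D(2) have "real_poly_exp (\<lambda>y. Re (D y v))" for v by (simp add: real_poly_exp_def)
  with f show ?thesis by (intro exI[of _ "\<lambda>y v. Re (D y v)"]) blast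
qed

lemma real_poly_exp_Ck: "real_poly_exp f \<Longrightarrow> Ck_on k UNIV f"
proof (induction k arbitrary: f)
  case 0
  obtain D where "\<And>y. (f has_derivative D y) (at y)"
    using real_poly_exp_derivative[OF 0] by blast
  then have "continuous (at y) f" for y by (rule has_derivative_continuous)
  then show ?case by (simp add: continuous_at_imp_continuous_on)
next
  case (Suc k)
  obtain D where "\<And>y. (f has_derivative D y) (at y)" "\<And>v. real_poly_exp (\<lambda>y. D y v)"
    using real_poly_exp_derivative[OF Suc.prems] by blast
  then show ?case by (intro Ck_on_SucI[of UNIV f D k] Suc.IH) auto
qed

section \<open>Finite-dimensional Lie algebras and their inner automorphisms\<close>

text \<open>Coordinates and bracket are linear on the whole ambient type, which will be a function
  space, whereas the Lie algebra laws are confined to \<open>span B\<close>. Thus the library's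
  facts on \<open>linear\<close> maps apply without relative versions.\<close>

locale fin_dim_lie =
  fixes B :: "'a::real_vector set" and \<phi> :: "'a \<Rightarrow> 'a \<Rightarrow> real" and br :: "'a \<Rightarrow> 'a \<Rightarrow> 'a"
  assumes finite_basis: "finite B"
    and linear_coord: "linear (\<phi> b)"
    and expand: "V \<in> span B \<Longrightarrow> (\<Sum>b\<in>B. \<phi> b V *\<^sub>R b) = V"
    and linear_br_left: "linear (\<lambda>V. br V W)"
    and linear_br: "linear (br V)"
    and br_closed: "V \<in> span B \<Longrightarrow> W \<in> span B \<Longrightarrow> br V W \<in> span B"
    and br_self: "V \<in> span B \<Longrightarrow> br V V = 0"
    and jacobi: "X \<in> span B \<Longrightarrow> V \<in> span B \<Longrightarrow> W \<in> span B \<Longrightarrow>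
      br X (br V W) = br (br X V) W + br V (br X W)"
begin

lemma br_antisym:
  assumes "V \<in> span B" "W \<in> span B"
  shows "br W V = - br V W"
  using br_self[OF span_add[OF assms]] br_self[OF assms(1)] br_self[OF assms(2)]
  by (simp add: linear_add[OF linear_br_left] linear_add[OF linear_br] eq_neg_iff_add_eq_0 add.commute)

lemma linear_expand:
  assumes "linear f" "w \<in> span B"
  shows "f w = (\<Sum>b\<in>B. \<phi> b w *\<^sub>R f b)"
  using expand[OF assms(2)] linear_sum[OF assms(1), of "\<lambda>b. \<phi> b w *\<^sub>R b" B] linear_cmul[OF assms(1)]
  by simp

text \<open>The ambient space has no norm, so curves and surfaces in the algebra are differentiated
  through their finitely many coordinates.\<close>

definition coord_derivative :: "('c::real_normed_vector \<Rightarrow> 'a) \<Rightarrow> ('c \<Rightarrow> 'a) \<Rightarrow> 'c \<Rightarrow> bool" where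
  "coord_derivative w w' y \<longleftrightarrow> (\<forall>b\<in>B. ((\<lambda>x. \<phi> b (w x)) has_derivative (\<lambda>h. \<phi> b (w' h))) (at y))"

lemma coord_derivative_apply:
  fixes f :: "'a \<Rightarrow> 'e::real_normed_vector"
  assumes "coord_derivative w w' y" "\<And>x. w x \<in> span B" "\<And>h. w' h \<in> span B" "linear f"
  shows "((\<lambda>x. f (w x)) has_derivative (\<lambda>h. f (w' h))) (at y)"
proof -
  have "((\<lambda>x. \<Sum>b\<in>B. \<phi> b (w x) *\<^sub>R f b) has_derivative (\<lambda>h. \<Sum>b\<in>B. \<phi> b (w' h) *\<^sub>R f b)) (at y)"
    using assms(1) unfolding coord_derivative_def
    by (intro has_derivative_sum has_derivative_scaleR_left) blast
  then show ?thesis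
    using linear_expand[OF assms(4) assms(2)] linear_expand[OF assms(4) assms(3)] by simp
qed

lemma coord_derivative_const: "coord_derivative (\<lambda>x. W) (\<lambda>h. 0) y"
  by (simp add: coord_derivative_def linear_0[OF linear_coord])

lemma coord_derivative_br:
  assumes w: "coord_derivative w w' y" "\<And>x. w x \<in> span B" "\<And>h. w' h \<in> span B"
    and v: "coord_derivative v v' y" "\<And>x. v x \<in> span B" "\<And>h. v' h \<in> span B"
  shows "coord_derivative (\<lambda>x. br (w x) (v x)) (\<lambda>h. br (w' h) (v y) + br (w y) (v' h)) y"
  unfolding coord_derivative_def
proof
  fix b
  have eq: "\<phi> b (br W V) = (\<Sum>c\<in>B. \<phi> c W * \<phi> b (br c V))" if "W \<in> span B" for W V
    using linear_expand[OF linear_compose[OF linear_br_left[of V] linear_coord[of b], unfolded o_def] that]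
    by simp
  have "((\<lambda>x. \<Sum>c\<in>B. \<phi> c (w x) * \<phi> b (br c (v x))) has_derivative
      (\<lambda>h. \<Sum>c\<in>B. \<phi> c (w y) * \<phi> b (br c (v' h)) + \<phi> c (w' h) * \<phi> b (br c (v y)))) (at y)"
  proof (intro has_derivative_sum has_derivative_mult)
    fix c assume "c \<in> B"
    then show "((\<lambda>x. \<phi> c (w x)) has_derivative (\<lambda>h. \<phi> c (w' h))) (at y)"
      using w(1) by (simp add: coord_derivative_def)
    show "((\<lambda>x. \<phi> b (br c (v x))) has_derivative (\<lambda>h. \<phi> b (br c (v' h)))) (at y)"
      using coord_derivative_apply[OF v linear_compose[OF linear_br linear_coord, unfolded o_def]] .
  qed
  then show "((\<lambda>x. \<phi> b (br (w x) (v x))) has_derivative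
      (\<lambda>h. \<phi> b (br (w' h) (v y) + br (w y) (v' h)))) (at y)"
    by (simp add: eq w linear_add[OF linear_coord] sum.distrib add.commute)
qed

lemma coord_derivative_zero_const:
  assumes "\<And>y. coord_derivative w (\<lambda>h. 0) y" "\<And>y. w y \<in> span B"
  shows "w x = w y"
proof -
  have "\<phi> b (w x) = \<phi> b (w y)" if "b \<in> B" for b
    using has_derivative_zero_constant[of UNIV "\<lambda>x. \<phi> b (w x)"] assms(1) that linear_0[OF linear_coord]
    by (auto simp: coord_derivative_def)
  then show ?thesis using expand[OF assms(2)] by (metis (mono_tags, lifting) sum.cong)
qed

text \<open>Number of terms, Putzer coefficients and their derivatives for
  \<open>exp (t ad Y)\<close>. The last clause is the equation d/dt exp(t ad Y) = exp(t ad Y) ad Y,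
  applied to members of the algebra.\<close>

definition ad_exp_data :: "'a \<Rightarrow> nat \<times> (nat \<Rightarrow> real \<Rightarrow> real) \<times> (nat \<Rightarrow> real \<Rightarrow> real) \<Rightarrow> bool" where
  "ad_exp_data Y = (\<lambda>(d, q, q'). 0 < d \<and> (\<forall>j. exp_polynomial (\<lambda>t. of_real (q j t))) \<and>
    (\<forall>t. q 0 t = 1) \<and> (\<forall>j. q j 0 = (if j = 0 then 1 else 0)) \<and>
    (\<forall>j t. (q j has_real_derivative q' j t) (at t)) \<and>
    (\<forall>t. \<forall>W\<in>span B. (\<Sum>j<d. q' j t *\<^sub>R (br Y ^^ j) W) = (\<Sum>j<d. q j t *\<^sub>R (br Y ^^ Suc j) W)))"

definition ad_deg :: "'a \<Rightarrow> nat" where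
  "ad_deg Y = fst (SOME x. ad_exp_data Y x)"

definition ad_coef :: "'a \<Rightarrow> nat \<Rightarrow> real \<Rightarrow> real" where
  "ad_coef Y = fst (snd (SOME x. ad_exp_data Y x))"

definition ad_coef' :: "'a \<Rightarrow> nat \<Rightarrow> real \<Rightarrow> real" where
  "ad_coef' Y = snd (snd (SOME x. ad_exp_data Y x))"

text \<open>The exponential of \<open>t ad Y\<close> as a finite sum: subspaces stable under
  \<open>br Y\<close> are preserved for purely algebraic reasons, without any limit.\<close>

definition ad_exp :: "'a \<Rightarrow> real \<Rightarrow> 'a \<Rightarrow> 'a" where
  "ad_exp Y t W = (\<Sum>j<ad_deg Y. ad_coef Y j t *\<^sub>R (br Y ^^ j) W)"

lemma ad_exp_data_ad_deg:
  assumes "Y \<in> span B"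
  shows "ad_exp_data Y (ad_deg Y, ad_coef Y, ad_coef' Y)"
proof -
  obtain p :: "real poly" where p: "lead_coeff p = 1" "degree p > 0" "coeff p 0 = 0"
    "\<And>w. w \<in> span B \<Longrightarrow> (\<Sum>j\<le>degree p. coeff p j *\<^sub>R (br Y ^^ j) w) = 0"
    using linear_annihilating_polynomial[OF linear_br[of Y] finite_basis] br_closed[OF assms] by blast
  obtain q \<rho> where q: "\<And>j. exp_polynomial (\<lambda>t. of_real (q j t))"
    "\<And>t j. j \<ge> degree p \<Longrightarrow> q j t = 0" "\<And>j. q j 0 = (if j = 0 then 1 else 0)"
    "\<And>t j. (q j has_real_derivative ((if j = 0 then 0 else q (j - 1) t) - \<rho> t * coeff p j)) (at t)"
    using real_putzer[OF p(1,2)] by blast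
  \<comment> \<open>The constant coefficient of \<open>p\<close> is 0, so the equation for
    \<open>q 0\<close> has right-hand side 0.\<close>
  have q0: "q 0 t = 1" for t
    using DERIV_isconst_all[of "q 0" t 0] q(4)[of 0] q(3)[of 0] p(3) by simp
  \<comment> \<open>The index \<open>degree p\<close> is included although
    \<open>q (degree p)\<close> vanishes: only the complete sum over the coefficients of
    \<open>p\<close> is annihilated.\<close>
  have "(\<Sum>j<Suc (degree p). ((if j = 0 then 0 else q (j - 1) t) - \<rho> t * coeff p j) *\<^sub>R (br Y ^^ j) W)
      = (\<Sum>j<Suc (degree p). q j t *\<^sub>R (br Y ^^ Suc j) W)" if W: "W \<in> span B" for t W
  proof -
    have "(\<Sum>j\<le>degree p. (\<rho> t * coeff p j) *\<^sub>R (br Y ^^ j) W) = \<rho> t *\<^sub>R (\<Sum>j\<le>degree p. coeff p j *\<^sub>R (br Y ^^ j) W)"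
      by (simp add: scaleR_sum_right)
    then have "(\<Sum>j\<le>degree p. ((if j = 0 then 0 else q (j - 1) t) - \<rho> t * coeff p j) *\<^sub>R (br Y ^^ j) W)
        = (\<Sum>j\<le>degree p. (if j = 0 then 0 else q (j - 1) t) *\<^sub>R (br Y ^^ j) W)"
      using p(4)[OF W] by (simp add: scaleR_diff_left sum_subtractf)
    also have "\<dots> = (\<Sum>j<degree p. q j t *\<^sub>R (br Y ^^ Suc j) W)"
      by (simp add: sum.atMost_shift)
    also have "\<dots> = (\<Sum>j<Suc (degree p). q j t *\<^sub>R (br Y ^^ Suc j) W)"
      by (simp only: sum.lessThan_Suc q(2)[OF order_refl] scaleR_zero_left add_0_right)
    finally show ?thesis unfolding lessThan_Suc_atMost[of "degree p", symmetric] .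
  qed
  with q q0 have "ad_exp_data Y (Suc (degree p), q, \<lambda>j t. (if j = 0 then 0 else q (j - 1) t) - \<rho> t * coeff p j)"
    unfolding ad_exp_data_def prod.case by blast
  then have "ad_exp_data Y (SOME x. ad_exp_data Y x)" by (rule someI[of "ad_exp_data Y"])
  then show ?thesis by (simp add: ad_deg_def ad_coef_def ad_coef'_def)
qed

lemma ad_coef:
  assumes "Y \<in> span B"
  shows "0 < ad_deg Y" "exp_polynomial (\<lambda>t. of_real (ad_coef Y j t))" "ad_coef Y 0 t = 1"
    "ad_coef Y j 0 = (if j = 0 then 1 else 0)" "(ad_coef Y j has_real_derivative ad_coef' Y j t) (at t)"
    "W \<in> span B \<Longrightarrow> (\<Sum>j<ad_deg Y. ad_coef' Y j t *\<^sub>R (br Y ^^ j) W) = ad_exp Y t (br Y W)"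
  using ad_exp_data_ad_deg[OF assms] unfolding ad_exp_data_def prod.case ad_exp_def
  by (simp_all only: funpow_Suc_right o_apply)

lemma linear_funpow_br: "linear (br Y ^^ j)"
proof (induction j)
  case (Suc j)
  from linear_compose[OF this linear_br] show ?case by (simp only: funpow.simps)
qed (simp add: linear_iff)

lemma linear_ad_exp: "linear (ad_exp Y t)"
  unfolding ad_exp_def
  by (intro linear_compose_sum ballI linear_compose_scale_right linear_funpow_br)

lemma funpow_br_mem: "(\<And>V. V \<in> S \<Longrightarrow> br Y V \<in> S) \<Longrightarrow> W \<in> S \<Longrightarrow> (br Y ^^ j) W \<in> S"
  by (induction j) auto

lemma ad_exp_mem:
  assumes "Y \<in> span B" "subspace S" "\<And>V. V \<in> S \<Longrightarrow> br Y V \<in> S" "W \<in> S"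
  shows "ad_exp Y t W \<in> S"
  unfolding ad_exp_def
  by (intro subspace_sum[OF assms(2)] subspace_scale[OF assms(2)] funpow_br_mem assms(3,4))

lemma ad_exp_closed: "Y \<in> span B \<Longrightarrow> W \<in> span B \<Longrightarrow> ad_exp Y t W \<in> span B"
  by (rule ad_exp_mem[OF _ subspace_span br_closed])

text \<open>The coefficient of the zeroth power is constantly 1 and cancels against
  \<open>W\<close>; every other term contains \<open>br Y W\<close>.\<close>

lemma ad_exp_diff_mem:
  assumes "Y \<in> span B" "subspace S" "\<And>V. V \<in> S \<Longrightarrow> br Y V \<in> S" "br Y W \<in> S"
  shows "ad_exp Y t W - W \<in> S"
proof -
  obtain d where d: "ad_deg Y = Suc d" using ad_coef(1)[OF assms(1)] gr0_implies_Suc by blast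
  have "ad_exp Y t W - W = (\<Sum>j<d. ad_coef Y (Suc j) t *\<^sub>R (br Y ^^ j) (br Y W))"
    unfolding ad_exp_def d
    by (simp only: sum.lessThan_Suc_shift) (simp add: ad_coef(3)[OF assms(1)] funpow_swap1)
  also have "\<dots> \<in> S"
    by (intro subspace_sum[OF assms(2)] subspace_scale[OF assms(2)] funpow_br_mem assms(3,4))
  finally show ?thesis .
qed

lemma ad_exp_self: "Y \<in> span B \<Longrightarrow> ad_exp Y t Y = Y"
  using ad_exp_diff_mem[of Y "{0}" Y t] br_self[of Y] by (simp add: linear_0[OF linear_br] subspace_0)

lemma ad_exp_0:
  assumes "Y \<in> span B"
  shows "ad_exp Y 0 W = W"
proof -
  have "ad_exp Y 0 W = (\<Sum>j<ad_deg Y. if j = 0 then W else 0)"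
    unfolding ad_exp_def by (rule sum.cong) (auto simp: ad_coef(4)[OF assms])
  then show ?thesis using ad_coef(1)[OF assms] by simp
qed

lemma ad_exp_commute: "ad_exp Y t (br Y W) = br Y (ad_exp Y t W)"
  unfolding ad_exp_def by (simp add: linear_sum[OF linear_br] linear_cmul[OF linear_br] funpow_swap1)

lemma coord_derivative_ad_exp:
  assumes Y: "Y \<in> span B" and f: "(f has_derivative f') (at y)"
    and w: "coord_derivative w w' y" "\<And>x. w x \<in> span B" "\<And>h. w' h \<in> span B"
  shows "coord_derivative (\<lambda>x. ad_exp Y (f x) (w x))
    (\<lambda>h. ad_exp Y (f y) (f' h *\<^sub>R br Y (w y) + w' h)) y"
  unfolding coord_derivative_def
proof
  fix b
  have "((\<lambda>x. \<Sum>j<ad_deg Y. ad_coef Y j (f x) * \<phi> b ((br Y ^^ j) (w x))) has_derivative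
     (\<lambda>h. \<Sum>j<ad_deg Y. ad_coef Y j (f y) * \<phi> b ((br Y ^^ j) (w' h)) + (f' h * ad_coef' Y j (f y)) * \<phi> b ((br Y ^^ j) (w y)))) (at y)"
  proof (intro has_derivative_sum has_derivative_mult)
    fix j
    show "((\<lambda>x. ad_coef Y j (f x)) has_derivative (\<lambda>h. f' h * ad_coef' Y j (f y))) (at y)"
      using has_derivative_compose[OF f ad_coef(5)[OF Y, of j "f y", unfolded has_field_derivative_def]]
      by (simp add: mult.commute)
    show "((\<lambda>x. \<phi> b ((br Y ^^ j) (w x))) has_derivative (\<lambda>h. \<phi> b ((br Y ^^ j) (w' h)))) (at y)"
      using coord_derivative_apply[OF w linear_compose[OF linear_funpow_br linear_coord, unfolded o_def]] .
  qed
  moreover have "(\<Sum>j<ad_deg Y. ad_coef Y j (f y) * \<phi> b ((br Y ^^ j) (w' h)) + (f' h * ad_coef' Y j (f y)) * \<phi> b ((br Y ^^ j) (w y)))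
      = \<phi> b (ad_exp Y (f y) (f' h *\<^sub>R br Y (w y) + w' h))" for h
  proof -
    have "(\<Sum>j<ad_deg Y. (f' h * ad_coef' Y j (f y)) * \<phi> b ((br Y ^^ j) (w y)))
        = f' h * \<phi> b (\<Sum>j<ad_deg Y. ad_coef' Y j (f y) *\<^sub>R (br Y ^^ j) (w y))"
      by (simp add: linear_sum[OF linear_coord] linear_cmul[OF linear_coord] sum_distrib_left mult.assoc)
    also have "\<dots> = \<phi> b (ad_exp Y (f y) (f' h *\<^sub>R br Y (w y)))"
      unfolding ad_coef(6)[OF Y w(2)] linear_cmul[OF linear_ad_exp] linear_cmul[OF linear_coord]
      by simp
    finally have 1: "(\<Sum>j<ad_deg Y. (f' h * ad_coef' Y j (f y)) * \<phi> b ((br Y ^^ j) (w y))) = \<phi> b (ad_exp Y (f y) (f' h *\<^sub>R br Y (w y)))" .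
    have 2: "(\<Sum>j<ad_deg Y. ad_coef Y j (f y) * \<phi> b ((br Y ^^ j) (w' h))) = \<phi> b (ad_exp Y (f y) (w' h))"
      unfolding ad_exp_def by (simp add: linear_sum[OF linear_coord] linear_cmul[OF linear_coord])
    show ?thesis
      unfolding sum.distrib 1 2 linear_add[OF linear_ad_exp] linear_add[OF linear_coord]
      by (rule add.commute)
  qed
  moreover have "(\<Sum>j<ad_deg Y. ad_coef Y j (f x) * \<phi> b ((br Y ^^ j) (w x))) = \<phi> b (ad_exp Y (f x) (w x))" for x
    unfolding ad_exp_def by (simp add: linear_sum[OF linear_coord] linear_cmul[OF linear_coord])
  ultimately show "((\<lambda>x. \<phi> b (ad_exp Y (f x) (w x))) has_derivative
      (\<lambda>h. \<phi> b (ad_exp Y (f y) (f' h *\<^sub>R br Y (w y) + w' h)))) (at y)" by (simp only:)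
qed

text \<open>Uniqueness for the linear equation w' = ad(Y) w: the product rule gives the left-hand
  side derivative 0. It replaces the addition theorem of the exponential.\<close>

lemma ad_exp_neg_curve:
  assumes Y: "Y \<in> span B" and w: "\<And>t. w t \<in> span B"
    and der: "\<And>t. coord_derivative w (\<lambda>h. h *\<^sub>R br Y (w t)) t"
  shows "ad_exp Y (- t) (w t) = w 0"
proof -
  have "coord_derivative (\<lambda>t. ad_exp Y (- t) (w t)) (\<lambda>h. 0) s" for s
  proof -
    have "coord_derivative (\<lambda>t. ad_exp Y (- t) (w t))
       (\<lambda>h. ad_exp Y (- s) (- h *\<^sub>R br Y (w s) + h *\<^sub>R br Y (w s))) s"
      by (rule coord_derivative_ad_exp[OF Y _ der w])
         (auto intro!: has_derivative_minus has_derivative_ident span_scale br_closed Y w)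
    then show ?thesis by (simp add: linear_0[OF linear_ad_exp])
  qed
  from coord_derivative_zero_const[OF this ad_exp_closed[OF Y w], of t 0]
  show ?thesis by (simp add: ad_exp_0[OF Y])
qed

lemma coord_derivative_ad_exp_const:
  assumes "Y \<in> span B" "W \<in> span B"
  shows "coord_derivative (\<lambda>t. ad_exp Y t W) (\<lambda>h. h *\<^sub>R br Y (ad_exp Y t W)) t"
  using coord_derivative_ad_exp[OF assms(1) has_derivative_ident coord_derivative_const, of W t] assms
  by (simp add: linear_cmul[OF linear_ad_exp] ad_exp_commute span_zero)

lemma ad_exp_inverse':
  assumes "Y \<in> span B" "W \<in> span B"
  shows "ad_exp Y (- t) (ad_exp Y t W) = W"
  using ad_exp_neg_curve[OF assms(1) ad_exp_closed[OF assms] coord_derivative_ad_exp_const[OF assms]]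
  by (simp add: ad_exp_0 assms)

lemma ad_exp_inverse:
  assumes "Y \<in> span B" "W \<in> span B"
  shows "ad_exp Y t (ad_exp Y (- t) W) = W"
  using ad_exp_inverse'[OF assms, of "- t"] by simp

text \<open>By the Jacobi identity the right-hand side, as a function of \<open>t\<close>, solves w'
  = ad(Y) w with initial value \<open>br V W\<close>, and \<open>ad_exp_neg_curve\<close> identifies
  it.\<close>

lemma ad_exp_br:
  assumes Y: "Y \<in> span B" and V: "V \<in> span B" and W: "W \<in> span B"
  shows "ad_exp Y t (br V W) = br (ad_exp Y t V) (ad_exp Y t W)"
proof -
  let ?w = "\<lambda>t. br (ad_exp Y t V) (ad_exp Y t W)"
  note cl = ad_exp_closed[OF Y]
  have der: "coord_derivative ?w (\<lambda>h. h *\<^sub>R br Y (?w t)) t" for t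
  proof -
    have "coord_derivative ?w (\<lambda>h. br (h *\<^sub>R br Y (ad_exp Y t V)) (ad_exp Y t W) +
        br (ad_exp Y t V) (h *\<^sub>R br Y (ad_exp Y t W))) t"
      by (intro coord_derivative_br coord_derivative_ad_exp_const span_scale br_closed cl Y V W)
    moreover have "br (h *\<^sub>R br Y (ad_exp Y t V)) (ad_exp Y t W) + br (ad_exp Y t V) (h *\<^sub>R br Y (ad_exp Y t W))
        = h *\<^sub>R br Y (?w t)" for h
      by (simp add: jacobi[OF Y cl[OF V] cl[OF W]] linear_cmul[OF linear_br] linear_cmul[OF linear_br_left]
          scaleR_add_right)
    ultimately show ?thesis by simp
  qed
  have "ad_exp Y (- t) (?w t) = br V W"
    using ad_exp_neg_curve[OF Y _ der, of t] br_closed cl V W by (simp add: ad_exp_0[OF Y])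
  then have "ad_exp Y t (ad_exp Y (- t) (?w t)) = ad_exp Y t (br V W)" by simp
  then show ?thesis using ad_exp_inverse[OF Y br_closed[OF cl[OF V] cl[OF W]]] by simp
qed

definition coords_poly_exp :: "(real^'n \<Rightarrow> 'a) \<Rightarrow> bool" where
  "coords_poly_exp w \<longleftrightarrow> (\<forall>b\<in>B. real_poly_exp (\<lambda>y. \<phi> b (w y)))"

lemma coords_poly_exp_apply:
  assumes "coords_poly_exp w" "\<And>y. w y \<in> span B" "linear f"
  shows "real_poly_exp (\<lambda>y. f (w y))"
proof -
  have "real_poly_exp (\<lambda>y. \<Sum>b\<in>B. \<phi> b (w y) * f b)"
    using assms(1) unfolding coords_poly_exp_def
    by (intro real_poly_exp_sum real_poly_exp_mult real_poly_exp_const) blast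
  then show ?thesis using linear_expand[OF assms(3,2)] by simp
qed

lemma coords_poly_exp_const: "coords_poly_exp (\<lambda>y. W)"
  by (simp add: coords_poly_exp_def real_poly_exp_const)

lemma coords_poly_exp_ad_exp:
  assumes Y: "Y \<in> span B" and w: "coords_poly_exp w" "\<And>y. w y \<in> span B"
  shows "coords_poly_exp (\<lambda>y. ad_exp Y (y $ i) (w y))" "coords_poly_exp (\<lambda>y. ad_exp Y (- (y $ i)) (w y))"
proof -
  have *: "coords_poly_exp (\<lambda>y. ad_exp Y (f y) (w y))" if "\<And>j. real_poly_exp (\<lambda>y. ad_coef Y j (f y))" for f
    unfolding coords_poly_exp_def
  proof
    fix b
    have "real_poly_exp (\<lambda>y. \<Sum>j<ad_deg Y. ad_coef Y j (f y) * \<phi> b ((br Y ^^ j) (w y)))"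
      by (intro real_poly_exp_sum real_poly_exp_mult that
          coords_poly_exp_apply[OF w linear_compose[OF linear_funpow_br linear_coord, unfolded o_def]])
    then show "real_poly_exp (\<lambda>y. \<phi> b (ad_exp Y (f y) (w y)))"
      unfolding ad_exp_def by (simp add: linear_sum[OF linear_coord] linear_cmul[OF linear_coord])
  qed
  show "coords_poly_exp (\<lambda>y. ad_exp Y (y $ i) (w y))"
    by (intro * real_poly_exp_coord ad_coef(2)[OF Y])
  show "coords_poly_exp (\<lambda>y. ad_exp Y (- (y $ i)) (w y))"
    by (rule *, rule real_poly_exp_coord[where q = "\<lambda>t. ad_coef Y j (- t)" for j], rule exp_polynomial_reflect, rule ad_coef(2)[OF Y])
qed

end

section \<open>Frames adapted to the derived series\<close>

text \<open>The list order is total on its members; this will decide which of two mixed derivatives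
  of the frame carries the bracket.\<close>

lemma takeWhile_neq_total:
  "k \<noteq> i \<Longrightarrow> k \<in> set js \<Longrightarrow> i \<in> set js \<Longrightarrow>
    k \<in> set (takeWhile ((\<noteq>) i) js) \<longleftrightarrow> i \<notin> set (takeWhile ((\<noteq>) k) js)"
  by (induction js) auto

context fin_dim_lie
begin

context
  fixes Y :: "'n::finite \<Rightarrow> 'a"
begin

primrec ad_prod :: "'n list \<Rightarrow> real^'n \<Rightarrow> 'a \<Rightarrow> 'a" where
  "ad_prod [] y W = W"
| "ad_prod (j # js) y W = ad_exp (Y j) (y $ j) (ad_prod js y W)"

primrec ad_prod_inv :: "'n list \<Rightarrow> real^'n \<Rightarrow> 'a \<Rightarrow> 'a" where
  "ad_prod_inv [] y W = W"
| "ad_prod_inv (j # js) y W = ad_prod_inv js y (ad_exp (Y j) (- (y $ j)) W)"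

text \<open>The order of the factors is a parameter, so that a frame can be split along an appended
  list. An index outside the list gets the product over the entire list.\<close>

definition frame :: "'n list \<Rightarrow> real^'n \<Rightarrow> 'n \<Rightarrow> 'a" where
  "frame js y i = ad_prod (takeWhile ((\<noteq>) i) js) y (Y i)"

lemma ad_prod_append: "ad_prod (as @ bs) y W = ad_prod as y (ad_prod bs y W)"
  by (induction as) auto

lemma linear_ad_prod: "linear (ad_prod js y)"
proof (induction js)
  case (Cons j js)
  from linear_compose[OF this linear_ad_exp] show ?case by (simp add: o_def)
qed (simp add: linear_iff)

lemma linear_ad_prod_inv: "linear (ad_prod_inv js y)"
proof (induction js)
  case (Cons j js)
  from linear_compose[OF linear_ad_exp this] show ?case by (simp add: o_def)
qed (simp add: linear_iff)

lemma frame_Cons_self: "frame (j # js) y j = Y j"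
  by (simp add: frame_def)

lemma frame_Cons: "k \<noteq> j \<Longrightarrow> frame (j # js) y k = ad_exp (Y j) (y $ j) (frame js y k)"
  by (simp add: frame_def)

lemma frame_append1: "i \<in> set as \<Longrightarrow> frame (as @ bs) y i = frame as y i"
  by (simp add: frame_def)

lemma frame_append2: "i \<notin> set as \<Longrightarrow> frame (as @ bs) y i = ad_prod as y (frame bs y i)"
  by (induction as) (auto simp: frame_def)

context
  assumes Y_mem: "Y j \<in> span B"
begin

lemma ad_prod_mem:
  assumes "subspace S" "\<And>j V. j \<in> set js \<Longrightarrow> V \<in> S \<Longrightarrow> br (Y j) V \<in> S" "W \<in> S"
  shows "ad_prod js y W \<in> S" "ad_prod_inv js y W \<in> S"
proof -
  show "ad_prod js y W \<in> S"
    using assms(2) by (induction js) (auto intro!: ad_exp_mem Y_mem assms(1,3))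
  show "ad_prod_inv js y W \<in> S"
    using assms(2,3) by (induction js arbitrary: W) (auto intro!: ad_exp_mem Y_mem assms(1))
qed

text \<open>Each factor moves \<open>W\<close> only within \<open>S\<close> and maps
  \<open>S\<close> into itself, so the deviations of the single factors add up inside
  \<open>S\<close>.\<close>

lemma ad_prod_diff_mem:
  assumes "subspace S" "\<And>j V. j \<in> set js \<Longrightarrow> V \<in> S \<Longrightarrow> br (Y j) V \<in> S"
    "\<And>j. j \<in> set js \<Longrightarrow> br (Y j) W \<in> S"
  shows "ad_prod js y W - W \<in> S" "ad_prod_inv js y W - W \<in> S"
proof -
  show "ad_prod js y W - W \<in> S"
    using assms(2,3)
  proof (induction js)
    case (Cons j js)
    let ?E = "ad_exp (Y j) (y $ j)"
    have "?E (ad_prod js y W - W) + (?E W - W) \<in> S"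
      using Cons by (intro subspace_add[OF assms(1)] ad_exp_mem ad_exp_diff_mem Y_mem assms(1)) auto
    then show ?case by (simp add: linear_diff[OF linear_ad_exp])
  qed (simp add: subspace_0 assms(1))
  show "ad_prod_inv js y W - W \<in> S"
    using assms(2,3)
  proof (induction js)
    case (Cons j js)
    let ?E = "ad_exp (Y j) (- (y $ j))"
    have "ad_prod_inv js y (?E W - W) + (ad_prod_inv js y W - W) \<in> S"
      using Cons by (intro subspace_add[OF assms(1)] ad_prod_mem ad_exp_diff_mem Y_mem assms(1)) auto
    then show ?case by (simp add: linear_diff[OF linear_ad_prod_inv])
  qed (simp add: subspace_0 assms(1))
qed

lemma ad_prod_closed: "W \<in> span B \<Longrightarrow> ad_prod js y W \<in> span B"
  by (intro ad_prod_mem subspace_span br_closed Y_mem)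

lemma ad_prod_inv_closed: "W \<in> span B \<Longrightarrow> ad_prod_inv js y W \<in> span B"
  by (intro ad_prod_mem subspace_span br_closed Y_mem)

lemma frame_mem: "frame js y i \<in> span B"
  unfolding frame_def by (intro ad_prod_closed Y_mem)

lemma ad_prod_inverse: "W \<in> span B \<Longrightarrow> ad_prod js y (ad_prod_inv js y W) = W"
  by (induction js arbitrary: W) (auto simp: ad_exp_inverse ad_exp_closed Y_mem)

lemma ad_prod_0: "ad_prod js 0 W = W"
  by (induction js) (auto simp: ad_exp_0 Y_mem)

text \<open>For the product g(y) of the exponentials, the frame vectors are the components of
  \<open>dg g\<^sup>-\<^sup>1\<close>, and the adjoint action is differentiated by bracketing with
  them. In the induction the outer exponential is an automorphism that fixes its own
  generator.\<close>

lemma coord_derivative_ad_prod: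
  assumes "distinct js" "W \<in> span B"
  shows "coord_derivative (\<lambda>y. ad_prod js y W)
    (\<lambda>h. \<Sum>k\<in>set js. h $ k *\<^sub>R br (frame js y k) (ad_prod js y W)) y"
  using assms(1)
proof (induction js)
  case Nil
  then show ?case by (simp add: coord_derivative_const)
next
  case (Cons j js)
  let ?w = "\<lambda>y. ad_prod js y W"
  let ?w' = "\<lambda>h. \<Sum>k\<in>set js. h $ k *\<^sub>R br (frame js y k) (?w y)"
  let ?E = "ad_exp (Y j) (y $ j)"
  have cl: "?w y \<in> span B" for y by (rule ad_prod_closed[OF assms(2)])
  have "coord_derivative (\<lambda>y. ad_exp (Y j) (y $ j) (?w y))
      (\<lambda>h. ?E (h $ j *\<^sub>R br (Y j) (?w y) + ?w' h)) y"
    using Cons cl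
    by (intro coord_derivative_ad_exp Y_mem bounded_linear_imp_has_derivative bounded_linear_vec_nth
        span_sum span_scale br_closed frame_mem) auto
  moreover have "?E (h $ j *\<^sub>R br (Y j) (?w y) + ?w' h) =
      (\<Sum>k\<in>set (j # js). h $ k *\<^sub>R br (frame (j # js) y k) (ad_prod (j # js) y W))" for h
  proof -
    have "?E (br (frame js y k) (?w y)) = br (frame (j # js) y k) (ad_prod (j # js) y W)" if "k \<in> set js" for k
    proof -
      have "k \<noteq> j" using that Cons.prems by auto
      then show ?thesis by (simp add: frame_Cons ad_exp_br[OF Y_mem frame_mem cl])
    qed
    moreover have "?E (br (Y j) (?w y)) = br (frame (j # js) y j) (ad_prod (j # js) y W)"
      using ad_exp_br[OF Y_mem Y_mem cl] by (simp add: frame_Cons_self ad_exp_self[OF Y_mem])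
    ultimately show ?thesis
      using Cons.prems by (simp add: linear_add[OF linear_ad_exp] linear_sum[OF linear_ad_exp] linear_cmul[OF linear_ad_exp])
  qed
  ultimately show ?case by simp
qed

text \<open>Only the coordinates listed before \<open>i\<close> occur in the product defining
  \<open>frame js y i\<close>. This one-sided dependence is the structure equation behind
  integrability.\<close>

lemma coord_derivative_frame:
  assumes "distinct js"
  shows "coord_derivative (\<lambda>y. frame js y i)
    (\<lambda>h. \<Sum>k\<in>set (takeWhile ((\<noteq>) i) js). h $ k *\<^sub>R br (frame js y k) (frame js y i)) y"
proof -
  have "frame (takeWhile ((\<noteq>) i) js) y k = frame js y k" if "k \<in> set (takeWhile ((\<noteq>) i) js)" for k
    using frame_append1[OF that, of "dropWhile ((\<noteq>) i) js" y] by simp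
  with coord_derivative_ad_prod[OF distinct_takeWhile[OF assms] Y_mem, of "(\<noteq>) i" i y]
  show ?thesis by (simp add: frame_def[of js _ i, symmetric])
qed

lemma coords_poly_exp_ad_prod:
  assumes "coords_poly_exp w" "\<And>y. w y \<in> span B"
  shows "coords_poly_exp (\<lambda>y. ad_prod js y (w y))"
  by (induction js) (auto intro!: coords_poly_exp_ad_exp Y_mem ad_prod_closed assms)

lemma coords_poly_exp_ad_prod_inv:
  assumes "coords_poly_exp w" "\<And>y. w y \<in> span B"
  shows "coords_poly_exp (\<lambda>y. ad_prod_inv js y (w y))"
  using assms by (induction js arbitrary: w) (auto intro!: coords_poly_exp_ad_exp Y_mem ad_exp_closed)

lemma coords_poly_exp_frame: "coords_poly_exp (\<lambda>y. frame js y i)"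
  unfolding frame_def by (intro coords_poly_exp_ad_prod coords_poly_exp_const Y_mem)

end

end

end

text \<open>Serves to write a vector moving inside \<open>S\<close> as a combination of fixed
  vectors of \<open>S\<close>, with its coordinates in the ambient basis as coefficients.\<close>

lemma subspace_projection:
  fixes S :: "'a::real_vector set"
  assumes "subspace S"
  obtains P where "linear P" "\<And>v. P v \<in> S" "\<And>v. v \<in> S \<Longrightarrow> P v = v"
proof -
  obtain C where C: "C \<subseteq> S" "independent C" "S \<subseteq> span C" by (rule maximal_independent_subset)
  have SC: "span C = S" using C(1,3) assms by (simp add: span_minimal subset_antisym)
  from linear_independent_extend_subspace[OF C(2), of id]
  obtain P where P: "linear P \<and> (\<forall>x\<in>C. P x = id x) \<and> range P = span (id ` C)" ..
  show thesis
  proof (rule that)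
    show lin: "linear P" using P by blast
    show "P v \<in> S" for v
    proof -
      have "P v \<in> range P" by (rule rangeI)
      also have "range P = S" using P SC by (simp only: image_id id_apply)
      finally show ?thesis .
    qed
    show "P v = v" if "v \<in> S" for v
    proof -
      have "P v = id v"
        by (rule linear_eq_on_span[OF lin linear_id, of C]) (use P SC that in blast)+
      then show ?thesis by simp
    qed
  qed
qed

text \<open>A frame \<open>Y\<close> adapted to a chain \<open>g\<close> of ideals with abelian quotients: \<open>Y j\<close> is taken from
  \<open>g (lev j)\<close> and \<open>\<theta>\<close> is the coframe, whose common kernel will be the isotropy algebra at \<open>0\<close>.\<close>

locale adapted_frame = fin_dim_lie +
  fixes Y :: "'n::finite \<Rightarrow> 'a" and \<theta> :: "'n \<Rightarrow> 'a \<Rightarrow> real" and lev :: "'n \<Rightarrow> nat"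
    and g :: "nat \<Rightarrow> 'a set" and r :: nat
  assumes linear_coframe: "linear (\<theta> j)"
    and coframe: "\<theta> i (Y j) = (if i = j then 1 else 0)"
    and subspace_g: "subspace (g k)" and g_subset: "g k \<subseteq> span B"
    and ideal: "V \<in> span B \<Longrightarrow> W \<in> g k \<Longrightarrow> br V W \<in> g k"
    and abelian: "V \<in> g k \<Longrightarrow> W \<in> g k \<Longrightarrow> br V W \<in> g (Suc k)"
    and Y_g: "Y j \<in> g (lev j)"
    and coframe_g: "V \<in> g k \<Longrightarrow> lev j < k \<Longrightarrow> \<theta> j V = 0"
    and lev_less: "lev j < r"
begin

lemma Y_span: "Y j \<in> span B"
  using Y_g g_subset by blast

definition block :: "nat \<Rightarrow> 'n list" where
  "block i = (SOME js. set js = {j. lev j = i} \<and> distinct js)"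

lemma block: "set (block i) = {j. lev j = i}" "distinct (block i)"
  using someI_ex[OF finite_distinct_list[of "{j. lev j = i}"]] by (simp_all add: block_def)

definition blocks_from :: "nat \<Rightarrow> 'n list" where
  "blocks_from i = concat (map block [i..<r])"

lemma blocks_from_step: "i < r \<Longrightarrow> blocks_from i = block i @ blocks_from (Suc i)"
  by (simp add: blocks_from_def upt_conv_Cons)

lemma set_blocks_from: "set (blocks_from i) = {j. i \<le> lev j}"
  using block(1) lev_less by (auto simp: blocks_from_def)

lemma distinct_blocks_from: "distinct (blocks_from i)"
proof (cases "i \<le> r")
  case True
  then show ?thesis
  proof (induction rule: inc_induct)
    case (step i)
    then show ?case
      unfolding blocks_from_step[OF step.hyps(2)] by (simp add: block set_blocks_from disjoint_iff)
  qed (simp add: blocks_from_def)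
qed (simp add: blocks_from_def)

text \<open>Peeling off the first block \<open>T\<close>: modulo \<open>g (i + 1)\<close> the block commutes, so the coefficients
  of \<open>X\<close> along it are the values of the coframe on \<open>T\<^sup>-\<^sup>1 X\<close>.\<close>

lemma peel_block:
  fixes X :: 'a
  assumes X: "X \<in> span B" "\<And>j. lev j < i \<Longrightarrow> \<theta> j X = 0"
  defines "c \<equiv> \<lambda>y j. \<theta> j (ad_prod_inv Y (block i) y X)"
  shows "lev k < Suc i \<Longrightarrow>
    \<theta> k (ad_prod_inv Y (block i) y (X - (\<Sum>j\<in>set (block i). c y j *\<^sub>R frame Y (block i) y j))) = 0"
proof -
  assume k: "lev k < Suc i"
  let ?T = "ad_prod_inv Y (block i) y"
  let ?S = "{V \<in> span B. \<forall>j. lev j < i \<longrightarrow> \<theta> j V = 0}"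
  have S: "subspace ?S"
    using linear_0[OF linear_coframe] linear_add[OF linear_coframe] linear_cmul[OF linear_coframe]
    by (auto simp: subspace_def span_zero intro: span_add span_scale)
  \<comment> \<open>\<open>g i\<close> is an ideal containing the block, and coframe members of
    level below \<open>i\<close> vanish on it. Transport by the block thus creates no components at
    the levels already cleared.\<close>
  have brY: "br (Y j) V \<in> g i" if "j \<in> set (block i)" "V \<in> span B" for j V
  proof -
    have "br V (Y j) \<in> g i" using that Y_g[of j] block(1) by (intro ideal) auto
    then show ?thesis
      using br_antisym[OF that(2) Y_span, of j] subspace_neg[OF subspace_g] by simp
  qed
  have XS: "?T X \<in> ?S"
  proof (rule ad_prod_mem(2)[OF Y_span S])
    show "br (Y j) V \<in> ?S" if "j \<in> set (block i)" "V \<in> ?S" for j V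
      using brY[of j V] that coframe_g br_closed[OF Y_span] by auto
  qed (use X in auto)
  have frame: "?T (frame Y (block i) y j) - Y j \<in> g (Suc i)" if j: "j \<in> set (block i)" for j
  proof -
    have br1: "br (Y a) V \<in> g (Suc i)" if "a \<in> set (block i)" "V \<in> g (Suc i)" for a V
      using ideal[OF Y_span that(2)] .
    have br2: "br (Y a) (Y j) \<in> g (Suc i)" if "a \<in> set (block i)" for a
      using abelian[of "Y a" i "Y j"] Y_g[of a] Y_g[of j] that j block(1) by auto
    have fr: "frame Y (block i) y j - Y j \<in> g (Suc i)"
      unfolding frame_def
      by (rule ad_prod_diff_mem(1)[OF Y_span subspace_g]) (use br1 br2 in \<open>auto dest: set_takeWhileD\<close>)
    have "?T (frame Y (block i) y j - Y j) \<in> g (Suc i)"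
      by (rule ad_prod_mem(2)[OF Y_span subspace_g br1 fr])
    moreover have "?T (Y j) - Y j \<in> g (Suc i)"
      by (rule ad_prod_diff_mem(2)[OF Y_span subspace_g br1 br2])
    ultimately have "?T (frame Y (block i) y j - Y j) + (?T (Y j) - Y j) \<in> g (Suc i)"
      by (rule subspace_add[OF subspace_g])
    then show ?thesis by (simp add: linear_diff[OF linear_ad_prod_inv])
  qed
  \<comment> \<open>The matrix of this elimination step is the identity, which is why no division
    occurs.\<close>
  have \<theta>_frame: "\<theta> k (?T (frame Y (block i) y j)) = (if k = j then 1 else 0)" if "j \<in> set (block i)" for j
    using coframe_g[OF frame[OF that] k] by (simp add: linear_diff[OF linear_coframe] coframe)
  have "\<theta> k (?T (X - (\<Sum>j\<in>set (block i). c y j *\<^sub>R frame Y (block i) y j)))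
      = \<theta> k (?T X) - (\<Sum>j\<in>set (block i). c y j * \<theta> k (?T (frame Y (block i) y j)))"
    by (simp only: linear_diff[OF linear_ad_prod_inv] linear_sum[OF linear_ad_prod_inv]
        linear_cmul[OF linear_ad_prod_inv] linear_diff[OF linear_coframe] linear_sum[OF linear_coframe]
        linear_cmul[OF linear_coframe] real_scaleR_def)
  also have "(\<Sum>j\<in>set (block i). c y j * \<theta> k (?T (frame Y (block i) y j)))
      = (\<Sum>j\<in>set (block i). if k = j then c y j else 0)"
    by (rule sum.cong) (simp_all add: \<theta>_frame)
  also have "\<dots> = (if lev k = i then c y k else 0)" by (simp add: block(1))
  also have "\<theta> k (?T X) - \<dots> = 0" using XS k by (simp add: c_def)
  finally show ?thesis .
qed

text \<open>Peeling a block and undoing its automorphism leaves a rest without components up to that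
  level, ready for the next block. After the last block the rest lies in the kernel of the coframe
  and provides \<open>W\<close>. Only linear forms, sums and products enter the
  coefficients.\<close>

lemma poly_exp_coefficients:
  assumes "i \<le> r" "X \<in> span B" "\<And>j. lev j < i \<Longrightarrow> \<theta> j X = 0"
  shows "\<exists>c. (\<forall>j. real_poly_exp (c j)) \<and> (\<forall>y. \<exists>W\<in>span B. (\<forall>j. \<theta> j W = 0) \<and>
    X - (\<Sum>j\<in>set (blocks_from i). c j y *\<^sub>R frame Y (blocks_from i) y j) = ad_prod Y (blocks_from i) y W)"
  using assms
proof (induction arbitrary: X rule: inc_induct)
  case base
  then show ?case
    using lev_less by (intro exI[of _ "\<lambda>j y. 0"]) (auto simp: blocks_from_def real_poly_exp_const)
next
  case (step i)
  let ?bs = "block i" and ?js = "blocks_from (Suc i)"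
  define c where "c j y = \<theta> j (ad_prod_inv Y ?bs y X)" for j y
  define V where "V y = X - (\<Sum>j\<in>set ?bs. c j y *\<^sub>R frame Y ?bs y j)" for y
  define X' where "X' y = ad_prod_inv Y ?bs y (V y)" for y
  have c: "real_poly_exp (c j)" for j
    unfolding c_def
    by (intro coords_poly_exp_apply coords_poly_exp_ad_prod_inv coords_poly_exp_const
        ad_prod_inv_closed Y_span step.prems(1) linear_coframe)
  have V: "V y \<in> span B" for y
    unfolding V_def by (intro span_diff span_sum span_scale frame_mem Y_span step.prems(1))
  have "coords_poly_exp V"
    unfolding coords_poly_exp_def
  proof
    fix b
    have "real_poly_exp (\<lambda>y. \<phi> b X + (\<Sum>j\<in>set ?bs. c j y * (- 1 * \<phi> b (frame Y ?bs y j))))"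
      by (intro real_poly_exp_add real_poly_exp_const real_poly_exp_sum real_poly_exp_mult c
          coords_poly_exp_apply[OF coords_poly_exp_frame] linear_coord frame_mem Y_span)
    then show "real_poly_exp (\<lambda>y. \<phi> b (V y))"
      by (simp add: V_def linear_diff[OF linear_coord] linear_sum[OF linear_coord]
          linear_cmul[OF linear_coord] sum_negf)
  qed
  then have X'_poly: "coords_poly_exp X'"
    unfolding X'_def using V by (intro coords_poly_exp_ad_prod_inv Y_span) auto
  have X'_span: "X' y \<in> span B" for y
    unfolding X'_def using V by (intro ad_prod_inv_closed Y_span) auto
  let ?S = "{V \<in> span B. \<forall>j. lev j < Suc i \<longrightarrow> \<theta> j V = 0}"
  have "subspace ?S"
    using linear_0[OF linear_coframe] linear_add[OF linear_coframe] linear_cmul[OF linear_coframe]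
    by (auto simp: subspace_def span_zero intro: span_add span_scale)
  \<comment> \<open>The rest \<open>X' y\<close> varies with \<open>y\<close>, but the induction
    hypothesis concerns fixed vectors. It is applied to the projections \<open>P b\<close>, of which
    \<open>X' y\<close> is a combination with exponential polynomial coefficients.\<close>
  then obtain P where P: "linear P" "\<And>v. P v \<in> ?S" "\<And>v. v \<in> ?S \<Longrightarrow> P v = v"
    using subspace_projection by blast
  have X'_S: "X' y \<in> ?S" for y
    using X'_span peel_block[OF step.prems, of i] step.prems by (simp add: X'_def V_def c_def)
  have X'_eq: "X' y = (\<Sum>b\<in>B. \<phi> b (X' y) *\<^sub>R P b)" for y
    using linear_expand[OF P(1) X'_span[of y]] unfolding P(3)[OF X'_S[of y]] .
  have "\<forall>b. \<exists>c. (\<forall>j. real_poly_exp (c j)) \<and> (\<forall>y. \<exists>W\<in>span B. (\<forall>j. \<theta> j W = 0) \<and>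
      P b - (\<Sum>j\<in>set ?js. c j y *\<^sub>R frame Y ?js y j) = ad_prod Y ?js y W)"
    using P(2) by (intro allI step.IH) auto
  from choice[OF this] obtain C where C: "\<And>b j. real_poly_exp (C b j)"
    "\<And>b y. \<exists>W\<in>span B. (\<forall>j. \<theta> j W = 0) \<and>
      P b - (\<Sum>j\<in>set ?js. C b j y *\<^sub>R frame Y ?js y j) = ad_prod Y ?js y W"
    by blast
  define c' where "c' j y = (if j \<in> set ?bs then c j y else (\<Sum>b\<in>B. \<phi> b (X' y) * C b j y))" for j y
  have "real_poly_exp (c' j)" for j
  proof (cases "j \<in> set ?bs")
    case False
    have "real_poly_exp (\<lambda>y. \<Sum>b\<in>B. \<phi> b (X' y) * C b j y)"
      using X'_poly by (intro real_poly_exp_sum real_poly_exp_mult C(1)) (simp add: coords_poly_exp_def)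
    then show ?thesis using False by (simp add: c'_def[abs_def])
  qed (simp add: c'_def[abs_def] c)
  moreover have "\<exists>W\<in>span B. (\<forall>j. \<theta> j W = 0) \<and>
    X - (\<Sum>j\<in>set (blocks_from i). c' j y *\<^sub>R frame Y (blocks_from i) y j) = ad_prod Y (blocks_from i) y W" for y
  proof -
    let ?T = "ad_prod Y ?bs y"
    have "\<forall>b. \<exists>W. W \<in> span B \<and> (\<forall>j. \<theta> j W = 0) \<and>
        P b - (\<Sum>j\<in>set ?js. C b j y *\<^sub>R frame Y ?js y j) = ad_prod Y ?js y W"
      using C(2)[of _ y] unfolding Bex_def by blast
    from choice[OF this] obtain W where W: "\<And>b. W b \<in> span B" "\<And>b j. \<theta> j (W b) = 0"
      "\<And>b. P b - (\<Sum>j\<in>set ?js. C b j y *\<^sub>R frame Y ?js y j) = ad_prod Y ?js y (W b)"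
      by blast
    define W' where "W' = (\<Sum>b\<in>B. \<phi> b (X' y) *\<^sub>R W b)"
    have W': "W' \<in> span B" unfolding W'_def by (intro span_sum span_scale W)
    have W'0: "\<theta> j W' = 0" for j
      by (simp add: W'_def linear_sum[OF linear_coframe] linear_cmul[OF linear_coframe] W(2))
    have disj: "set ?bs \<inter> set ?js = {}" using block(1) set_blocks_from by auto
    have "(\<Sum>j\<in>set (blocks_from i). c' j y *\<^sub>R frame Y (blocks_from i) y j)
        = (\<Sum>j\<in>set ?bs. c' j y *\<^sub>R frame Y (?bs @ ?js) y j) + (\<Sum>j\<in>set ?js. c' j y *\<^sub>R frame Y (?bs @ ?js) y j)"
      using disj by (simp add: blocks_from_step[OF step.hyps(2)] sum.union_disjoint)
    also have "(\<Sum>j\<in>set ?bs. c' j y *\<^sub>R frame Y (?bs @ ?js) y j) = (\<Sum>j\<in>set ?bs. c j y *\<^sub>R frame Y ?bs y j)"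
      by (rule sum.cong) (simp_all add: c'_def frame_append1)
    also have "(\<Sum>j\<in>set ?js. c' j y *\<^sub>R frame Y (?bs @ ?js) y j) =
        (\<Sum>j\<in>set ?js. (\<Sum>b\<in>B. \<phi> b (X' y) * C b j y) *\<^sub>R ?T (frame Y ?js y j))"
      using disj by (intro sum.cong) (auto simp: c'_def frame_append2)
    also have "\<dots> = (\<Sum>j\<in>set ?js. \<Sum>b\<in>B. (\<phi> b (X' y) * C b j y) *\<^sub>R ?T (frame Y ?js y j))"
      by (simp only: scaleR_sum_left)
    also have "\<dots> = (\<Sum>b\<in>B. \<Sum>j\<in>set ?js. (\<phi> b (X' y) * C b j y) *\<^sub>R ?T (frame Y ?js y j))"
      by (rule sum.swap)
    also have "\<dots> = ?T (\<Sum>b\<in>B. \<phi> b (X' y) *\<^sub>R (\<Sum>j\<in>set ?js. C b j y *\<^sub>R frame Y ?js y j))"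
      by (simp only: linear_sum[OF linear_ad_prod] linear_cmul[OF linear_ad_prod] scaleR_sum_right
          scaleR_scaleR)
    finally have "X - (\<Sum>j\<in>set (blocks_from i). c' j y *\<^sub>R frame Y (blocks_from i) y j)
        = V y - ?T (\<Sum>b\<in>B. \<phi> b (X' y) *\<^sub>R (\<Sum>j\<in>set ?js. C b j y *\<^sub>R frame Y ?js y j))"
      by (simp add: V_def)
    also have "V y = ?T (X' y)" unfolding X'_def by (rule ad_prod_inverse[OF Y_span V, symmetric])
    also have "?T (X' y) - ?T (\<Sum>b\<in>B. \<phi> b (X' y) *\<^sub>R (\<Sum>j\<in>set ?js. C b j y *\<^sub>R frame Y ?js y j))
        = ?T ((\<Sum>b\<in>B. \<phi> b (X' y) *\<^sub>R P b) - (\<Sum>b\<in>B. \<phi> b (X' y) *\<^sub>R (\<Sum>j\<in>set ?js. C b j y *\<^sub>R frame Y ?js y j)))"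
      unfolding linear_diff[OF linear_ad_prod] X'_eq[of y, symmetric] ..
    also have "\<dots> = ?T (\<Sum>b\<in>B. \<phi> b (X' y) *\<^sub>R (P b - (\<Sum>j\<in>set ?js. C b j y *\<^sub>R frame Y ?js y j)))"
      by (simp only: sum_subtractf scaleR_diff_right)
    also have "\<dots> = ?T (ad_prod Y ?js y W')"
      by (simp only: W(3) W'_def linear_sum[OF linear_ad_prod] linear_cmul[OF linear_ad_prod])
    also have "\<dots> = ad_prod Y (blocks_from i) y W'"
      by (simp add: blocks_from_step[OF step.hyps(2)] ad_prod_append)
    finally show ?thesis using W' W'0 by blast
  qed
  ultimately show ?case by blast
qed

end

section \<open>Lie brackets of vector fields\<close>

abbreviation fderiv :: "('a::real_normed_vector \<Rightarrow> 'b::real_normed_vector) \<Rightarrow> 'a \<Rightarrow> 'a \<Rightarrow> 'b" where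
  "fderiv X x \<equiv> frechet_derivative X (at x)"

lemma vector_field_Ck: "X \<in> vector_fields U \<Longrightarrow> Ck_on k U X"
  by (simp add: vector_fields_def smooth_on_def)

lemma vector_field_derivative:
  "X \<in> vector_fields U \<Longrightarrow> x \<in> U \<Longrightarrow> (X has_derivative fderiv X x) (at x)"
  by (rule Ck_on_SucD(1)[OF vector_field_Ck[of X U "Suc 0"]])

lemma vector_field_fderiv_Ck: "X \<in> vector_fields U \<Longrightarrow> Ck_on k U (\<lambda>x. fderiv X x v)"
  by (rule Ck_on_SucD(2)[OF vector_field_Ck])

lemma vector_field_second_derivative:
  "X \<in> vector_fields U \<Longrightarrow> x \<in> U \<Longrightarrow>
    ((\<lambda>x. fderiv X x v) has_derivative fderiv (\<lambda>x. fderiv X x v) x) (at x)"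
  by (rule Ck_on_SucD(1)[OF vector_field_fderiv_Ck[of X U "Suc 0" v]])

lemma linear_sum_axis:
  fixes f :: "real^'n \<Rightarrow> 'b::real_vector"
  assumes "linear f"
  shows "f u = (\<Sum>i\<in>UNIV. u $ i *\<^sub>R f (axis i 1))"
proof -
  have "u = (\<Sum>i\<in>UNIV. u $ i *\<^sub>R axis i 1)"
    by (simp add: vec_eq_iff axis_def if_distrib cong: if_cong)
  then have "f u = f (\<Sum>i\<in>UNIV. u $ i *\<^sub>R axis i 1)" by (rule arg_cong)
  then show ?thesis by (simp only: linear_sum[OF assms] linear_cmul[OF assms])
qed

text \<open>Smoothness differentiates \<open>fderiv X z v\<close> for constant \<open>v\<close>
  only, so the moving direction \<open>Y z\<close> is first expanded in the standard basis.\<close>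

lemma fderiv_apply_derivative:
  fixes X Y :: "real^'n \<Rightarrow> real^'n"
  assumes "open U" "X \<in> vector_fields U" "Y \<in> vector_fields U" "x \<in> U"
  shows "((\<lambda>z. fderiv X z (Y z)) has_derivative
    (\<lambda>h. fderiv X x (fderiv Y x h) + fderiv (\<lambda>z. fderiv X z (Y x)) x h)) (at x)"
proof -
  let ?H = "\<lambda>v. fderiv (\<lambda>x. fderiv X x v) x"
  have lin: "linear (fderiv X z)" if "z \<in> U" for z
    using vector_field_derivative[OF assms(2) that] has_derivative_linear by blast
  \<comment> \<open>Linearity of the second derivative in its inner direction, obtained from
    uniqueness of derivatives.\<close>
  have H: "?H v h = (\<Sum>i\<in>UNIV. v $ i *\<^sub>R ?H (axis i 1) h)" for v h
  proof -
    have "((\<lambda>z. \<Sum>i\<in>UNIV. v $ i *\<^sub>R fderiv X z (axis i 1)) has_derivative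
        (\<lambda>h. \<Sum>i\<in>UNIV. v $ i *\<^sub>R ?H (axis i 1) h)) (at x)"
      by (intro has_derivative_sum has_derivative_scaleR_right vector_field_second_derivative[OF assms(2,4)])
    then have "((\<lambda>z. fderiv X z v) has_derivative (\<lambda>h. \<Sum>i\<in>UNIV. v $ i *\<^sub>R ?H (axis i 1) h)) (at x)"
      by (rule has_derivative_transform_within_open[OF _ assms(1,4)]) (rule linear_sum_axis[OF lin, symmetric])
    from has_derivative_unique[OF vector_field_second_derivative[OF assms(2,4)] this]
    show ?thesis by (rule fun_cong)
  qed
  have "((\<lambda>z. Y z $ i) has_derivative (\<lambda>h. fderiv Y x h $ i)) (at x)" for i
    by (rule bounded_linear.has_derivative[OF bounded_linear_vec_nth vector_field_derivative[OF assms(3,4)]])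
  then have "((\<lambda>z. \<Sum>i\<in>UNIV. Y z $ i *\<^sub>R fderiv X z (axis i 1)) has_derivative
      (\<lambda>h. \<Sum>i\<in>UNIV. Y x $ i *\<^sub>R ?H (axis i 1) h + fderiv Y x h $ i *\<^sub>R fderiv X x (axis i 1))) (at x)"
    by (intro has_derivative_sum has_derivative_scaleR vector_field_second_derivative[OF assms(2,4)])
  moreover have "(\<Sum>i\<in>UNIV. Y x $ i *\<^sub>R ?H (axis i 1) h + fderiv Y x h $ i *\<^sub>R fderiv X x (axis i 1))
      = fderiv X x (fderiv Y x h) + ?H (Y x) h" for h
    using H[of "Y x" h] linear_sum_axis[OF lin[OF assms(4)], of "fderiv Y x h"]
    by (simp add: sum.distrib)
  ultimately have "((\<lambda>z. \<Sum>i\<in>UNIV. Y z $ i *\<^sub>R fderiv X z (axis i 1)) has_derivative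
      (\<lambda>h. fderiv X x (fderiv Y x h) + ?H (Y x) h)) (at x)" by (simp only:)
  then show ?thesis
    by (rule has_derivative_transform_within_open[OF _ assms(1,4)]) (rule linear_sum_axis[OF lin, symmetric])
qed

lemma fderiv_lie_bracket:
  fixes X Y :: "real^'n \<Rightarrow> real^'n"
  assumes "open U" "X \<in> vector_fields U" "Y \<in> vector_fields U" "x \<in> U"
  shows "fderiv (lie_bracket U X Y) x h =
    fderiv Y x (fderiv X x h) + fderiv (\<lambda>z. fderiv Y z (X x)) x h
    - (fderiv X x (fderiv Y x h) + fderiv (\<lambda>z. fderiv X z (Y x)) x h)"
proof -
  have "((\<lambda>z. fderiv Y z (X z) - fderiv X z (Y z)) has_derivative (\<lambda>h.
      fderiv Y x (fderiv X x h) + fderiv (\<lambda>z. fderiv Y z (X x)) x h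
      - (fderiv X x (fderiv Y x h) + fderiv (\<lambda>z. fderiv X z (Y x)) x h))) (at x)"
    by (intro has_derivative_diff fderiv_apply_derivative[OF assms(1,2,3,4)]
        fderiv_apply_derivative[OF assms(1,3,2,4)])
  then have "(lie_bracket U X Y has_derivative (\<lambda>h.
      fderiv Y x (fderiv X x h) + fderiv (\<lambda>z. fderiv Y z (X x)) x h
      - (fderiv X x (fderiv Y x h) + fderiv (\<lambda>z. fderiv X z (Y x)) x h))) (at x)"
    by (rule has_derivative_transform_within_open[OF _ assms(1,4)]) (simp add: lie_bracket_def)
  from frechet_derivative_at[OF this, symmetric] show ?thesis by simp
qed

text \<open>The terms with second derivatives cancel by symmetry. The arrangement is the derivation
  law that \<open>fin_dim_lie\<close> asks of the opposite bracket.\<close>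

lemma lie_bracket_jacobi:
  fixes V W X :: "real^'n \<Rightarrow> real^'n"
  assumes "open U" "V \<in> vector_fields U" "W \<in> vector_fields U" "X \<in> vector_fields U"
  shows "lie_bracket U (lie_bracket U W V) X =
    lie_bracket U W (lie_bracket U V X) + lie_bracket U (lie_bracket U W X) V"
proof
  fix x
  show "lie_bracket U (lie_bracket U W V) X x =
    (lie_bracket U W (lie_bracket U V X) + lie_bracket U (lie_bracket U W X) V) x"
  proof (cases "x \<in> U")
    case True
    have sym: "fderiv (\<lambda>z. fderiv A z u) x v = fderiv (\<lambda>z. fderiv A z v) x u"
      if "A \<in> vector_fields U" for A :: "real^'n \<Rightarrow> real^'n" and u v
      by (rule second_derivative_symmetric[OF assms(1) True vector_field_derivative[OF that]
            vector_field_second_derivative[OF that True] vector_field_second_derivative[OF that True]])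
    have diff: "fderiv A x (u - v) = fderiv A x u - fderiv A x v" if "A \<in> vector_fields U" for A :: "real^'n \<Rightarrow> real^'n" and u v
      using vector_field_derivative[OF that True] has_derivative_linear linear_diff by blast
    have val: "lie_bracket U A C x = fderiv C x (A x) - fderiv A x (C x)" for A C
      using True by (simp add: lie_bracket_def)
    show ?thesis
      unfolding plus_fun_apply val fderiv_lie_bracket[OF assms(1,3,2) True]
        fderiv_lie_bracket[OF assms(1,2,4) True] fderiv_lie_bracket[OF assms(1,3,4) True]
        diff[OF assms(2)] diff[OF assms(3)] diff[OF assms(4)]
        sym[OF assms(2), of "W x" "X x"] sym[OF assms(3), of "V x" "X x"] sym[OF assms(4), of "W x" "V x"]
      by (simp add: algebra_simps)
  qed (simp add: lie_bracket_def)
qed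

text \<open>Energy argument: the squared norm of \<open>f\<close>, damped by
  \<open>exp (- 2 * C * t)\<close>, does not increase and starts at 0.\<close>

lemma linear_ode_zero:
  fixes f :: "real \<Rightarrow> 'b::real_inner"
  assumes der: "\<And>t. t \<in> {0..1} \<Longrightarrow> (f has_vector_derivative f' t) (at t)"
    and bound: "\<And>t. t \<in> {0..1} \<Longrightarrow> norm (f' t) \<le> C * norm (f t)" and "f 0 = 0"
  shows "f 1 = 0"
proof -
  define h where "h t = (f t \<bullet> f t) * exp (- 2 * C * t)" for t
  have h: "(h has_real_derivative (2 * (f t \<bullet> f' t) - 2 * C * (f t \<bullet> f t)) * exp (- 2 * C * t)) (at t)"
    if t: "t \<in> {0..1}" for t
  proof -
    have "((\<lambda>t. f t \<bullet> f t) has_real_derivative 2 * (f t \<bullet> f' t)) (at t)"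
      using has_derivative_inner[OF der[OF t, unfolded has_vector_derivative_def] der[OF t, unfolded has_vector_derivative_def]]
      by (simp add: has_field_derivative_def inner_commute algebra_simps mult_commute_abs)
    then show ?thesis
      unfolding h_def by (auto intro!: derivative_eq_intros simp: algebra_simps)
  qed
  have "h 1 \<le> h 0"
  proof (rule DERIV_nonpos_imp_nonincreasing[of 0 1 h])
    fix t :: real assume t: "0 \<le> t" "t \<le> 1"
    have "f t \<bullet> f' t \<le> norm (f t) * norm (f' t)" by (rule norm_cauchy_schwarz)
    also have "\<dots> \<le> norm (f t) * (C * norm (f t))" using bound[of t] t by (intro mult_left_mono) auto
    also have "\<dots> = C * (f t \<bullet> f t)" by (simp add: dot_square_norm power2_eq_square)
    finally have "(2 * (f t \<bullet> f' t) - 2 * C * (f t \<bullet> f t)) * exp (- 2 * C * t) \<le> 0"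
      by (intro mult_nonpos_nonneg) auto
    then show "\<exists>y. (h has_real_derivative y) (at t) \<and> y \<le> 0" using h[of t] t by auto
  qed simp
  then have "f 1 \<bullet> f 1 \<le> 0" by (simp add: h_def assms(3) mult_le_0_iff)
  then have "f 1 \<bullet> f 1 = 0" using inner_ge_zero[of "f 1"] by linarith
  then show ?thesis by simp
qed

section \<open>Bases adapted to a decreasing chain of subspaces\<close>

text \<open>The basis is extended upwards from \<open>H r\<close>, and \<open>lev\<close> records
  the member of the chain at which a vector was added. Later extensions only add vectors of lower
  level, so those of level at least \<open>k\<close> keep spanning \<open>H k\<close>.\<close>

lemma basis_adapted_to_chain:
  fixes H :: "nat \<Rightarrow> 'v::real_vector set"
  assumes sub: "\<And>k. subspace (H k)" and dec: "\<And>k. H (Suc k) \<subseteq> H k" and zero: "H r = {0}" and "i \<le> r"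
  shows "\<exists>C lev. independent C \<and> span C = H i \<and> (\<forall>v\<in>C. i \<le> lev v \<and> lev v < r \<and> v \<in> H (lev v)) \<and>
    (\<forall>k\<ge>i. H k \<subseteq> span {v\<in>C. k \<le> lev v})"
  using \<open>i \<le> r\<close>
proof (induction rule: inc_induct)
  case base
  have "H k \<subseteq> {0}" if "r \<le> k" for k
    using lift_Suc_antimono_le[of H, OF dec that] zero by simp
  then show ?case
    by (intro exI[of _ "{}"] exI[of _ "\<lambda>_. 0"]) (auto simp: zero independent_empty)
next
  case (step i)
  then obtain C lev where C: "independent C" "span C = H (Suc i)"
    "\<And>v. v \<in> C \<Longrightarrow> Suc i \<le> lev v \<and> lev v < r \<and> v \<in> H (lev v)"
    "\<And>k. k \<ge> Suc i \<Longrightarrow> H k \<subseteq> span {v\<in>C. k \<le> lev v}" by blast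
  have "C \<subseteq> H i" using C(2) dec[of i] span_superset[of C] by blast
  then obtain C' where C': "C \<subseteq> C'" "C' \<subseteq> H i" "independent C'" "H i \<subseteq> span C'"
    using maximal_independent_subset_extend[OF _ C(1)] by blast
  define lev' where "lev' v = (if v \<in> C then lev v else i)" for v
  have "H k \<subseteq> span {v\<in>C'. k \<le> lev' v}" if "k \<ge> i" for k
  proof (cases "k = i")
    case True
    have "i \<le> lev' v" for v using C(3)[of v] by (auto simp: lev'_def)
    then show ?thesis using True C'(4) by simp
  next
    case False
    have "span {v\<in>C. k \<le> lev v} \<subseteq> span {v\<in>C'. k \<le> lev' v}"
      by (rule span_mono) (use C'(1) in \<open>auto simp: lev'_def\<close>)
    then show ?thesis using C(4)[of k] that False by auto
  qed
  moreover have "span C' = H i" using C'(2,4) sub span_minimal by blast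
  moreover have "i \<le> lev' v \<and> lev' v < r \<and> v \<in> H (lev' v)" if "v \<in> C'" for v
    using C(3)[of v] that C'(2) step.hyps by (auto simp: lev'_def)
  ultimately show ?case using C'(3) by blast
qed

text \<open>The dual basis of an adapted basis, reindexed by the coordinate type. A dual form
  vanishes on \<open>H k\<close> if its basis vector has level below \<open>k\<close>, because
  \<open>H k\<close> is spanned by other basis vectors.\<close>

lemma adapted_coframe:
  fixes H :: "nat \<Rightarrow> (real^'n) set"
  assumes "\<And>k. subspace (H k)" "\<And>k. H (Suc k) \<subseteq> H k" "H r = {0}" "H 0 = UNIV"
  obtains v :: "'n \<Rightarrow> real^'n" and \<psi> :: "'n \<Rightarrow> real^'n \<Rightarrow> real" and lev where "\<And>j. v j \<in> H (lev j)" "\<And>j. lev j < r"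
    "\<And>j. linear (\<psi> j)" "\<And>i j. \<psi> i (v j) = (if i = j then 1 else 0)"
    "\<And>j k u. u \<in> H k \<Longrightarrow> lev j < k \<Longrightarrow> \<psi> j u = 0" "\<And>u. (\<And>j. \<psi> j u = 0) \<Longrightarrow> u = 0"
proof -
  have "\<exists>C lev. independent C \<and> span C = UNIV \<and> (\<forall>v\<in>C. lev v < r \<and> v \<in> H (lev v)) \<and>
      (\<forall>k. H k \<subseteq> span {v\<in>C. k \<le> lev v})"
    using basis_adapted_to_chain[of H r 0, OF assms(1-3)] assms(4) by simp
  then obtain C lev where C: "independent C" "span C = UNIV"
    "\<And>v. v \<in> C \<Longrightarrow> lev v < r \<and> v \<in> H (lev v)" "\<And>k. H k \<subseteq> span {v\<in>C. k \<le> lev v}"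
    by blast
  have fin: "finite C" using C(1) independent_imp_finite by blast
  have "card C = CARD('n)"
    using basis_card_eq_dim[of C UNIV] C(1,2) by simp
  then obtain v :: "'n \<Rightarrow> real^'n" where v: "bij_betw v UNIV C"
    using finite_same_card_bij[of "UNIV :: 'n set" C] fin by auto
  have vC: "v j \<in> C" for j using bij_betwE[OF v] by blast
  have v_eq: "v i = v j \<longleftrightarrow> i = j" for i j by (rule inj_eq[OF bij_betw_imp_inj_on[OF v]])
  have "\<forall>j. \<exists>f. linear f \<and> (\<forall>x\<in>C. f x = (if x = v j then 1 else 0 :: real))"
    by (intro allI linear_independent_extend C(1))
  from choice[OF this] obtain \<psi> where \<psi>: "\<And>j. linear (\<psi> j)"
    "\<And>j x. x \<in> C \<Longrightarrow> \<psi> j x = (if x = v j then 1 else 0 :: real)" by blast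
  show thesis
  proof (rule that[of v "\<lambda>j. lev (v j)" \<psi>])
    show "v j \<in> H (lev (v j))" "lev (v j) < r" for j using C(3) vC by blast+
    show "linear (\<psi> j)" for j by (rule \<psi>)
    show "\<psi> i (v j) = (if i = j then 1 else 0)" for i j using \<psi>(2)[OF vC, of i j] v_eq[of j i] by auto
    show "\<psi> j u = 0" if "u \<in> H k" "lev (v j) < k" for j k u
    proof (rule linear_eq_0_on_span[OF \<psi>(1)])
      show "\<psi> j x = 0" if "x \<in> {v\<in>C. k \<le> lev v}" for x
        using that \<psi>(2)[of x j] \<open>lev (v j) < k\<close> by auto
      show "u \<in> span {v\<in>C. k \<le> lev v}" using C(4) that(1) by blast
    qed
    show "u = 0" if "\<And>j. \<psi> j u = 0" for u
    proof -
      have lin: "linear (\<lambda>u. \<Sum>j\<in>UNIV. \<psi> j u *\<^sub>R v j)"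
        by (simp add: linear_iff linear_add[OF \<psi>(1)] linear_cmul[OF \<psi>(1)] scaleR_add_left sum.distrib scaleR_sum_right)
      have "(\<Sum>j\<in>UNIV. \<psi> j x *\<^sub>R v j) = id x" if xC: "x \<in> C" for x
      proof -
        obtain i where i: "x = v i" using bij_betw_imp_surj_on[OF v] xC by blast
        have "(\<Sum>j\<in>UNIV. \<psi> j x *\<^sub>R v j) = (\<Sum>j\<in>UNIV. if j = i then v i else 0)"
          using \<psi>(2)[OF xC] v_eq[of i] by (intro sum.cong) (auto simp: i)
        then show ?thesis by (simp add: i)
      qed
      then have "(\<Sum>j\<in>UNIV. \<psi> j u *\<^sub>R v j) = id u"
        by (rule linear_eq_on_span[OF lin linear_id, of C]) (auto simp: C(2))
      then show ?thesis by (simp add: that)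
    qed
  qed
qed

section \<open>The chart\<close>

lemma fderiv_combination:
  fixes B :: "(real^'n \<Rightarrow> real^'n) set"
  assumes "B \<subseteq> vector_fields U" "x \<in> U"
  shows "fderiv (\<Sum>b\<in>B. c b *\<^sub>R b) x h = (\<Sum>b\<in>B. c b *\<^sub>R fderiv b x h)"
proof -
  have "((\<lambda>x. \<Sum>b\<in>B. c b *\<^sub>R b x) has_derivative (\<lambda>h. \<Sum>b\<in>B. c b *\<^sub>R fderiv b x h)) (at x)"
    using assms by (intro has_derivative_sum has_derivative_scaleR_right vector_field_derivative) auto
  moreover have "(\<Sum>b\<in>B. c b *\<^sub>R b) = (\<lambda>x. \<Sum>b\<in>B. c b *\<^sub>R b x)"
    by (simp add: fun_eq_iff sum_fun_apply scaleR_fun_def)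
  ultimately have "((\<Sum>b\<in>B. c b *\<^sub>R b) has_derivative (\<lambda>h. \<Sum>b\<in>B. c b *\<^sub>R fderiv b x h)) (at x)"
    by (simp only:)
  from fun_cong[OF frechet_derivative_at[OF this], of h] show ?thesis by (rule sym)
qed

lemma lie_bracket_combination:
  fixes B :: "(real^'n \<Rightarrow> real^'n) set"
  assumes "B \<subseteq> vector_fields U"
  shows "lie_bracket U (\<Sum>c\<in>B. \<beta> c *\<^sub>R c) (\<Sum>b\<in>B. \<alpha> b *\<^sub>R b) =
    (\<Sum>b\<in>B. \<Sum>c\<in>B. (\<alpha> b * \<beta> c) *\<^sub>R lie_bracket U c b)"
proof
  fix x
  show "lie_bracket U (\<Sum>c\<in>B. \<beta> c *\<^sub>R c) (\<Sum>b\<in>B. \<alpha> b *\<^sub>R b) x =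
    (\<Sum>b\<in>B. \<Sum>c\<in>B. (\<alpha> b * \<beta> c) *\<^sub>R lie_bracket U c b) x"
  proof (cases "x \<in> U")
    case True
    have lin: "linear (fderiv b x)" if "b \<in> B" for b
      using vector_field_derivative[of b U x] that assms True has_derivative_linear by blast
    have "fderiv (\<Sum>b\<in>B. \<alpha> b *\<^sub>R b) x ((\<Sum>c\<in>B. \<beta> c *\<^sub>R c) x)
        = (\<Sum>b\<in>B. \<Sum>c\<in>B. (\<alpha> b * \<beta> c) *\<^sub>R fderiv b x (c x))" for \<alpha> \<beta>
      unfolding fderiv_combination[OF assms True]
      by (intro sum.cong refl)
         (simp add: sum_fun_apply scaleR_fun_def linear_sum[OF lin] linear_cmul[OF lin] scaleR_sum_right)
    note eq = this
    have "(\<Sum>b\<in>B. \<Sum>c\<in>B. (\<beta> b * \<alpha> c) *\<^sub>R fderiv b x (c x))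
        = (\<Sum>b\<in>B. \<Sum>c\<in>B. (\<alpha> b * \<beta> c) *\<^sub>R fderiv c x (b x))"
      by (subst sum.swap) (simp add: mult.commute)
    then have "lie_bracket U (\<Sum>c\<in>B. \<beta> c *\<^sub>R c) (\<Sum>b\<in>B. \<alpha> b *\<^sub>R b) x =
        (\<Sum>b\<in>B. \<Sum>c\<in>B. (\<alpha> b * \<beta> c) *\<^sub>R fderiv b x (c x)) -
        (\<Sum>b\<in>B. \<Sum>c\<in>B. (\<alpha> b * \<beta> c) *\<^sub>R fderiv c x (b x))"
      using True by (simp only: lie_bracket_def if_True eq)
    then show ?thesis
      using True
      by (simp add: lie_bracket_def sum_fun_apply scaleR_fun_def scaleR_diff_right sum_subtractf)
  qed (simp add: lie_bracket_def sum_fun_apply scaleR_fun_def)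
qed

text \<open>The coframe reads off the components of the value at 0, so by \<open>\<psi>_zero\<close>
  the remainder \<open>W\<close> from \<open>poly_exp_coefficients\<close> is a field vanishing at
  0.\<close>

locale adapted_fields = adapted_frame B \<phi> br Y "\<lambda>j X. \<psi> j (X 0)" lev g r
  for U :: "(real^'n) set" and B \<phi> br and Y :: "'n \<Rightarrow> real^'n \<Rightarrow> real^'n"
    and \<psi> :: "'n \<Rightarrow> real^'n \<Rightarrow> real" and lev g r +
  assumes open_U: "open U" and zero_U: "0 \<in> U" and fields: "span B \<subseteq> vector_fields U"
    and br_bracket: "V \<in> span B \<Longrightarrow> W \<in> span B \<Longrightarrow> br V W = lie_bracket U W V"
    and linear_\<psi>: "linear (\<psi> j)" and \<psi>_zero: "(\<And>j. \<psi> j u = 0) \<Longrightarrow> u = 0"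
begin

definition Z :: "real^'n \<Rightarrow> 'n \<Rightarrow> real^'n \<Rightarrow> real^'n" where
  "Z y i = frame Y (blocks_from 0) y i"

definition DZ :: "'n \<Rightarrow> real^'n \<Rightarrow> real^'n \<Rightarrow> real^'n \<Rightarrow> real^'n" where
  "DZ i y h = (\<Sum>k\<in>set (takeWhile ((\<noteq>) i) (blocks_from 0)). h $ k *\<^sub>R br (Z y k) (Z y i))"

lemma set_blocks [simp]: "set (blocks_from 0) = UNIV"
  by (simp add: set_blocks_from)

lemma Z_span: "Z y i \<in> span B"
  unfolding Z_def by (rule frame_mem[OF Y_span])

lemma DZ_span: "DZ i y h \<in> span B"
  unfolding DZ_def by (intro span_sum span_scale br_closed Z_span)

lemma basis_span: "b \<in> B \<Longrightarrow> b \<in> span B"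
  by (rule span_base)

lemma coord_Z_derivative:
  assumes "b \<in> B"
  shows "((\<lambda>y. \<phi> b (Z y i)) has_derivative (\<lambda>h. \<phi> b (DZ i y h))) (at y)"
  using coord_derivative_frame[where Y = Y, OF Y_span distinct_blocks_from[of 0], of i y] assms
  unfolding coord_derivative_def Z_def DZ_def by blast

lemma coord_Z_poly_exp: "b \<in> B \<Longrightarrow> real_poly_exp (\<lambda>y. \<phi> b (Z y i))"
  using coords_poly_exp_frame[where Y = Y and js = "blocks_from 0" and i = i, OF Y_span] unfolding coords_poly_exp_def Z_def by blast

lemma continuous_on_coord_Z: "b \<in> B \<Longrightarrow> continuous_on S (\<lambda>y. \<phi> b (Z y i))"
  using Ck_on_continuous[OF real_poly_exp_Ck[OF coord_Z_poly_exp, of b 0 i]] continuous_on_subset by blast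

lemma continuous_on_coord_DZ:
  assumes "b \<in> B"
  shows "continuous_on S (\<lambda>y. \<phi> b (DZ i y h))"
proof -
  obtain D where D: "\<And>y. ((\<lambda>y. \<phi> b (Z y i)) has_derivative D y) (at y)" "\<And>v. real_poly_exp (\<lambda>y. D y v)"
    using real_poly_exp_derivative[OF coord_Z_poly_exp[OF assms, of i]] by blast
  have "D y h = \<phi> b (DZ i y h)" for y
    using has_derivative_unique[OF D(1) coord_Z_derivative[OF assms]] by (rule fun_cong)
  then have "real_poly_exp (\<lambda>y. \<phi> b (DZ i y h))" using D(2)[of h] by simp
  from Ck_on_continuous[OF real_poly_exp_Ck[OF this, of 0]] show ?thesis
    using continuous_on_subset by blast
qed

lemma field_expand: "V \<in> span B \<Longrightarrow> V x = (\<Sum>b\<in>B. \<phi> b V *\<^sub>R b x)"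
  using fun_cong[OF expand, of V x] by (simp add: sum_fun_apply scaleR_fun_def)

lemma field_derivative: "V \<in> span B \<Longrightarrow> x \<in> U \<Longrightarrow> (V has_derivative fderiv V x) (at x)"
  using fields vector_field_derivative by blast

lemma linear_fderiv: "V \<in> span B \<Longrightarrow> x \<in> U \<Longrightarrow> linear (fderiv V x)"
  using field_derivative has_derivative_linear by blast

lemma fderiv_expand:
  assumes "V \<in> span B" "x \<in> U"
  shows "fderiv V x h = (\<Sum>b\<in>B. \<phi> b V *\<^sub>R fderiv b x h)"
  using fderiv_combination[OF order_trans[OF span_superset fields] assms(2), of "\<lambda>b. \<phi> b V" h]
  unfolding expand[OF assms(1)] .

lemma br_apply:
  "V \<in> span B \<Longrightarrow> W \<in> span B \<Longrightarrow> x \<in> U \<Longrightarrow> br V W x = fderiv V x (W x) - fderiv W x (V x)"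
  by (simp add: br_bracket lie_bracket_def)

lemma continuous_on_field: "b \<in> B \<Longrightarrow> continuous_on U b"
  using fields vector_field_Ck[of b U 0] basis_span by auto

lemma continuous_on_fderiv: "b \<in> B \<Longrightarrow> continuous_on U (\<lambda>x. fderiv b x h)"
  using fields vector_field_fderiv_Ck[of b U 0 h] basis_span by auto

text \<open>The rank one map with \<open>i\<close>-th coordinate form and vector \<open>w\<close>.
  Assembling \<open>F\<close> from such maps reduces its calculus to scalar coefficients and the
  basis fields.\<close>

definition slot :: "'n \<Rightarrow> real^'n \<Rightarrow> (real^'n) \<Rightarrow>\<^sub>L (real^'n)" where
  "slot i w = Blinfun (\<lambda>v. v $ i *\<^sub>R w)"

lemma slot_apply: "slot i w v = v $ i *\<^sub>R w"
  unfolding slot_def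
  by (subst bounded_linear_Blinfun_apply)
     (auto intro: bounded_linear_scaleR_const bounded_linear_vec_nth)

lemma bounded_linear_slot: "bounded_linear (slot i)"
  by (subst linear_conv_bounded_linear[symmetric])
     (auto intro!: linearI blinfun_eqI simp: slot_apply blinfun.add_left blinfun.scaleR_left algebra_simps)

definition F :: "(real^'n) \<times> (real^'n) \<Rightarrow> (real^'n) \<Rightarrow>\<^sub>L (real^'n)" where
  "F z = (\<Sum>i\<in>UNIV. \<Sum>b\<in>B. \<phi> b (Z (fst z) i) *\<^sub>R slot i (b (snd z)))"

definition dF :: "(real^'n) \<times> (real^'n) \<Rightarrow> (real^'n) \<times> (real^'n) \<Rightarrow> (real^'n) \<Rightarrow>\<^sub>L (real^'n)" where
  "dF z h = (\<Sum>i\<in>UNIV. \<Sum>b\<in>B. \<phi> b (Z (fst z) i) *\<^sub>R slot i (fderiv b (snd z) (snd h))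
     + \<phi> b (DZ i (fst z) (fst h)) *\<^sub>R slot i (b (snd z)))"

lemma F_apply: "F (y, x) v = (\<Sum>i\<in>UNIV. v $ i *\<^sub>R Z y i x)"
  by (simp add: F_def blinfun.sum_left blinfun.scaleR_left slot_apply field_expand[OF Z_span]
      scaleR_sum_right mult.commute)

lemma dF_apply:
  assumes "x \<in> U"
  shows "dF (y, x) (h, k) v = (\<Sum>i\<in>UNIV. v $ i *\<^sub>R (fderiv (Z y i) x k + DZ i y h x))"
  by (simp add: dF_def blinfun.sum_left blinfun.scaleR_left blinfun.add_left slot_apply
      field_expand[OF DZ_span] fderiv_expand[OF Z_span assms] scaleR_sum_right scaleR_add_right
      sum.distrib mult.commute)

lemma F_derivative:
  assumes "z \<in> UNIV \<times> U"
  shows "(F has_derivative dF z) (at z)"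
  unfolding F_def[abs_def] dF_def[abs_def]
proof (intro has_derivative_sum has_derivative_scaleR)
  fix i b assume b: "b \<in> B"
  show "((\<lambda>z. \<phi> b (Z (fst z) i)) has_derivative (\<lambda>h. \<phi> b (DZ i (fst z) (fst h)))) (at z)"
    by (rule has_derivative_compose[OF has_derivative_fst[OF has_derivative_ident] coord_Z_derivative[OF b]])
  show "((\<lambda>z. slot i (b (snd z))) has_derivative (\<lambda>h. slot i (fderiv b (snd z) (snd h)))) (at z)"
    using assms
    by (intro bounded_linear.has_derivative[OF bounded_linear_slot]
        has_derivative_compose[OF has_derivative_snd[OF has_derivative_ident] field_derivative[OF basis_span[OF b]]])
       auto
qed

lemma continuous_on_dF: "continuous_on (UNIV \<times> U) (\<lambda>z. dF z h)"
  unfolding dF_def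
proof (intro continuous_on_sum continuous_on_add continuous_on_scaleR
    bounded_linear.continuous_on[OF bounded_linear_slot])
  fix i b assume b: "b \<in> B"
  show "continuous_on (UNIV \<times> U) (\<lambda>z. \<phi> b (Z (fst z) i))"
    by (rule continuous_on_compose2[OF continuous_on_coord_Z[OF b, of UNIV] continuous_on_fst[OF continuous_on_id]]) simp
  show "continuous_on (UNIV \<times> U) (\<lambda>z. \<phi> b (DZ i (fst z) (fst h)))"
    by (rule continuous_on_compose2[OF continuous_on_coord_DZ[OF b, of UNIV] continuous_on_fst[OF continuous_on_id]]) simp
  show "continuous_on (UNIV \<times> U) (\<lambda>z. fderiv b (snd z) (snd h))"
    by (rule continuous_on_compose2[OF continuous_on_fderiv[OF b] continuous_on_snd[OF continuous_on_id]]) auto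
  show "continuous_on (UNIV \<times> U) (\<lambda>z. b (snd z))"
    by (rule continuous_on_compose2[OF continuous_on_field[OF b] continuous_on_snd[OF continuous_on_id]]) auto
qed

text \<open>The bracket of \<open>Z y k\<close> and \<open>Z y i\<close> is
  \<open>M k i - M i k\<close>. It is added exactly when \<open>k\<close> precedes \<open>i\<close>
  and then replaces \<open>M i k\<close> by \<open>M k i\<close>; the resulting array
  \<open>N\<close> is symmetric because the order is total.\<close>

lemma dF_symmetric:
  assumes "x \<in> U"
  shows "dF (y, x) (a, F (y, x) a) b = dF (y, x) (b, F (y, x) b) a"
proof -
  define M where "M k i = fderiv (Z y k) x (Z y i x)" for k i
  define before where "before k i \<longleftrightarrow> k \<in> set (takeWhile ((\<noteq>) i) (blocks_from 0))" for k i :: 'n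
  define N where "N k i = (if before k i then M k i else M i k)" for k i
  have N_sym: "N k i = N i k" for k i
    using takeWhile_neq_total[of k i "blocks_from 0"] by (cases "k = i") (auto simp: N_def before_def)
  have eq: "dF (y, x) (a, F (y, x) a) b = (\<Sum>i\<in>UNIV. \<Sum>k\<in>UNIV. (b $ i * a $ k) *\<^sub>R N k i)" for a b
  proof -
    have 1: "fderiv (Z y i) x (F (y, x) a) = (\<Sum>k\<in>UNIV. a $ k *\<^sub>R M i k)" for i
      by (simp add: F_apply M_def linear_sum[OF linear_fderiv[OF Z_span assms]]
          linear_cmul[OF linear_fderiv[OF Z_span assms]])
    have 2: "DZ i y a x = (\<Sum>k\<in>UNIV. if before k i then a $ k *\<^sub>R (M k i - M i k) else 0)" for i
      by (simp add: DZ_def sum_fun_apply scaleR_fun_def br_apply[OF Z_span Z_span assms] M_def before_def sum.If_cases)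
    have "fderiv (Z y i) x (F (y, x) a) + DZ i y a x = (\<Sum>k\<in>UNIV. a $ k *\<^sub>R N k i)" for i
      unfolding 1 2 sum.distrib[symmetric] by (rule sum.cong) (auto simp: N_def algebra_simps)
    then show ?thesis by (simp add: dF_apply[OF assms] scaleR_sum_right)
  qed
  show ?thesis
    unfolding eq by (subst sum.swap) (simp add: N_sym[of _ i for i] mult.commute)
qed

lemma chart_inverse:
  obtains R u where "R > 0" "u 0 = 0" "\<And>y. y \<in> ball 0 R \<Longrightarrow> u y \<in> U"
    "\<And>y. y \<in> ball 0 R \<Longrightarrow> (u has_derivative F (y, u y)) (at y)"
proof -
  have app: "blinfun_apply (Blinfun (dF z)) = dF z" if "z \<in> UNIV \<times> U" for z
    by (rule bounded_linear_Blinfun_apply[OF has_derivative_bounded_linear[OF F_derivative[OF that]]])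
  obtain R u where "R > 0" "u 0 = 0" "\<And>y. y \<in> ball 0 R \<Longrightarrow> (y, u y) \<in> UNIV \<times> U"
    "\<And>y. y \<in> ball 0 R \<Longrightarrow> (u has_derivative F (y, u y)) (at y)"
  proof (rule frobenius_solution[of "UNIV \<times> U" 0 F "\<lambda>z. Blinfun (dF z)"])
    show "open ((UNIV :: (real^'n) set) \<times> U)" by (intro open_Times open_UNIV open_U)
    show "(F has_derivative blinfun_apply (Blinfun (dF z))) (at z)" if "z \<in> UNIV \<times> U" for z
      unfolding app[OF that] by (rule F_derivative[OF that])
    show "continuous_on (UNIV \<times> U) (\<lambda>z. Blinfun (dF z))"
    proof (rule continuous_on_blinfun_componentwise)
      fix h :: "(real^'n) \<times> (real^'n)"
      show "continuous_on (UNIV \<times> U) (\<lambda>z. blinfun_apply (Blinfun (dF z)) h)"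
        by (rule continuous_on_eq[OF continuous_on_dF[of h]]) (simp only: app)
    qed
    show "blinfun_apply (Blinfun (dF z)) (a, F z a) b = blinfun_apply (Blinfun (dF z)) (b, F z b) a"
      if "z \<in> UNIV \<times> U" for z a b
      using dF_symmetric[of "snd z" "fst z" a b] that unfolding app[OF that] by auto
  qed (use zero_U in auto)
  then show thesis using that by auto
qed

text \<open>Bootstrapping: if \<open>u\<close> has order \<open>k\<close>, so does the right-hand
  side \<open>F (y, u y)\<close>, which is the derivative of \<open>u\<close>.\<close>

lemma solution_Ck:
  assumes "open S" "\<And>y. y \<in> S \<Longrightarrow> u y \<in> U" "\<And>y. y \<in> S \<Longrightarrow> (u has_derivative F (y, u y)) (at y)"
  shows "Ck_on k S u"
proof (induction k)
  case 0
  show ?case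
    using has_derivative_continuous[OF assms(3)] by (simp add: continuous_at_imp_continuous_on)
next
  case (Suc k)
  show ?case
  proof (rule Ck_on_SucI[OF assms(1,3)])
    fix v
    have "Ck_on k S (\<lambda>y. b (u y))" if "b \<in> B" for b
      using Ck_on_compose[OF assms(1) open_U vector_field_Ck Suc.IH, of b] fields basis_span[OF that] assms(2)
      by blast
    then have "Ck_on k S (\<lambda>y. \<Sum>i\<in>UNIV. v $ i *\<^sub>R (\<Sum>b\<in>B. \<phi> b (Z y i) *\<^sub>R b (u y)))"
      by (intro Ck_on_sum[OF assms(1)] Ck_on_scaleR[OF assms(1)] Ck_on_const
          Ck_on_subset[OF real_poly_exp_Ck[OF coord_Z_poly_exp]]) auto
    then show "Ck_on k S (\<lambda>y. F (y, u y) v)"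
      by (simp add: F_apply field_expand[OF Z_span])
  qed
qed

text \<open>Along each ray, a field of the transported isotropy algebra satisfies a homogeneous linear
  differential equation at the moving point.\<close>

lemma isotropy_transport:
  assumes u0: "u 0 = 0" and uU: "\<And>y. y \<in> ball 0 R \<Longrightarrow> u y \<in> U"
    and du: "\<And>y. y \<in> ball 0 R \<Longrightarrow> (u has_derivative F (y, u y)) (at y)"
    and W: "W \<in> span B" "W 0 = 0" and y: "y \<in> ball 0 R"
  shows "ad_prod Y (blocks_from 0) y W (u y) = 0"
proof -
  define w where "w y = ad_prod Y (blocks_from 0) y W" for y
  define dw where "dw y h = (\<Sum>k\<in>UNIV. h $ k *\<^sub>R br (Z y k) (w y))" for y h
  define f where "f y = w y (u y)" for y
  have w_span: "w y \<in> span B" for y unfolding w_def by (rule ad_prod_closed[where Y = Y, OF Y_span W(1)])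
  have dw_span: "dw y h \<in> span B" for y h
    unfolding dw_def by (intro span_sum span_scale br_closed Z_span w_span)
  \<comment> \<open>The point and the field both move. The bracket contained in \<open>dw\<close>
    cancels the derivative of \<open>w y\<close> along the frame, and what remains is linear in the
    value \<open>f y\<close>.\<close>
  have df: "(f has_derivative (\<lambda>h. \<Sum>k\<in>UNIV. h $ k *\<^sub>R fderiv (Z y k) (u y) (f y))) (at y)"
    if y: "y \<in> ball 0 R" for y
  proof -
    have phi_w: "((\<lambda>y. \<phi> b (w y)) has_derivative (\<lambda>h. \<phi> b (dw y h))) (at y)" if "b \<in> B" for b
      using coord_derivative_ad_prod[where Y = Y, OF Y_span distinct_blocks_from[of 0] W(1), of y] that
      unfolding coord_derivative_def w_def dw_def Z_def set_blocks by blast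
    have "((\<lambda>y. \<Sum>b\<in>B. \<phi> b (w y) *\<^sub>R b (u y)) has_derivative
        (\<lambda>h. \<Sum>b\<in>B. \<phi> b (w y) *\<^sub>R fderiv b (u y) (F (y, u y) h) + \<phi> b (dw y h) *\<^sub>R b (u y))) (at y)"
      by (intro has_derivative_sum has_derivative_scaleR phi_w has_derivative_compose[OF du[OF y]]
          field_derivative basis_span uU[OF y])
    moreover have "(\<Sum>b\<in>B. \<phi> b (w y) *\<^sub>R fderiv b (u y) (F (y, u y) h) + \<phi> b (dw y h) *\<^sub>R b (u y))
        = (\<Sum>k\<in>UNIV. h $ k *\<^sub>R fderiv (Z y k) (u y) (f y))" for h
    proof -
      have "(\<Sum>b\<in>B. \<phi> b (w y) *\<^sub>R fderiv b (u y) (F (y, u y) h) + \<phi> b (dw y h) *\<^sub>R b (u y))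
          = fderiv (w y) (u y) (F (y, u y) h) + dw y h (u y)"
        by (simp add: sum.distrib fderiv_expand[OF w_span uU[OF y]] field_expand[OF dw_span])
      also have "fderiv (w y) (u y) (F (y, u y) h) = (\<Sum>k\<in>UNIV. h $ k *\<^sub>R fderiv (w y) (u y) (Z y k (u y)))"
        by (simp add: F_apply linear_sum[OF linear_fderiv[OF w_span uU[OF y]]]
            linear_cmul[OF linear_fderiv[OF w_span uU[OF y]]])
      also have "dw y h (u y) = (\<Sum>k\<in>UNIV. h $ k *\<^sub>R
          (fderiv (Z y k) (u y) (f y) - fderiv (w y) (u y) (Z y k (u y))))"
        by (simp add: dw_def sum_fun_apply scaleR_fun_def br_apply[OF Z_span w_span uU[OF y]] f_def)
      finally show ?thesis by (simp add: scaleR_diff_right sum_subtractf)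
    qed
    ultimately have "((\<lambda>y. \<Sum>b\<in>B. \<phi> b (w y) *\<^sub>R b (u y)) has_derivative
        (\<lambda>h. \<Sum>k\<in>UNIV. h $ k *\<^sub>R fderiv (Z y k) (u y) (f y))) (at y)" by (simp only:)
    moreover have "(\<lambda>y. \<Sum>b\<in>B. \<phi> b (w y) *\<^sub>R b (u y)) = f"
      unfolding f_def using field_expand[OF w_span] by auto
    ultimately show ?thesis by (simp only:)
  qed
  have ray: "t *\<^sub>R y \<in> ball 0 R" if "t \<in> {0..1}" for t
  proof -
    have "\<bar>t\<bar> * norm y \<le> norm y" using that by (simp add: mult_left_le_one_le)
    then show ?thesis using y by simp
  qed
  \<comment> \<open>A bound for the norm of the linear map governing the equation along the ray,
    written out in basis fields and standard vectors so that its continuity in \<open>t\<close> is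
    evident.\<close>
  define \<kappa> where "\<kappa> t = (\<Sum>k\<in>UNIV. \<Sum>b\<in>B. \<bar>y $ k\<bar> * (\<bar>\<phi> b (Z (t *\<^sub>R y) k)\<bar> *
      (\<Sum>i\<in>UNIV. norm (fderiv b (u (t *\<^sub>R y)) (axis i 1)))))" for t
  have "continuous_on {0..1} (\<lambda>t. u (t *\<^sub>R y))"
  proof (rule continuous_on_compose2[of "ball 0 R" u])
    show "continuous_on (ball 0 R) u"
      using has_derivative_continuous[OF du] by (simp add: continuous_at_imp_continuous_on)
  qed (use ray in \<open>auto intro!: continuous_intros\<close>)
  then have cont_fderiv: "continuous_on {0..1} (\<lambda>t. fderiv b (u (t *\<^sub>R y)) h)" if "b \<in> B" for b h
    by (rule continuous_on_compose2[OF continuous_on_fderiv[OF that]]) (use uU ray in auto)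
  have cont_Z: "continuous_on {0..1} (\<lambda>t. \<phi> b (Z (t *\<^sub>R y) k))" if "b \<in> B" for b k
    by (rule continuous_on_compose2[OF continuous_on_coord_Z[OF that, of UNIV]])
       (auto intro!: continuous_intros)
  have "continuous_on {0..1} \<kappa>"
    unfolding \<kappa>_def
    by (intro continuous_on_sum continuous_on_mult continuous_on_const continuous_on_rabs continuous_on_norm
        cont_Z cont_fderiv)
  then have "\<exists>m\<in>{0..1}. \<forall>t\<in>{0..1}. \<kappa> t \<le> \<kappa> m"
    by (intro continuous_attains_sup) auto
  then obtain C where C: "\<And>t. t \<in> {0..1} \<Longrightarrow> \<kappa> t \<le> C" by blast
  have "f (1 *\<^sub>R y) = 0"
  proof (rule linear_ode_zero[of "\<lambda>t. f (t *\<^sub>R y)"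
        "\<lambda>t. \<Sum>k\<in>UNIV. y $ k *\<^sub>R fderiv (Z (t *\<^sub>R y) k) (u (t *\<^sub>R y)) (f (t *\<^sub>R y))" C])
    fix t :: real assume t: "t \<in> {0..1}"
    let ?x = "u (t *\<^sub>R y)" and ?v = "f (t *\<^sub>R y)"
    have "((\<lambda>t. t *\<^sub>R y) has_derivative (\<lambda>s. s *\<^sub>R y)) (at t)"
      by (intro has_derivative_scaleR_left has_derivative_ident)
    from has_derivative_compose[OF this df[OF ray[OF t]]]
    show "((\<lambda>t. f (t *\<^sub>R y)) has_vector_derivative (\<Sum>k\<in>UNIV. y $ k *\<^sub>R fderiv (Z (t *\<^sub>R y) k) ?x ?v)) (at t)"
      by (simp add: has_vector_derivative_def scaleR_sum_right)
    have b: "norm (fderiv b ?x ?v) \<le> (\<Sum>i\<in>UNIV. norm (fderiv b ?x (axis i 1))) * norm ?v" if "b \<in> B" for b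
    proof -
      have "norm (fderiv b ?x ?v) \<le> (\<Sum>i\<in>UNIV. norm (?v $ i *\<^sub>R fderiv b ?x (axis i 1)))"
        unfolding linear_sum_axis[OF linear_fderiv[OF basis_span[OF that] uU[OF ray[OF t]]], of ?v]
        by (rule norm_sum)
      also have "\<dots> \<le> (\<Sum>i\<in>UNIV. norm (fderiv b ?x (axis i 1)) * norm ?v)"
        by (intro sum_mono) (simp add: mult.commute[of _ "norm ?v"] mult_right_mono component_le_norm_cart)
      finally show ?thesis by (simp add: sum_distrib_right)
    qed
    have "norm (\<Sum>k\<in>UNIV. y $ k *\<^sub>R fderiv (Z (t *\<^sub>R y) k) ?x ?v)
        \<le> (\<Sum>k\<in>UNIV. \<bar>y $ k\<bar> * norm (fderiv (Z (t *\<^sub>R y) k) ?x ?v))"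
      by (rule order_trans[OF norm_sum]) simp
    also have "\<dots> \<le> (\<Sum>k\<in>UNIV. \<bar>y $ k\<bar> * (\<Sum>b\<in>B. \<bar>\<phi> b (Z (t *\<^sub>R y) k)\<bar> * norm (fderiv b ?x ?v)))"
      unfolding fderiv_expand[OF Z_span uU[OF ray[OF t]]]
      by (intro sum_mono mult_left_mono order_trans[OF norm_sum]) auto
    also have "\<dots> \<le> (\<Sum>k\<in>UNIV. \<bar>y $ k\<bar> * (\<Sum>b\<in>B. \<bar>\<phi> b (Z (t *\<^sub>R y) k)\<bar> *
        ((\<Sum>i\<in>UNIV. norm (fderiv b ?x (axis i 1))) * norm ?v)))"
      by (intro sum_mono mult_left_mono b) auto
    also have "\<dots> = \<kappa> t * norm ?v"
      by (simp add: \<kappa>_def sum_distrib_left sum_distrib_right mult.assoc)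
    also have "\<dots> \<le> C * norm ?v" using C[OF t] by (intro mult_right_mono) auto
    finally show "norm (\<Sum>k\<in>UNIV. y $ k *\<^sub>R fderiv (Z (t *\<^sub>R y) k) ?x ?v) \<le> C * norm ?v" .
  next
    show "f (0 *\<^sub>R y) = 0"
      using W(2) by (simp add: f_def w_def u0 ad_prod_0[where Y = Y, OF Y_span])
  qed
  then show ?thesis by (simp add: f_def w_def)
qed

text \<open>At 0 the frame is \<open>Y\<close> itself, whose values at 0 are dual to
  \<open>\<psi>\<close>; hence \<open>\<psi>\<close> assembles to the left inverse that the inverse
  function theorem requires.\<close>

lemma F_injective_at_0:
  obtains G where "G o\<^sub>L F (0, 0) = id_blinfun"
proof -
  define G where "G = Blinfun (\<lambda>u. \<Sum>j\<in>UNIV. \<psi> j u *\<^sub>R axis j 1 :: real^'n)"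
  have "linear (\<lambda>u. \<Sum>j\<in>UNIV. \<psi> j u *\<^sub>R axis j 1 :: real^'n)"
    by (simp add: linear_iff linear_add[OF linear_\<psi>] linear_cmul[OF linear_\<psi>] scaleR_add_left sum.distrib
        scaleR_sum_right)
  then have G: "G u = (\<Sum>j\<in>UNIV. \<psi> j u *\<^sub>R axis j 1)" for u
    unfolding G_def by (subst bounded_linear_Blinfun_apply) (simp_all add: linear_conv_bounded_linear)
  have "\<psi> j (F (0, 0) v) = v $ j" for j v
  proof -
    have "Z 0 i = Y i" for i
      unfolding Z_def frame_def by (rule ad_prod_0[where Y = Y, OF Y_span])
    then show ?thesis
      by (simp add: F_apply linear_sum[OF linear_\<psi>] linear_cmul[OF linear_\<psi>] coframe if_distrib
          cong: if_cong)
  qed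
  then have "G o\<^sub>L F (0, 0) = id_blinfun"
    by (intro blinfun_eqI) (simp add: G vec_eq_iff axis_def if_distrib cong: if_cong)
  then show thesis by (rule that)
qed

theorem poly_exp_chart:
  "\<exists>V y. local_coordinates V y \<and> 0 \<in> V \<and> V \<subseteq> U \<and>
    (\<forall>X\<in>span B. \<exists>c :: 'n \<Rightarrow> real^'n \<Rightarrow> real.
       (\<forall>x\<in>V. X x = (\<Sum>i\<in>UNIV. c i x *\<^sub>R coord_field V y i x)) \<and>
       (\<forall>i. \<exists>f\<in>poly_exp_algebra y. \<forall>x\<in>V. complex_of_real (c i x) = f x))"
proof -
  obtain R u where R: "R > 0" and u0: "u 0 = 0" and uU: "\<And>y. y \<in> ball 0 R \<Longrightarrow> u y \<in> U"
    and du: "\<And>y. y \<in> ball 0 R \<Longrightarrow> (u has_derivative F (y, u y)) (at y)"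
    by (rule chart_inverse) blast
  obtain G where G: "G o\<^sub>L F (0, u 0) = id_blinfun" using F_injective_at_0 u0 by auto
  have cont_u: "continuous_on (ball 0 R) u"
    using has_derivative_continuous[OF du] by (simp add: continuous_at_imp_continuous_on)
  have "continuous_on (UNIV \<times> U) F"
    using has_derivative_continuous[OF F_derivative] by (simp add: continuous_at_imp_continuous_on)
  then have cont_F: "continuous_on (ball 0 R) (\<lambda>y. F (y, u y))"
    by (rule continuous_on_compose2) (use cont_u uU in \<open>auto intro!: continuous_intros\<close>)
  \<comment> \<open>The chart is the local inverse of \<open>u\<close>. Here it is only
    differentiable; smoothness follows from \<open>Ck_on_inverse_map\<close>.\<close>
  obtain S V y y' where S: "open S" "S \<subseteq> ball 0 R" "0 \<in> S" and V: "open V" "u 0 \<in> V"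
    and hom: "homeomorphism S V u y"
    and dy: "\<And>x. x \<in> V \<Longrightarrow> (y has_derivative y' x) (at x)"
    and y': "\<And>x. x \<in> V \<Longrightarrow> y' x = inv (blinfun_apply (F (y x, u (y x))))"
    and bij: "\<And>x. x \<in> V \<Longrightarrow> bij (blinfun_apply (F (y x, u (y x))))"
    using inverse_function_theorem[OF open_ball du cont_F _ G] R by (metis centre_in_ball)
  have yS: "y x \<in> S" and uy: "u (y x) = x" if "x \<in> V" for x
    using homeomorphism_image2[OF hom] homeomorphism_apply2[OF hom] that by blast+
  have uV: "u s \<in> V" and yu: "y (u s) = s" if "s \<in> S" for s
    using homeomorphism_image1[OF hom] homeomorphism_apply1[OF hom] that by blast+
  have inj_y: "inj_on y V" by (metis inj_onI uy)
  have yV: "y ` V = S" by (rule homeomorphism_image2[OF hom])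
  have inv_y: "inv_into V y s = u s" if "s \<in> S" for s
    using inv_into_f_eq[OF inj_y uV[OF that] yu[OF that]] .
  have du': "(u has_derivative F (s, u s)) (at s)" if "s \<in> S" for s
    using du S(2) that by blast
  have Ck_u: "Ck_on k S u" for k
    using uU S(2) by (intro solution_Ck[OF S(1)] du') auto
  have fd_u: "fderiv u s = F (s, u s)" if "s \<in> S" for s
    using frechet_derivative_at[OF du'[OF that]] by simp
  have "Ck_on k V y" for k
  proof (rule Ck_on_inverse_map[OF S(1) V(1) _ _ dy])
    show "smooth_on S u" by (simp add: smooth_on_def Ck_u)
    show "fderiv u (y x) (y' x v) = v" if "x \<in> V" for x v
      using fd_u[OF yS[OF that]] y'[OF that] bij_is_surj[OF bij[OF that]] by (simp add: surj_f_inv_f)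
  qed (use yV in auto)
  moreover have "Ck_on k S (inv_into V y)" for k
    by (rule Ck_on_cong[OF S(1) _ Ck_u]) (simp add: inv_y)
  ultimately have "local_coordinates V y"
    using V(1) S(1) inj_y yV by (simp add: local_coordinates_def smooth_on_def)
  moreover have "0 \<in> V" using V(2) u0 by simp
  moreover have "V \<subseteq> U" using uy yS uU S(2) by (metis subset_iff)
  moreover have "\<exists>c :: 'n \<Rightarrow> real^'n \<Rightarrow> real. (\<forall>x\<in>V. X x = (\<Sum>i\<in>UNIV. c i x *\<^sub>R coord_field V y i x)) \<and>
       (\<forall>i. \<exists>f\<in>poly_exp_algebra y. \<forall>x\<in>V. complex_of_real (c i x) = f x)" if X: "X \<in> span B" for X
  proof -
    have coord: "coord_field V y i x = Z (y x) i x" if x: "x \<in> V" for i x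
    proof -
      have "(inv_into V y has_derivative F (y x, u (y x))) (at (y x))"
        by (rule has_derivative_transform_within_open[OF du'[OF yS[OF x]] S(1) yS[OF x]]) (simp add: inv_y)
      from frechet_derivative_at[OF this] have "coord_field V y i x = F (y x, x) (axis i 1)"
        by (simp add: coord_field_def uy[OF x])
      also have "\<dots> = (\<Sum>j\<in>UNIV. if j = i then Z (y x) i x else 0)"
        unfolding F_apply by (rule sum.cong) (auto simp: axis_def)
      finally show ?thesis by simp
    qed
    obtain c where c: "\<And>j. real_poly_exp (c j)"
      "\<And>y. \<exists>W\<in>span B. (\<forall>j. \<psi> j (W 0) = 0) \<and>
        X - (\<Sum>j\<in>UNIV. c j y *\<^sub>R Z y j) = ad_prod Y (blocks_from 0) y W"
      using poly_exp_coefficients[OF _ X, of 0] unfolding Z_def set_blocks by auto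
    show ?thesis
    proof (intro exI[of _ "\<lambda>i x. c i (y x)"] conjI ballI allI)
      fix x assume x: "x \<in> V"
      obtain W where W: "W \<in> span B" "\<forall>j. \<psi> j (W 0) = 0"
        "X - (\<Sum>j\<in>UNIV. c j (y x) *\<^sub>R Z (y x) j) = ad_prod Y (blocks_from 0) (y x) W"
        using c(2)[of "y x"] by blast
      \<comment> \<open>\<open>W\<close> is an isotropy field at 0, so its transport vanishes at
        \<open>u (y x) = x\<close> and the remainder drops out of the decomposition of
        \<open>X\<close> on evaluation at \<open>x\<close>.\<close>
      have "W 0 = 0" using \<psi>_zero W(2) by blast
      from isotropy_transport[OF u0 uU du W(1) this, where y = "y x"] yS[OF x] S(2)
      have "ad_prod Y (blocks_from 0) (y x) W x = 0" by (auto simp: uy[OF x])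
      then have "X x - (\<Sum>j\<in>UNIV. c j (y x) *\<^sub>R Z (y x) j x) = 0"
        using fun_cong[OF W(3), of x] by (simp add: sum_fun_apply scaleR_fun_def)
      then show "X x = (\<Sum>i\<in>UNIV. c i (y x) *\<^sub>R coord_field V y i x)"
        by (simp add: coord[OF x])
    next
      fix i
      have "(\<lambda>x. complex_of_real (c i (y x))) \<in> poly_exp_algebra y"
        using poly_exp_algebra_comp[OF c(1)[of i, unfolded real_poly_exp_def], of y] .
      then show "\<exists>f\<in>poly_exp_algebra y. \<forall>x\<in>V. complex_of_real (c i (y x)) = f x"
        by (rule bexI[rotated]) simp
    qed
  qed
  ultimately show ?thesis by blast
qed

end

section \<open>Adapted data for a solvable transitive algebra of vector fields\<close>

theorem theorem5p1:
  fixes U :: "(real^'n) set" and L :: "(real^'n \<Rightarrow> real^'n) set"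
  assumes "local_lie_algebra U L"
    and "transitive_at_0 L"
    and "finite_dimensional L"
    and "solvable_lie_algebra U L"
  shows "\<exists>V y. local_coordinates V y \<and> 0 \<in> V \<and> V \<subseteq> U \<and>
    (\<forall>X\<in>L. \<exists>c :: 'n \<Rightarrow> real^'n \<Rightarrow> real.
       (\<forall>x\<in>V. X x = (\<Sum>i\<in>UNIV. c i x *\<^sub>R coord_field V y i x)) \<and>
       (\<forall>i. \<exists>f\<in>poly_exp_algebra y. \<forall>x\<in>V. complex_of_real (c i x) = f x))"
proof -
  have U: "open U" "0 \<in> U" and LU: "L \<subseteq> vector_fields U" and sub: "subspace L"
    and closed: "\<And>X Y. X \<in> L \<Longrightarrow> Y \<in> L \<Longrightarrow> lie_bracket U X Y \<in> L"
    using assms(1) by (auto simp: local_lie_algebra_def)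
  obtain B0 where B0: "finite B0" "B0 \<subseteq> L" "L \<subseteq> span B0"
    using assms(3) by (auto simp: finite_dimensional_def)
  obtain B where B: "B \<subseteq> B0" "independent B" "B0 \<subseteq> span B"
    by (rule maximal_independent_subset)
  have finB: "finite B" using B(1) B0(1) finite_subset by blast
  have BL: "B \<subseteq> L" using B(1) B0(2) by blast
  have "span B0 \<subseteq> span B" by (intro span_minimal B(3) subspace_span)
  then have L: "span B = L" using span_minimal[OF BL sub] B0(3) by blast
  have BU: "B \<subseteq> vector_fields U" using BL LU by blast
  have "\<forall>b. \<exists>f. linear f \<and> (\<forall>x\<in>B. f x = (if x = b then 1 else 0 :: real))"
    by (intro allI linear_independent_extend B(2))
  from choice[OF this] obtain \<phi> where \<phi>: "\<And>b. linear (\<phi> b)"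
    "\<And>b x. x \<in> B \<Longrightarrow> \<phi> b x = (if x = b then 1 else 0 :: real)" by blast
  have expand: "(\<Sum>b\<in>B. \<phi> b V *\<^sub>R b) = V" if "V \<in> L" for V
  proof -
    have lin: "linear (\<lambda>V. \<Sum>b\<in>B. \<phi> b V *\<^sub>R b)"
      by (simp add: linear_iff linear_add[OF \<phi>(1)] linear_cmul[OF \<phi>(1)] scaleR_add_left sum.distrib
          scaleR_sum_right)
    have "(\<Sum>b\<in>B. \<phi> b x *\<^sub>R b) = id x" if "x \<in> B" for x
    proof -
      have "(\<Sum>b\<in>B. \<phi> b x *\<^sub>R b) = (\<Sum>b\<in>B. if b = x then x else 0)"
        using \<phi>(2)[OF that] by (intro sum.cong) auto
      then show ?thesis using that finB by simp
    qed
    then have "(\<Sum>b\<in>B. \<phi> b V *\<^sub>R b) = id V"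
      by (rule linear_eq_on_span[OF lin linear_id, of B]) (auto simp: L that)
    then show ?thesis by simp
  qed
  \<comment> \<open>\<open>lie_bracket\<close> is not linear on functions that fail to be
    differentiable. Defined through the coordinates, \<open>br\<close> is bilinear on the entire
    function space and agrees with the reversed bracket on \<open>L\<close>.\<close>
  define br where "br V W = (\<Sum>b\<in>B. \<Sum>c\<in>B. (\<phi> b V * \<phi> c W) *\<^sub>R lie_bracket U c b)" for V W
  have br: "br V W = lie_bracket U W V" if "V \<in> L" "W \<in> L" for V W
    using lie_bracket_combination[OF BU, of "\<lambda>c. \<phi> c W" "\<lambda>b. \<phi> b V"]
    unfolding expand[OF that(1)] expand[OF that(2)] br_def by (rule sym)
  have brL: "br V W \<in> L" if "V \<in> L" "W \<in> L" for V W
    using br[OF that] closed that by simp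
  interpret fin_dim_lie B \<phi> br
  proof (rule fin_dim_lie.intro)
    show "finite B" by (rule finB)
    show "linear (\<phi> b)" for b by (rule \<phi>)
    show "linear (\<lambda>V. br V W)" for W
      by (simp add: br_def linear_iff linear_add[OF \<phi>(1)] linear_cmul[OF \<phi>(1)]
          distrib_right scaleR_add_left sum.distrib scaleR_sum_right mult.assoc)
    show "linear (br V)" for V
      by (simp add: br_def linear_iff linear_add[OF \<phi>(1)] linear_cmul[OF \<phi>(1)] distrib_left
          distrib_right scaleR_add_left sum.distrib scaleR_sum_right mult.assoc mult.left_commute)
    show "(\<Sum>b\<in>B. \<phi> b V *\<^sub>R b) = V" if "V \<in> span B" for V using expand that L by simp
    show "br V W \<in> span B" if "V \<in> span B" "W \<in> span B" for V W using brL that L by simp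
    show "br V V = 0" if "V \<in> span B" for V
      using br[of V V] that L by (auto simp: lie_bracket_def fun_eq_iff)
    show "br X (br V W) = br (br X V) W + br V (br X W)"
      if "X \<in> span B" "V \<in> span B" "W \<in> span B" for X V W
      using lie_bracket_jacobi[OF U(1), of V W X] that LU unfolding L by (simp add: br closed subset_iff)
  qed
  define g where "g k = (derived_algebra U ^^ k) L" for k
  have g_Suc: "g (Suc k) = span {lie_bracket U X Y |X Y. X \<in> g k \<and> Y \<in> g k}" for k
    by (simp add: g_def derived_algebra_def)
  \<comment> \<open>Each member of the derived series is an ideal of all of \<open>L\<close>: the
    Jacobi identity moves \<open>V\<close> into one of the two arguments of a generating bracket,
    where the previous ideal absorbs it.\<close>
  have g: "subspace (g k) \<and> g k \<subseteq> L \<and> (\<forall>V\<in>L. \<forall>W\<in>g k. br V W \<in> g k)" for k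
  proof (induction k)
    case 0
    then show ?case using sub brL by (simp add: g_def)
  next
    case (Suc k)
    let ?G = "{lie_bracket U X Y |X Y. X \<in> g k \<and> Y \<in> g k}"
    have "?G \<subseteq> L" using closed Suc by blast
    then have GL: "g (Suc k) \<subseteq> L" unfolding g_Suc by (rule span_minimal[OF _ sub])
    have "br V W \<in> g (Suc k)" if V: "V \<in> L" and W: "W \<in> g (Suc k)" for V W
    proof -
      have "br V G \<in> span ?G" if G: "G \<in> ?G" for G
      proof -
        obtain X Y where XY: "G = lie_bracket U X Y" "X \<in> g k" "Y \<in> g k" using G by blast
        have XYL: "X \<in> L" "Y \<in> L" using XY Suc by blast+
        have brg: "br V X \<in> g k" "br V Y \<in> g k" using Suc V XY by blast+
        have "br V G = br (br V Y) X + br Y (br V X)"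
          using jacobi[of V Y X] V XYL L by (simp add: XY(1) br closed)
        also have "\<dots> = lie_bracket U X (br V Y) + lie_bracket U (br V X) Y"
          using XYL V by (simp add: br closed)
        also have "\<dots> \<in> span ?G"
          using XY brg by (intro span_add span_base) blast+
        finally show ?thesis .
      qed
      then have "span (br V ` ?G) \<subseteq> span ?G" by (intro span_minimal subspace_span image_subsetI)
      moreover have "br V W \<in> span (br V ` ?G)"
        unfolding linear_span_image[OF linear_br] using W[unfolded g_Suc] by (rule imageI)
      ultimately show ?thesis unfolding g_Suc by (rule subsetD)
    qed
    then show ?case using GL by (simp add: g_Suc subspace_span)
  qed
  have g_dec: "g (Suc k) \<subseteq> g k" for k
  proof -
    have "lie_bracket U X Y \<in> g k" if "X \<in> g k" "Y \<in> g k" for X Y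
      using g[of k] that br[of Y X] by (metis subsetD)
    then have "{lie_bracket U X Y |X Y. X \<in> g k \<and> Y \<in> g k} \<subseteq> g k" by blast
    then show ?thesis unfolding g_Suc by (rule span_minimal) (use g in blast)
  qed
  obtain r where r: "g r = {0}"
    using assms(4) by (auto simp: solvable_lie_algebra_def g_def)
  \<comment> \<open>Transitivity makes this chain start at the whole tangent space, and solvability
    makes it end at 0.\<close>
  define H where "H k = (\<lambda>X. X 0) ` g k" for k
  have lin_eval: "linear (\<lambda>X :: real^'n \<Rightarrow> real^'n. X 0)"
    by (simp add: linear_iff scaleR_fun_def)
  have H: "subspace (H k)" for k
    unfolding H_def using g[of k] by (intro linear_subspace_image lin_eval) blast
  have "H (Suc k) \<subseteq> H k" for k unfolding H_def using g_dec by (rule image_mono)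
  moreover have "H r = {0}" by (simp add: H_def r)
  moreover have "H 0 = UNIV"
  proof -
    have "{X 0 |X. X \<in> L} = H 0" by (auto simp: H_def g_def)
    then show ?thesis
      using assms(2) H[of 0] span_eq_iff[of "H 0"] by (simp add: transitive_at_0_def)
  qed
  ultimately obtain v :: "'n \<Rightarrow> real^'n" and \<psi> :: "'n \<Rightarrow> real^'n \<Rightarrow> real" and lev
    where v: "\<And>j. v j \<in> H (lev j)" "\<And>j. lev j < r"
    and \<psi>: "\<And>j. linear (\<psi> j)" "\<And>i j. \<psi> i (v j) = (if i = j then 1 else 0)"
      "\<And>j k u. u \<in> H k \<Longrightarrow> lev j < k \<Longrightarrow> \<psi> j u = 0" "\<And>u. (\<And>j. \<psi> j u = 0) \<Longrightarrow> u = 0"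
    by (rule adapted_coframe[OF H]) blast
  \<comment> \<open>Every basis vector is lifted to a field in the derived algebra of its own level,
    which ties the linear algebra at 0 to the chain of ideals.\<close>
  have "\<forall>j. \<exists>X. X \<in> g (lev j) \<and> X 0 = v j" using v(1) by (fastforce simp: H_def)
  from choice[OF this] obtain Y where Y: "\<And>j. Y j \<in> g (lev j)" "\<And>j. Y j 0 = v j" by blast
  interpret adapted_fields U B \<phi> br Y \<psi> lev g r
  proof (intro adapted_fields.intro adapted_frame.intro adapted_frame_axioms.intro
      adapted_fields_axioms.intro fin_dim_lie_axioms)
    show "linear (\<lambda>X :: real^'n \<Rightarrow> real^'n. \<psi> j (X 0))" for j
      using linear_compose[OF lin_eval \<psi>(1)] by (simp add: o_def)
    show "\<psi> i (Y j 0) = (if i = j then 1 else 0)" for i j by (simp add: Y(2) \<psi>(2))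
    show "subspace (g k)" for k using g by blast
    show "g k \<subseteq> span B" for k using g L by blast
    show "br V W \<in> g k" if "V \<in> span B" "W \<in> g k" for V W k using g[of k] that L by blast
    show "br V W \<in> g (Suc k)" if "V \<in> g k" "W \<in> g k" for V W k
    proof -
      have "br V W = lie_bracket U W V" using g[of k] that by (intro br) auto
      then show ?thesis unfolding g_Suc using that by (intro span_base) blast
    qed
    show "Y j \<in> g (lev j)" for j by (rule Y)
    show "lev j < r" for j by (rule v)
    show "\<psi> j (V 0) = 0" if "V \<in> g k" "lev j < k" for V k j
      using \<psi>(3)[of "V 0" k j] that by (simp add: H_def)
    show "open U" "0 \<in> U" "span B \<subseteq> vector_fields U" using U LU L by simp_all
    show "br V W = lie_bracket U W V" if "V \<in> span B" "W \<in> span B" for V W using br that L by simp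
    show "linear (\<psi> j)" for j by (rule \<psi>(1))
    show "u = 0" if "\<And>j. \<psi> j u = 0" for u using \<psi>(4) that by blast
  qed
  show ?thesis using poly_exp_chart unfolding L .
qed

end
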